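(* Let $K$ be an algebraically closed field and let $d$ and $n$ be integers such that $2\le n\le d+1$. (1) If $d$ is a multiple of $n-1$, then there is a family of $n$ (pairwise distinct) monomials in $K[X_0,X_1]$ of degree $d$, generating an $(X_0,X_1)$-primary ideal, such that their syzygy bundle on $\mathbb{P}^1$ is semistable. It is stable for $n=2$, and semistable, but not stable, otherwise. (2) If $d$ is not a multiple of $n-1$, there is no such family (i.e. no family of $n$ monomials in $K[X_0,X_1]$ of degree $d$, generating an $(X_0,X_1)$-primary ideal, has semistable syzygy bundle). (3) Moreover, if $d$ is not a multiple of $n-1$, and $f_1,\ldots,f_n$ is any family of homogeneous polynomials in $K[X_0,X_1]$ of degree $d$ such that the ideal $(f_1,\ldots,f_n)$ is $(X_0,X_1)$-primary, then their syzygy bundle $\mathrm{Syz}(f_1,\ldots,f_n)$ is not semistable.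
   Context: $\mathbb{P}^1$ is the projective line over $K$ with homogeneous coordinates $X_0,X_1$. If $f_1,\ldots,f_n\in K[X_0,X_1]$ are homogeneous polynomials of degree $d$ such that the ideal $(f_1,\ldots,f_n)$ is $(X_0,X_1)$-primary, their syzygy bundle $\mathrm{Syz}(f_1,\ldots,f_n)$ is the vector bundle of rank $n-1$ on $\mathbb{P}^1$ that is the kernel of the epimorphism $\bigoplus_{i=1}^n\mathcal{O}_{\mathbb{P}^1}(-d)\to\mathcal{O}_{\mathbb{P}^1}$, $(g_1,\ldots,g_n)\mapsto f_1g_1+\cdots+f_ng_n$. (Semi)stability is slope (semi)stability, with slope $\mu(E)=c_1(E)/\mathrm{rk}(E)$. *)

theory Defs
  imports
    "HOL-Computational_Algebra.Polynomial"
    "HOL-Computational_Algebra.Fraction_Field"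
    "Jordan_Normal_Form.Determinant"
begin

text \<open>
  The ring \<open>K[X\<^sub>0,X\<^sub>1]\<close> is \<open>'a poly poly\<close>, with \<open>X\<^sub>1\<close> the outer and \<open>X\<^sub>0\<close> the inner variable:
  \<open>coeff (coeff f j) i\<close> is the coefficient of \<open>X\<^sub>0\<^sup>i X\<^sub>1\<^sup>j\<close>. Its fraction field
  \<open>K(X\<^sub>0,X\<^sub>1)\<close> is \<open>'a poly poly fract\<close>.
\<close>

definition X0 :: "'a::field poly poly" where
  "X0 = [:[:0, 1:]:]"

definition X1 :: "'a::field poly poly" where
  "X1 = [:0, 1:]"

definition eval_form :: "'a::field poly poly \<Rightarrow> 'a \<Rightarrow> 'a \<Rightarrow> 'a" where
  "eval_form f a b = poly (poly f [:b:]) a"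

text \<open>As usual, the zero polynomial is homogeneous of every degree.\<close>

definition homogeneous :: "nat \<Rightarrow> 'a::field poly poly \<Rightarrow> bool" where
  "homogeneous k f \<longleftrightarrow> (\<forall>i j. coeff (coeff f j) i \<noteq> 0 \<longrightarrow> i + j = k)"

definition is_monomial :: "nat \<Rightarrow> 'a::field poly poly \<Rightarrow> bool" where
  "is_monomial k f \<longleftrightarrow> (\<exists>i j. i + j = k \<and> f = X0 ^ i * X1 ^ j)"


section \<open>Primary ideals\<close>

text \<open>An ideal of a commutative ring is a submodule of the ring as a module over itself.\<close>

definition ideal_generated :: "'r::comm_ring_1 set \<Rightarrow> 'r set" where
  "ideal_generated S = module.span (*) S"

definition ideal_radical :: "'r::comm_ring_1 set \<Rightarrow> 'r set" where
  "ideal_radical I = {x. \<exists>k. x ^ k \<in> I}"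

definition primary_ideal :: "'r::comm_ring_1 set \<Rightarrow> bool" where
  "primary_ideal I \<longleftrightarrow> module.subspace (*) I \<and> I \<noteq> UNIV \<and>
     (\<forall>x y. x * y \<in> I \<longrightarrow> x \<in> I \<or> y \<in> ideal_radical I)"

definition generates_primary :: "nat \<Rightarrow> (nat \<Rightarrow> 'a::field poly poly) \<Rightarrow> bool" where
  "generates_primary n f \<longleftrightarrow>
     (let I = ideal_generated (f ` {..<n})
      in primary_ideal I \<and> ideal_radical I = ideal_generated {X0, X1})"


section \<open>The projective line and its twisting sheaves\<close>

text \<open>
  A point \<open>(a : b)\<close> is the set of all its pairs of homogeneous coordinates. Only closed points
  are used; they determine the open subsets of the projective line and the sheaves on it.
\<close>

type_synonym 'a point = "('a \<times> 'a) set"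

definition proportional :: "(('a::field \<times> 'a) \<times> ('a \<times> 'a)) set" where
  "proportional = {((a, b), (a', b')). (a, b) \<noteq> (0, 0) \<and> (\<exists>c. c \<noteq> 0 \<and> a' = c * a \<and> b' = c * b)}"

definition P1 :: "'a::field point set" where
  "P1 = (UNIV - {(0, 0)}) // proportional"

definition nonvanishing :: "'a::field poly poly \<Rightarrow> 'a point \<Rightarrow> bool" where
  "nonvanishing f p \<longleftrightarrow> (\<forall>(a, b) \<in> p. eval_form f a b \<noteq> 0)"

definition zariski_open :: "'a::field point set \<Rightarrow> bool" where
  "zariski_open U \<longleftrightarrow>
     (\<exists>T. (\<forall>f\<in>T. \<exists>k. homogeneous k f) \<and> U = {p \<in> P1. \<exists>f\<in>T. nonvanishing f p})"

definition function_field :: "'a::field poly poly fract set" where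
  "function_field = {Fract g h | g h. h \<noteq> 0 \<and> (\<exists>k. homogeneous k g \<and> homogeneous k h)}"

text \<open>
  The stalk of \<open>\<O>(m)\<close> at \<open>p\<close>: fractions of homogeneous polynomials, of degree \<open>m\<close>, with
  denominator not vanishing at \<open>p\<close>. For \<open>m = 0\<close> this is the local ring at \<open>p\<close>.
\<close>

definition twist_stalk :: "int \<Rightarrow> 'a::field point \<Rightarrow> 'a poly poly fract set" where
  "twist_stalk m p = {Fract g h | g h. nonvanishing h p \<and>
     (\<exists>k l. homogeneous k g \<and> homogeneous l h \<and> int k = int l + m)}"

abbreviation local_ring :: "'a::field point \<Rightarrow> 'a poly poly fract set" where
  "local_ring p \<equiv> twist_stalk 0 p"

definition twist :: "int \<Rightarrow> 'a::field point set \<Rightarrow> 'a poly poly fract set" where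
  "twist m U = {s. \<forall>p\<in>U. s \<in> twist_stalk m p}"


section \<open>Subsheaves of direct sums of twisting sheaves\<close>

text \<open>
  All sheaves considered are subsheaves of some \<open>\<O>(m)\<^sup>n\<close>, so their sections over a nonempty open
  set are vectors over \<open>K(X\<^sub>0,X\<^sub>1)\<close> (indexed by \<open>nat\<close> and zero from \<open>n\<close> on) and the restriction
  maps are inclusions. Only the values at nonempty open sets matter: the section module over the
  empty set would have to be 0, which the inclusion convention does not accommodate.
\<close>

type_synonym 'a sheaf = "'a point set \<Rightarrow> (nat \<Rightarrow> 'a poly poly fract) set"

definition stalk :: "'a::field sheaf \<Rightarrow> 'a point \<Rightarrow> (nat \<Rightarrow> 'a poly poly fract) set" where
  "stalk F p = (\<Union>U \<in> {U. zariski_open U \<and> p \<in> U}. F U)"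

definition generic_stalk :: "'a::field sheaf \<Rightarrow> (nat \<Rightarrow> 'a poly poly fract) set" where
  "generic_stalk F = (\<Union>U \<in> {U. zariski_open U \<and> U \<noteq> {}}. F U)"

definition subsheaf :: "'a::field sheaf \<Rightarrow> 'a sheaf \<Rightarrow> bool" where
  "subsheaf F E \<longleftrightarrow>
     (\<forall>U. zariski_open U \<and> U \<noteq> {} \<longrightarrow>
        F U \<subseteq> E U \<and>
        (\<lambda>_. 0) \<in> F U \<and>
        (\<forall>s\<in>F U. \<forall>t\<in>F U. (\<lambda>i. s i + t i) \<in> F U) \<and>
        (\<forall>c\<in>twist 0 U. \<forall>s\<in>F U. (\<lambda>i. c * s i) \<in> F U) \<and>
        (\<forall>V. zariski_open V \<and> V \<noteq> {} \<and> V \<subseteq> U \<longrightarrow> F U \<subseteq> F V) \<and>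
        (\<forall>s. (\<forall>p\<in>U. \<exists>V. zariski_open V \<and> p \<in> V \<and> V \<subseteq> U \<and> s \<in> F V) \<longrightarrow> s \<in> F U))"

text \<open>
  A sheaf is of finite type if locally finitely many sections generate all stalks. On a
  locally noetherian scheme, a subsheaf of modules of a coherent sheaf is coherent iff it is of
  finite type.
\<close>

definition finite_type :: "'a::field sheaf \<Rightarrow> bool" where
  "finite_type F \<longleftrightarrow>
     (\<forall>p\<in>P1. \<exists>V G. zariski_open V \<and> p \<in> V \<and> finite G \<and> G \<subseteq> F V \<and>
        (\<forall>q\<in>V. \<forall>s\<in>stalk F q. \<exists>c. (\<forall>g\<in>G. c g \<in> local_ring q) \<and> s = (\<lambda>i. \<Sum>g\<in>G. c g * g i)))"

definition coherent_subsheaf :: "'a::field sheaf \<Rightarrow> 'a sheaf \<Rightarrow> bool" where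
  "coherent_subsheaf F E \<longleftrightarrow> subsheaf F E \<and> finite_type F"


section \<open>Rank, degree and slope\<close>

text \<open>\<open>v 0, \<dots>, v (r - 1)\<close> is a basis of the \<open>R\<close>-module \<open>M\<close>.\<close>

definition module_basis ::
    "'k::field set \<Rightarrow> (nat \<Rightarrow> 'k) set \<Rightarrow> nat \<Rightarrow> (nat \<Rightarrow> nat \<Rightarrow> 'k) \<Rightarrow> bool" where
  "module_basis R M r v \<longleftrightarrow>
     (\<forall>i<r. v i \<in> M) \<and>
     (\<forall>s\<in>M. \<exists>c. (\<forall>i<r. c i \<in> R) \<and> s = (\<lambda>j. \<Sum>i<r. c i * v i j)) \<and>
     (\<forall>c. (\<forall>i<r. c i \<in> R) \<and> (\<lambda>j. \<Sum>i<r. c i * v i j) = (\<lambda>_. 0) \<longrightarrow> (\<forall>i<r. c i = 0))"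

definition sheaf_rank :: "'a::field sheaf \<Rightarrow> nat" where
  "sheaf_rank F = (THE r. \<exists>v. module_basis function_field (generic_stalk F) r v)"

text \<open>
  The order of vanishing at \<open>p = (a : b)\<close> of a nonzero rational function is the multiplicity of
  the linear form \<open>b X\<^sub>0 - a X\<^sub>1\<close> in the numerator minus that in the denominator.
\<close>

definition line_multiplicity :: "'a::field \<Rightarrow> 'a \<Rightarrow> 'a poly poly \<Rightarrow> nat" where
  "line_multiplicity a b g = Max {k. ([:[:b:]:] * X0 - [:[:a:]:] * X1) ^ k dvd g}"

definition order_at :: "'a::field point \<Rightarrow> 'a poly poly fract \<Rightarrow> int" where
  "order_at p s = (THE k. \<exists>a b g h. (a, b) \<in> p \<and> g \<noteq> 0 \<and> h \<noteq> 0 \<and> s = Fract g h \<and>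
     k = int (line_multiplicity a b g) - int (line_multiplicity a b h))"

text \<open>
  Rational sections \<open>v 0, \<dots>, v (r - 1)\<close> forming a basis of the generic stalk of \<open>F\<close> give the
  rational section \<open>v 0 \<and> \<dots> \<and> v (r - 1)\<close> of the line bundle \<open>det F\<close>. Its order at \<open>p\<close> is that
  of the determinant expressing \<open>v\<close> through a basis \<open>w\<close> of the stalk of \<open>F\<close> at \<open>p\<close>; the latter
  is free, being a finitely generated torsion-free module over a discrete valuation ring.
\<close>

definition wedge_order ::
    "'a::field sheaf \<Rightarrow> nat \<Rightarrow> (nat \<Rightarrow> nat \<Rightarrow> 'a poly poly fract) \<Rightarrow> 'a point \<Rightarrow> int" where
  "wedge_order F r v p = (THE k. \<exists>w A. module_basis (local_ring p) (stalk F p) r w \<and>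
     (\<forall>i<r. (\<forall>j<r. A i j \<in> function_field) \<and> v i = (\<lambda>l. \<Sum>j<r. A i j * w j l)) \<and>
     k = order_at p (det (mat r r (\<lambda>(i, j). A i j))))"

text \<open>
  \<open>c\<^sub>1(F) = deg (det F)\<close> is the degree of the divisor of any nonzero rational section of
  \<open>det F\<close>. The ground field being algebraically closed,
  every closed point has degree 1.
\<close>

definition sheaf_degree :: "'a::alg_closed_field sheaf \<Rightarrow> int" where
  "sheaf_degree F = (THE k. \<exists>v. module_basis function_field (generic_stalk F) (sheaf_rank F) v \<and>
     k = (\<Sum>p \<in> {p \<in> P1. wedge_order F (sheaf_rank F) v p \<noteq> 0}. wedge_order F (sheaf_rank F) v p))"

definition slope :: "'a::alg_closed_field sheaf \<Rightarrow> rat" where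
  "slope F = of_int (sheaf_degree F) / of_nat (sheaf_rank F)"

definition slope_semistable :: "'a::alg_closed_field sheaf \<Rightarrow> bool" where
  "slope_semistable E \<longleftrightarrow>
     (\<forall>F. coherent_subsheaf F E \<and> 0 < sheaf_rank F \<and> sheaf_rank F < sheaf_rank E \<longrightarrow>
        slope F \<le> slope E)"

definition slope_stable :: "'a::alg_closed_field sheaf \<Rightarrow> bool" where
  "slope_stable E \<longleftrightarrow>
     (\<forall>F. coherent_subsheaf F E \<and> 0 < sheaf_rank F \<and> sheaf_rank F < sheaf_rank E \<longrightarrow>
        slope F < slope E)"


section \<open>Syzygy bundles\<close>

text \<open>The kernel of \<open>\<O>(-d)\<^sup>n \<rightarrow> \<O>\<close>, \<open>(g\<^sub>i) \<mapsto> \<Sum> f\<^sub>i g\<^sub>i\<close>.\<close>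

definition Syz :: "nat \<Rightarrow> nat \<Rightarrow> (nat \<Rightarrow> 'a::field poly poly) \<Rightarrow> 'a sheaf" where
  "Syz d n f U = {s. (\<forall>i<n. s i \<in> twist (- int d) U) \<and> (\<forall>i\<ge>n. s i = 0) \<and>
     (\<Sum>i<n. Fract (f i) 1 * s i) = 0}"

end

theory Submission
  imports Defs
begin

text \<open>
  Let \<open>F\<close> be a subsheaf of \<open>\<O>(m)\<^sup>N\<close> of rank \<open>r\<close>. For a rational basis \<open>v\<close> of \<open>F\<close>, local bases \<open>w\<^sub>p\<close> of its
  stalks and a nonzero \<open>r \<times> r\<close> minor \<open>M\<close>, the order of \<open>v\<^sub>0 \<and> \<dots> \<and> v\<^bsub>r-1\<^esub>\<close> at \<open>p\<close> is
  \<open>ord\<^sub>p M(v) - ord\<^sub>p M(w\<^sub>p)\<close>. As \<open>M(v)\<close> is homogeneous of degree \<open>r m\<close>, its orders add up to \<open>r m\<close>, so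
  \<open>deg F = r m - \<Sum>\<^sub>p ord\<^sub>p M(w\<^sub>p)\<close>. This gives the degree \<open>-n d\<close> of the syzygy bundle, and \<open>deg F \<le> r m\<close>
  in general, so \<open>\<O>(m)\<^sup>N\<close> is semistable.

  If \<open>d = (n - 1) e\<close>, the relations \<open>X\<^sub>1\<^sup>e f\<^bsub>i+1\<^esub> = X\<^sub>0\<^sup>e f\<^sub>i\<close> between the monomials
  \<open>f\<^sub>i = X\<^sub>0\<^bsup>e i\<^esup> X\<^sub>1\<^bsup>d - e i\<^esup>\<close> identify their syzygy bundle with \<open>\<O>(-d-e)\<^bsup>n-1\<^esup>\<close>. If \<open>n - 1\<close> does not divide \<open>d\<close>,
  let \<open>m\<close> be the integral part of \<open>n d / (n - 1)\<close>. By a dimension count there is a nonzero syzygy of total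
  degree \<open>m\<close>; it spans a line subbundle \<open>\<O>(-m)\<close>, and \<open>-m\<close> exceeds the slope \<open>-n d / (n - 1)\<close>.
\<close>


text \<open>Orders and degrees are definite descriptions, so nothing is known of them before local
  bases exist at every point and the value is independent of all choices. Minors serve both ends:
  they compare otherwise unrelated bases, and their orders have a known sum. The identification with
  O(-d-e)^(n-1) is never made as an isomorphism of sheaves. Linear functionals replace the
  coordinates in a minor, and the bound for subsheaves only asks that they be regular on stalks and
  jointly injective on the generic stalk. The number m meets two opposite demands. With e = m - d, a
  syzygy by forms of degree e has n (e + 1) coefficients and satisfies d + e + 1 equations; n (e +
  1) > d + e + 1 says (n - 1)(m + 1) > n d. Destabilising requires (n - 1) m < n d. The integral
  part of n d / (n - 1) does both unless the quotient is an integer, which means that n - 1 divides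
  d, as n d = (n - 1) d + d. The forms of such a syzygy may have common zeros, so the copy of O(-m)
  need not be saturated. Semistability tests all coherent subsheaves, hence this one as
  well.\<close>

section \<open>Polynomial functions over an algebraically closed field\<close>

text \<open>Over a finite field, one plus the product of all \<open>X - a\<close> would be a
  nonconstant polynomial without a root.\<close>

lemma infinite_UNIV_alg_closed: "infinite (UNIV :: 'a::alg_closed_field set)"
proof
  assume fin: "finite (UNIV :: 'a set)"
  define p :: "'a poly" where "p = (\<Prod>a\<in>UNIV. [:- a, 1:]) + 1"
  have "degree (\<Prod>a\<in>(UNIV::'a set). [:- a, 1:]) = card (UNIV :: 'a set)"
    by (subst degree_prod_eq_sum_degree) auto
  moreover have "card (UNIV :: 'a set) > 0"
    using fin by (simp add: card_gt_0_iff)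
  ultimately have "degree p > 0"
    unfolding p_def by (subst degree_add_eq_left) auto
  then obtain x where "poly p x = 0"
    using alg_closed_imp_poly_has_root by blast
  moreover have "poly (\<Prod>a\<in>UNIV. [:- a, 1:]) x = 0"
    unfolding poly_prod by (rule prod_zero[OF fin]) (auto intro!: bexI[of _ x])
  ultimately show False by (simp add: p_def)
qed

lemma poly_zero_everywhere:
  fixes p :: "'a::alg_closed_field poly"
  assumes "\<And>x. poly p x = 0"
  shows "p = 0"
proof (rule ccontr)
  assume "p \<noteq> 0"
  then have "finite {x. poly p x = 0}" by (rule poly_roots_finite)
  moreover have "{x. poly p x = 0} = UNIV" using assms by blast
  ultimately show False using infinite_UNIV_alg_closed by metis
qed

section \<open>Homogeneous forms and points\<close>

lemma homogeneousD: "homogeneous k f \<Longrightarrow> i + j \<noteq> k \<Longrightarrow> coeff (coeff f j) i = 0"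
  unfolding homogeneous_def by blast

lemma homogeneous_0 [simp]: "homogeneous k 0"
  by (simp add: homogeneous_def)

lemma homogeneous_const [simp]: "homogeneous 0 [:[:c:]:]"
  by (auto simp: homogeneous_def coeff_pCons split: nat.splits)

lemma homogeneous_1 [simp]: "homogeneous 0 1"
  using homogeneous_const[of 1] by (simp add: one_pCons)

lemma homogeneous_X0 [simp]: "homogeneous 1 X0"
  by (auto simp: homogeneous_def X0_def coeff_pCons split: nat.splits)

lemma homogeneous_X1 [simp]: "homogeneous 1 X1"
  by (auto simp: homogeneous_def X1_def coeff_pCons split: nat.splits if_splits)

lemma homogeneous_add: "homogeneous k f \<Longrightarrow> homogeneous k g \<Longrightarrow> homogeneous k (f + g)"
  unfolding homogeneous_def coeff_add by (metis add_0)

lemma homogeneous_uminus: "homogeneous k f \<Longrightarrow> homogeneous k (- f)"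
  unfolding homogeneous_def by simp

lemma homogeneous_diff: "homogeneous k f \<Longrightarrow> homogeneous k g \<Longrightarrow> homogeneous k (f - g)"
  using homogeneous_add[of k f "- g"] homogeneous_uminus[of k g] by simp

lemma homogeneous_sum: "(\<And>i. i \<in> I \<Longrightarrow> homogeneous k (f i)) \<Longrightarrow> homogeneous k (\<Sum>i\<in>I. f i)"
  by (induction I rule: infinite_finite_induct) (auto intro: homogeneous_add)

lemma homogeneous_mult:
  assumes "homogeneous k f" "homogeneous l g"
  shows "homogeneous (k + l) (f * g)"
  unfolding homogeneous_def
proof (intro allI impI)
  fix i j assume "coeff (coeff (f * g) j) i \<noteq> 0"
  then have "(\<Sum>r\<le>j. \<Sum>s\<le>i. coeff (coeff f r) s * coeff (coeff g (j - r)) (i - s)) \<noteq> 0"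
    by (simp add: coeff_mult coeff_sum)
  then obtain r where r: "r \<le> j" "(\<Sum>s\<le>i. coeff (coeff f r) s * coeff (coeff g (j - r)) (i - s)) \<noteq> 0"
    by (metis (no_types, lifting) atMost_iff sum.neutral)
  then obtain s where "s \<le> i" "coeff (coeff f r) s * coeff (coeff g (j - r)) (i - s) \<noteq> 0"
    by (metis (no_types, lifting) atMost_iff sum.neutral)
  then have "s + r = k" "(i - s) + (j - r) = l"
    using assms unfolding homogeneous_def by auto
  then show "i + j = k + l" using r \<open>s \<le> i\<close> by linarith
qed

lemma homogeneous_power: "homogeneous k f \<Longrightarrow> homogeneous (m * k) (f ^ m)"
  by (induction m) (auto intro: homogeneous_mult)

lemma homogeneous_X0_power [simp]: "homogeneous m (X0 ^ m)"
  using homogeneous_power[OF homogeneous_X0, of m] by simp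

lemma homogeneous_X1_power [simp]: "homogeneous m (X1 ^ m)"
  using homogeneous_power[OF homogeneous_X1, of m] by simp

lemma homogeneous_0_degree:
  assumes "homogeneous 0 f"
  shows "f = [:[:coeff (coeff f 0) 0:]:]"
proof (intro poly_eqI)
  fix j i show "coeff (coeff f j) i = coeff (coeff [:[:coeff (coeff f 0) 0:]:] j) i"
    using homogeneousD[OF assms, of i j] by (cases i; cases j) auto
qed

lemma X0_nonzero [simp]: "X0 \<noteq> 0" by (simp add: X0_def)
lemma X1_nonzero [simp]: "X1 \<noteq> 0" by (simp add: X1_def)

lemma eval_form_simps [simp]:
  "eval_form 0 a b = 0" "eval_form 1 a b = 1"
  "eval_form X0 a b = a" "eval_form X1 a b = b"
  "eval_form [:[:c:]:] a b = c"
  "eval_form (f + g) a b = eval_form f a b + eval_form g a b"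
  "eval_form (f - g) a b = eval_form f a b - eval_form g a b"
  "eval_form (- f) a b = - eval_form f a b"
  "eval_form (f * g) a b = eval_form f a b * eval_form g a b"
  "eval_form (f ^ m) a b = eval_form f a b ^ m"
  by (simp_all add: eval_form_def X0_def X1_def)

lemma eval_form_altdef:
  "eval_form f a b = (\<Sum>j\<le>degree f. \<Sum>i\<le>degree (coeff f j). coeff (coeff f j) i * a ^ i * b ^ j)"
  unfolding eval_form_def
  by (simp add: poly_altdef[of f] poly_sum poly_altdef[of "coeff _ _"] sum_distrib_right)

lemma eval_form_scale:
  assumes "homogeneous k f"
  shows "eval_form f (c * a) (c * b) = c ^ k * eval_form f a b"
  unfolding eval_form_altdef sum_distrib_left
proof (intro sum.cong refl)
  fix j i
  show "coeff (coeff f j) i * (c * a) ^ i * (c * b) ^ j = c ^ k * (coeff (coeff f j) i * a ^ i * b ^ j)"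
  proof (cases "i + j = k")
    case True
    then show ?thesis by (auto simp: power_mult_distrib power_add)
  next
    case False
    then show ?thesis using homogeneousD[OF assms] by simp
  qed
qed

text \<open>Substituting a polynomial \<open>q\<close> for the outer variable and then
  \<open>c\<close> for the inner one is evaluation at \<open>(c, q(c))\<close>. This links the
  factor theorem over \<open>K[X0]\<close>, where roots are polynomials, with
  \<open>eval_form\<close>.\<close>

lemma poly_poly_at: "poly (poly f q) c = poly (poly f [:poly q c:]) (c::'a::comm_ring_1)"
  by (induction f) auto

section \<open>Linear forms and their multiplicities as factors\<close>

text \<open>The form whose powers are counted by \<open>line_multiplicity\<close>; for
  \<open>(a, b)\<close> nonzero its only zero on the projective line is
  \<open>(a : b)\<close>.\<close>

definition line :: "'a::field \<Rightarrow> 'a \<Rightarrow> 'a poly poly" where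
  "line a b = [:[:b:]:] * X0 - [:[:a:]:] * X1"

lemma line_altdef: "line a b = [:[:0, b:], [:- a:]:]"
  by (simp add: line_def X0_def X1_def)

lemma homogeneous_line [simp]: "homogeneous 1 (line a b)"
  unfolding line_def
  using homogeneous_mult[OF homogeneous_const homogeneous_X0]
    homogeneous_mult[OF homogeneous_const homogeneous_X1]
  by (intro homogeneous_diff) auto

lemma eval_form_line [simp]: "eval_form (line a b) a' b' = b * a' - a * b'"
  unfolding line_def eval_form_simps ..

lemma line_scale: "line (c * a) (c * b) = [:[:c:]:] * line a b"
  by (simp add: line_altdef)

text \<open>Up to a nonzero constant the form is \<open>X1 - (b / a) X0\<close>, which is monic in
  the outer variable, so the factor theorem over \<open>K[X0]\<close> applies.\<close>

lemma line_dvd_iff: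
  assumes "a \<noteq> 0"
  shows "line a b dvd g \<longleftrightarrow> poly g [:0, b / a:] = 0"
proof -
  have 1: "line a b = [:[:- a:]:] * [:- [:0, b / a:], 1:]"
    using assms by (simp add: line_altdef)
  have "[:- [:0, b / a:], 1:] = [:[:- 1 / a:]:] * line a b"
    using assms by (simp add: line_altdef one_pCons)
  then have "line a b dvd g \<longleftrightarrow> [:- [:0, b / a:], 1:] dvd g"
    using 1 by (metis dvd_mult_right)
  then show ?thesis by (simp add: poly_eq_0_iff_dvd)
qed

lemma line_0_dvd_iff:
  assumes "b \<noteq> 0"
  shows "line 0 b dvd g \<longleftrightarrow> (\<forall>j. poly (coeff g j) 0 = 0)"
proof -
  have "[:0, b:] dvd q \<longleftrightarrow> poly q 0 = 0" for q
  proof -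
    have "[:0, b:] = [:b:] * [:-0, 1:]" "[:-0, 1:] = [:1 / b:] * [:0, b:]"
      using assms by (simp_all add: one_pCons)
    then have "[:0, b:] dvd q \<longleftrightarrow> [:-0, 1:] dvd q" by (metis dvd_mult_right)
    then show ?thesis by (simp only: poly_eq_0_iff_dvd)
  qed
  then show ?thesis by (simp add: line_altdef const_poly_dvd_iff)
qed

lemma line_nonzero: "(a, b) \<noteq> (0, 0) \<Longrightarrow> line a b \<noteq> 0"
  by (auto simp: line_altdef)

lemma line_prime:
  assumes "(a, b) \<noteq> (0, 0)" "line a b dvd g * h"
  shows "line a b dvd g \<or> line a b dvd h"
proof (cases "a = 0")
  case True
  then have "prime_elem [:0, b:]" using assms(1) by (intro prime_elem_linear_field_poly) auto
  then have "prime_elem (line a b)" using True by (simp add: line_altdef lift_prime_elem_poly)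
  then show ?thesis using assms(2) by (auto dest: prime_elem_dvd_multD)
next
  case False
  then show ?thesis using assms(2) by (simp add: line_dvd_iff)
qed

lemma line_dvd_vanishes: "line a b dvd g \<Longrightarrow> eval_form g a b = 0"
  by (auto elim!: dvdE)

text \<open>Homogeneity spreads the zero at \<open>(a, b)\<close> over the whole line through it and
  the origin. The restriction of \<open>f\<close> to that line is a polynomial in one variable over
  an infinite field, hence zero.\<close>

lemma line_dvd_homogeneous:
  fixes f :: "'a::alg_closed_field poly poly"
  assumes ab: "(a, b) \<noteq> (0, 0)" and hom: "homogeneous k f" and ev: "eval_form f a b = 0"
  shows "line a b dvd f"
proof (cases "a = 0")
  case False
  have "poly (poly f [:0, b / a:]) c = 0" for c
  proof -
    have "poly (poly f [:0, b / a:]) c = eval_form f (c / a * a) (c / a * b)"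
      using False by (subst poly_poly_at) (simp add: eval_form_def)
    also have "\<dots> = 0" by (subst eval_form_scale[OF hom]) (simp add: ev)
    finally show ?thesis .
  qed
  then have "poly f [:0, b / a:] = 0" by (rule poly_zero_everywhere)
  then show ?thesis using False by (simp add: line_dvd_iff)
next
  case True
  then have b: "b \<noteq> 0" using ab by simp
  \<comment> \<open>The restriction of \<open>f\<close> to the line \<open>X0 = 0\<close>.\<close>
  define q where "q = map_poly (\<lambda>c. poly c 0) f"
  have q: "poly q c = eval_form f 0 c" for c
    unfolding q_def eval_form_def by (induction f) (auto simp: map_poly_pCons)
  have "poly q c = 0" for c
    using eval_form_scale[OF hom, of "c / b" 0 b] ev True b by (simp add: q)
  then have "q = 0" by (rule poly_zero_everywhere)
  then have "poly (coeff f j) 0 = 0" for j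
    unfolding q_def by (metis coeff_0 coeff_map_poly poly_0)
  then show ?thesis using True b by (simp add: line_0_dvd_iff)
qed

text \<open>The product has the coefficients \<open>b g(i-1, j) - a g(i, j-1)\<close>. For
  \<open>a = 0\<close> this is a shift of those of \<open>g\<close>; otherwise it can be solved for
  \<open>g(i, j-1)\<close>, by induction on the exponent \<open>i\<close> of
  \<open>X0\<close>.\<close>

lemma homogeneous_line_cancel:
  assumes ab: "(a, b) \<noteq> (0, 0)" and hom: "homogeneous (Suc k) (line a b * g)"
  shows "homogeneous k g"
proof -
  have c: "coeff (coeff (line a b * g) j) i
      = (case i of 0 \<Rightarrow> 0 | Suc i' \<Rightarrow> b * coeff (coeff g j) i')
        - (case j of 0 \<Rightarrow> 0 | Suc j' \<Rightarrow> a * coeff (coeff g j') i)" for i j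
    by (cases i; cases j) (auto simp: line_altdef)
  have "coeff (coeff g j) i = 0" if "i + j \<noteq> k" for i j
  proof (cases "a = 0")
    case True
    then show ?thesis using c[of j "Suc i"] homogeneousD[OF hom, of "Suc i" j] that ab
      by (auto split: nat.splits)
  next
    case False
    show ?thesis using that
    proof (induction i arbitrary: j)
      case 0
      then show ?case using c[of "Suc j" 0] homogeneousD[OF hom, of 0 "Suc j"] False by auto
    next
      case (Suc i)
      then have "coeff (coeff g (Suc j)) i = 0" by auto
      then show ?case using c[of "Suc j" "Suc i"] homogeneousD[OF hom, of "Suc i" "Suc j"] False Suc.prems
        by auto
    qed
  qed
  then show ?thesis unfolding homogeneous_def by blast
qed

lemma line_multiplicity_eqI:
  assumes ab: "(a, b) \<noteq> (0, 0)" and g: "g = line a b ^ k * h" and h: "\<not> line a b dvd h"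
  shows "line_multiplicity a b g = k"
proof -
  have "{j. line a b ^ j dvd g} = {..k}"
  proof safe
    fix j assume j: "line a b ^ j dvd g"
    show "j \<le> k"
    proof (rule ccontr)
      assume "\<not> j \<le> k"
      then have "line a b ^ Suc k dvd g" using j by (metis le_imp_power_dvd dvd_trans not_less_eq_eq)
      then have "line a b ^ k * line a b dvd line a b ^ k * h" by (simp add: g mult.commute)
      then show False using h line_nonzero[OF ab] by (simp add: dvd_mult_cancel_left)
    qed
  qed (auto simp: g le_imp_power_dvd)
  then show ?thesis unfolding line_multiplicity_def line_def[symmetric] by (auto intro: Max_eqI)
qed

text \<open>The exponents are bounded by the degree in \<open>X1\<close> if \<open>a\<close> is
  nonzero. For \<open>a = 0\<close> the form lies in the coefficient ring, and the degree of the
  leading coefficient is a bound.\<close>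

lemma line_multiplicity_exists:
  assumes ab: "(a, b) \<noteq> (0, 0)" and g: "g \<noteq> 0"
  obtains k h where "g = line a b ^ k * h" "\<not> line a b dvd h" "h \<noteq> 0"
proof -
  have bound: "\<exists>N. \<forall>k. line a b ^ k dvd g \<longrightarrow> k \<le> N"
  proof (cases "a = 0")
    case False
    have "k \<le> degree g" if "line a b ^ k dvd g" for k
    proof -
      have "degree (line a b ^ k) = k" using False by (simp add: degree_power_eq line_altdef)
      then show ?thesis using dvd_imp_degree_le[OF that g] by simp
    qed
    then show ?thesis by blast
  next
    case True
    then have b: "b \<noteq> 0" using ab by simp
    have "k \<le> degree (lead_coeff g)" if "line a b ^ k dvd g" for k
    proof -
      have "line a b ^ k = [:[:0, b:] ^ k:]" using True by (simp add: line_altdef poly_const_pow)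
      then have "[:0, b:] ^ k dvd lead_coeff g" using that by (simp add: const_poly_dvd_iff)
      moreover have "degree ([:0, b:] ^ k) = k" using b by (simp add: degree_power_eq)
      ultimately show ?thesis using g dvd_imp_degree_le[of "[:0, b:] ^ k" "lead_coeff g"] by simp
    qed
    then show ?thesis by blast
  qed
  then obtain N where N: "\<And>k. line a b ^ k dvd g \<Longrightarrow> k \<le> N" by blast
  define k where "k = (GREATEST k. line a b ^ k dvd g)"
  have k: "line a b ^ k dvd g" unfolding k_def
    by (rule GreatestI_nat[of _ 0 N]) (use N in auto)
  then obtain h where h: "g = line a b ^ k * h" by (elim dvdE)
  have "\<not> line a b dvd h"
  proof
    assume "line a b dvd h"
    then have "line a b ^ Suc k dvd g" by (auto simp: h mult_ac)
    then have "Suc k \<le> k" unfolding k_def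
      by (rule Greatest_le_nat[of _ _ N]) (use N in auto)
    then show False by simp
  qed
  then show thesis using that h g by auto
qed

lemma line_multiplicity_mult:
  assumes ab: "(a, b) \<noteq> (0, 0)" and "g \<noteq> 0" "h \<noteq> 0"
  shows "line_multiplicity a b (g * h) = line_multiplicity a b g + line_multiplicity a b h"
proof -
  obtain k g' where g: "g = line a b ^ k * g'" "\<not> line a b dvd g'"
    using line_multiplicity_exists[OF ab \<open>g \<noteq> 0\<close>] by blast
  obtain l h' where h: "h = line a b ^ l * h'" "\<not> line a b dvd h'"
    using line_multiplicity_exists[OF ab \<open>h \<noteq> 0\<close>] by blast
  have "g * h = line a b ^ (k + l) * (g' * h')" by (simp add: g h power_add mult_ac)
  moreover have "\<not> line a b dvd g' * h'" using line_prime[OF ab] g h by blast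
  ultimately show ?thesis using line_multiplicity_eqI[OF ab] g h by metis
qed

lemma line_multiplicity_0I:
  "(a, b) \<noteq> (0, 0) \<Longrightarrow> eval_form g a b \<noteq> 0 \<Longrightarrow> line_multiplicity a b g = 0"
  by (rule line_multiplicity_eqI[of a b g 0 g]) (auto dest: line_dvd_vanishes)

lemma line_multiplicity_scale:
  assumes "c \<noteq> 0"
  shows "line_multiplicity (c * a) (c * b) g = line_multiplicity a b g"
proof -
  have "[:[:inverse c:]:] * [:[:c:]:] = 1" using assms by (simp add: one_pCons)
  then have u: "[:[:inverse c:]:] ^ k * [:[:c:]:] ^ k = 1" for k
    by (metis power_mult_distrib power_one)
  have "line (c * a) (c * b) ^ k dvd g \<longleftrightarrow> line a b ^ k dvd g" for k
  proof -
    have e: "line (c * a) (c * b) ^ k = [:[:c:]:] ^ k * line a b ^ k"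
      by (simp only: line_scale power_mult_distrib)
    moreover have "[:[:c:]:] ^ k dvd 1" using u[of k] by (metis dvd_triv_right)
    ultimately show ?thesis by (simp add: mult_unit_dvd_iff')
  qed
  then show ?thesis unfolding line_multiplicity_def line_def[symmetric] by simp
qed

section \<open>Points and orders of vanishing\<close>

definition pt :: "'a::field \<Rightarrow> 'a \<Rightarrow> 'a point" where
  "pt a b = {(c * a, c * b) | c. c \<noteq> 0}"

lemma pt_proportional: "(a, b) \<noteq> (0, 0) \<Longrightarrow> proportional `` {(a, b)} = pt a b"
  by (auto simp: proportional_def pt_def)

lemma P1_iff: "p \<in> P1 \<longleftrightarrow> (\<exists>a b. (a, b) \<noteq> (0, 0) \<and> p = pt a b)"
proof -
  have "p \<in> P1 \<longleftrightarrow> (\<exists>x. x \<noteq> (0, 0) \<and> p = proportional `` {x})"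
    unfolding P1_def quotient_def by blast
  also have "\<dots> \<longleftrightarrow> (\<exists>a b. (a, b) \<noteq> (0, 0) \<and> p = proportional `` {(a, b)})"
    by (simp only: split_paired_Ex)
  also have "\<dots> \<longleftrightarrow> (\<exists>a b. (a, b) \<noteq> (0, 0) \<and> p = pt a b)"
    by (intro ex_cong1 conj_cong refl) (drule pt_proportional, simp)
  finally show ?thesis .
qed

lemma P1E:
  assumes "p \<in> P1"
  obtains a b where "(a, b) \<noteq> (0, 0)" "p = pt a b"
  using assms P1_iff by blast

lemma pt_in_P1: "(a, b) \<noteq> (0, 0) \<Longrightarrow> pt a b \<in> P1"
  using P1_iff by blast

lemma pt_self: "(a, b) \<in> pt a b"
  unfolding pt_def by (auto intro!: exI[of _ 1])

lemma pt_eqI: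
  assumes "(a, b) \<noteq> (0, 0)" "(a', b') \<noteq> (0, 0)" "b * a' = a * b'"
  shows "pt a b = pt a' b'"
proof -
  obtain c where c: "c \<noteq> 0" "a' = c * a" "b' = c * b"
  proof (cases "a = 0")
    case True
    then show thesis using assms that[of "b' / b"] by auto
  next
    case False
    then have "a' \<noteq> 0" using assms by (metis mult_eq_0_iff)
    then show thesis using False assms that[of "a' / a"] by (auto simp: field_simps)
  qed
  then show ?thesis unfolding pt_def
    by (auto simp: mult.assoc[symmetric]) (metis (no_types) c(1) divide_eq_0_iff nonzero_eq_divide_eq)+
qed

lemma nonvanishing_pt:
  assumes "homogeneous k f"
  shows "nonvanishing f (pt a b) \<longleftrightarrow> eval_form f a b \<noteq> 0"
proof
  assume "nonvanishing f (pt a b)"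
  then show "eval_form f a b \<noteq> 0"
    using pt_self[of a b] by (auto simp: nonvanishing_def)
next
  assume "eval_form f a b \<noteq> 0"
  then show "nonvanishing f (pt a b)"
    by (auto simp: nonvanishing_def pt_def eval_form_scale[OF assms])
qed

lemma nonvanishing_nonzero: "nonvanishing f p \<Longrightarrow> p \<in> P1 \<Longrightarrow> f \<noteq> 0"
  by (auto simp: nonvanishing_def elim!: P1E dest!: bspec[OF _ pt_self])

lemma nonvanishing_mult [simp]: "nonvanishing f p \<Longrightarrow> nonvanishing g p \<Longrightarrow> nonvanishing (f * g) p"
  by (auto simp: nonvanishing_def)

lemma nonvanishing_mult_iff:
  "homogeneous k f \<Longrightarrow> homogeneous l g \<Longrightarrow> p \<in> P1 \<Longrightarrow> nonvanishing (f * g) p \<longleftrightarrow> nonvanishing f p \<and> nonvanishing g p"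
  by (elim P1E) (simp add: nonvanishing_pt nonvanishing_pt[OF homogeneous_mult])

lemma nonvanishing_power [simp]: "nonvanishing f p \<Longrightarrow> nonvanishing (f ^ m) p"
  by (auto simp: nonvanishing_def)

lemma nonvanishing_1 [simp]: "nonvanishing 1 p"
  by (auto simp: nonvanishing_def)

lemma nonvanishing_X0_X1:
  assumes "p \<in> P1" obtains l where "l \<in> {X0, X1}" "nonvanishing l p" "homogeneous 1 l"
proof -
  obtain a b where "(a, b) \<noteq> (0, 0)" "p = pt a b" using assms by (rule P1E)
  then have "nonvanishing X0 p \<or> nonvanishing X1 p"
    using nonvanishing_pt[OF homogeneous_X0, of a b] nonvanishing_pt[OF homogeneous_X1, of a b] by auto
  then show thesis using that homogeneous_X0 homogeneous_X1 by blast
qed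

text \<open>The description in \<open>order_at\<close> ranges over all coordinates of the point and
  all ways of writing the fraction. Coordinates matter only up to scaling, which leaves
  multiplicities unchanged; equal fractions are compared by cross-multiplication and additivity of
  multiplicities.\<close>

lemma order_at_Fract:
  assumes ab: "(a, b) \<noteq> (0, 0)" and gh: "g \<noteq> 0" "h \<noteq> 0"
  shows "order_at (pt a b) (Fract g h) = int (line_multiplicity a b g) - int (line_multiplicity a b h)"
  unfolding order_at_def
proof (rule the_equality)
  show "\<exists>a' b' g' h'. (a', b') \<in> pt a b \<and> g' \<noteq> 0 \<and> h' \<noteq> 0 \<and> Fract g h = Fract g' h' \<and>
     int (line_multiplicity a b g) - int (line_multiplicity a b h) =
     int (line_multiplicity a' b' g') - int (line_multiplicity a' b' h')"
    using gh pt_self by blast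
next
  fix k assume "\<exists>a' b' g' h'. (a', b') \<in> pt a b \<and> g' \<noteq> 0 \<and> h' \<noteq> 0 \<and> Fract g h = Fract g' h' \<and>
     k = int (line_multiplicity a' b' g') - int (line_multiplicity a' b' h')"
  then obtain a' b' g' h' where *: "(a', b') \<in> pt a b" "g' \<noteq> 0" "h' \<noteq> 0" "Fract g h = Fract g' h'"
     "k = int (line_multiplicity a' b' g') - int (line_multiplicity a' b' h')" by blast
  then have k: "k = int (line_multiplicity a b g') - int (line_multiplicity a b h')"
    by (auto simp: pt_def line_multiplicity_scale)
  have "g * h' = g' * h" using * gh by (simp add: eq_fract)
  then have "line_multiplicity a b g + line_multiplicity a b h' = line_multiplicity a b g' + line_multiplicity a b h"
    using line_multiplicity_mult[OF ab] gh * by metis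
  then show "k = int (line_multiplicity a b g) - int (line_multiplicity a b h)" using k by linarith
qed

lemma nonzero_FractE:
  assumes "x \<noteq> (0 :: 'a::idom fract)"
  obtains g h where "x = Fract g h" "g \<noteq> 0" "h \<noteq> 0"
proof (cases x)
  case (Fract g h)
  then show thesis using that assms by (cases "g = 0") (auto simp: Zero_fract_def eq_fract)
qed

lemma order_at_mult:
  assumes "p \<in> P1" "x \<noteq> 0" "y \<noteq> 0"
  shows "order_at p (x * y) = order_at p x + order_at p y"
proof -
  obtain g h where x: "x = Fract g h" "g \<noteq> 0" "h \<noteq> 0" using assms(2) by (rule nonzero_FractE)
  obtain g' h' where y: "y = Fract g' h'" "g' \<noteq> 0" "h' \<noteq> 0" using assms(3) by (rule nonzero_FractE)
  obtain a b where p: "(a, b) \<noteq> (0, 0)" "p = pt a b" using assms(1) by (rule P1E)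
  show ?thesis unfolding x(1) y(1) p(2)
    using x(2,3) y(2,3) p(1) by (simp add: order_at_Fract line_multiplicity_mult)
qed

lemma order_at_1: "p \<in> P1 \<Longrightarrow> order_at p 1 = 0"
  using order_at_mult[of p 1 1] by simp

lemma order_at_divide:
  assumes "p \<in> P1" "x \<noteq> 0" "y \<noteq> 0"
  shows "order_at p (x / y) = order_at p x - order_at p y"
  using order_at_mult[of p "x / y" y] assms by simp

lemma order_at_Fract_nonvanishing:
  assumes "p \<in> P1" "h \<noteq> 0" "nonvanishing g p" "homogeneous k g" 
  shows "order_at p (Fract g h) = - order_at p (Fract h 1)"
proof -
  obtain a b where p: "(a, b) \<noteq> (0, 0)" "p = pt a b" using assms(1) by (rule P1E)
  have "g \<noteq> 0" using assms nonvanishing_nonzero by blast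
  then show ?thesis
    using assms p by (simp add: order_at_Fract line_multiplicity_0I nonvanishing_pt)
qed


section \<open>Divisors and their degrees\<close>

text \<open>A function on the line read as a divisor of degree \<open>t\<close>. Finite support is
  part of the notion because a sum over an infinite set is 0 by convention.\<close>

definition has_total :: "('a::field point \<Rightarrow> int) \<Rightarrow> int \<Rightarrow> bool" where
  "has_total f t \<longleftrightarrow> finite {p \<in> P1. f p \<noteq> 0} \<and> sum f {p \<in> P1. f p \<noteq> 0} = t"

lemma has_totalI:
  assumes "finite T" "T \<subseteq> P1" "\<And>p. p \<in> P1 \<Longrightarrow> p \<notin> T \<Longrightarrow> f p = 0" "sum f T = t"
  shows "has_total f t"
  unfolding has_total_def
proof
  have sub: "{p \<in> P1. f p \<noteq> 0} \<subseteq> T" using assms(3) by blast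
  then show "finite {p \<in> P1. f p \<noteq> 0}" using assms(1) finite_subset by blast
  show "sum f {p \<in> P1. f p \<noteq> 0} = t"
    unfolding assms(4)[symmetric]
    by (rule sum.mono_neutral_left) (use assms(1,2) sub in auto)
qed

lemma has_totalD:
  assumes "has_total f t" "finite T" "T \<subseteq> P1" "\<And>p. p \<in> P1 \<Longrightarrow> p \<notin> T \<Longrightarrow> f p = 0"
  shows "sum f T = t"
  using has_totalI[OF assms(2,3,4) refl] assms(1) by (simp add: has_total_def)

lemma has_total_finite: "has_total f t \<Longrightarrow> finite {p \<in> P1. f p \<noteq> 0}"
  by (simp add: has_total_def)

lemma has_total_add:
  assumes "has_total f s" "has_total g t"
  shows "has_total (\<lambda>p. f p + g p) (s + t)"
proof (rule has_totalI)
  let ?T = "{p \<in> P1. f p \<noteq> 0} \<union> {p \<in> P1. g p \<noteq> 0}"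
  show "finite ?T" using assms by (simp add: has_total_finite)
  then have "sum f ?T = s" "sum g ?T = t"
    using assms by (auto intro!: has_totalD)
  then show "(\<Sum>p\<in>?T. f p + g p) = s + t" by (simp add: sum.distrib)
qed auto

lemma has_total_uminus: "has_total f t \<Longrightarrow> has_total (\<lambda>p. - f p) (- t)"
  by (simp add: has_total_def sum_negf)

lemma has_total_diff: "has_total f s \<Longrightarrow> has_total g t \<Longrightarrow> has_total (\<lambda>p. f p - g p) (s - t)"
  using has_total_add[of f s "\<lambda>p. - g p" "- t"] has_total_uminus[of g t] by simp

lemma has_total_cong: "(\<And>p. p \<in> P1 \<Longrightarrow> f p = g p) \<Longrightarrow> has_total f t \<longleftrightarrow> has_total g t"
proof -
  assume *: "\<And>p. p \<in> P1 \<Longrightarrow> f p = g p"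
  then have "{p \<in> P1. f p \<noteq> 0} = {p \<in> P1. g p \<noteq> 0}" by auto
  moreover have "sum f {p \<in> P1. g p \<noteq> 0} = sum g {p \<in> P1. g p \<noteq> 0}"
    by (rule sum.cong) (use * in auto)
  ultimately show ?thesis by (simp add: has_total_def)
qed

lemma has_total_nonneg: "has_total f t \<Longrightarrow> (\<And>p. p \<in> P1 \<Longrightarrow> 0 \<le> f p) \<Longrightarrow> 0 \<le> t"
  by (auto simp: has_total_def intro!: sum_nonneg)

text \<open>Setting \<open>X0 = 1\<close> gives a polynomial in \<open>X1\<close>. Either it has a
  root \<open>t\<close>, and \<open>(1 : t)\<close> is a zero, or it is constant; then
  \<open>X1 ^ Suc k\<close> does not occur in \<open>g\<close>, so \<open>X0\<close> divides
  \<open>g\<close> and \<open>(0 : 1)\<close> is a zero.\<close>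

lemma homogeneous_has_zero:
  fixes g :: "'a::alg_closed_field poly poly"
  assumes hom: "homogeneous (Suc k) g"
  obtains a b where "(a, b) \<noteq> (0, 0)" "eval_form g a b = 0"
proof -
  define q where "q = map_poly (\<lambda>c. poly c 1) g"
  have q: "poly q t = eval_form g 1 t" for t
    unfolding q_def eval_form_def by (induction g) (auto simp: map_poly_pCons)
  show thesis
  proof (cases "degree q > 0")
    case True
    then obtain t where "poly q t = 0" using alg_closed_imp_poly_has_root by blast
    then show thesis using that[of 1 t] q by simp
  next
    case False
    have "poly (coeff g (Suc k)) 0 = 0"
    proof -
      have "coeff (coeff g (Suc k)) i = 0" if "i \<noteq> 0" for i
        using homogeneousD[OF hom, of i "Suc k"] that by simp
      then have c: "coeff g (Suc k) = [:coeff (coeff g (Suc k)) 0:]"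
        by (intro poly_eqI) (auto simp: coeff_pCons split: nat.splits)
      have "coeff q (Suc k) = 0" using False by (simp add: coeff_eq_0)
      moreover have "coeff q (Suc k) = poly (coeff g (Suc k)) 1"
        unfolding q_def by (simp add: coeff_map_poly)
      moreover have "poly (coeff g (Suc k)) x = coeff (coeff g (Suc k)) 0" for x
        by (subst c) simp
      ultimately show ?thesis by simp
    qed
    moreover have "poly (coeff g j) 0 = 0" if "j \<noteq> Suc k" for j
      using homogeneousD[OF hom, of 0 j] that by (simp add: poly_0_coeff_0)
    ultimately have "poly (coeff g j) 0 = 0" for j by (cases "j = Suc k") auto
    then have "line 0 1 dvd g" by (simp add: line_0_dvd_iff)
    then have "eval_form g 0 1 = 0" by (rule line_dvd_vanishes)
    then show thesis using that[of 0 1] by simp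
  qed
qed

lemma order_at_form_0I:
  "p \<in> P1 \<Longrightarrow> nonvanishing g p \<Longrightarrow> homogeneous k g \<Longrightarrow> order_at p (Fract g 1) = 0"
  using order_at_Fract_nonvanishing[of p 1 g k] order_at_1[of p] by (simp add: One_fract_def)

lemma order_at_line:
  assumes ab: "(a, b) \<noteq> (0, 0)" and p: "p \<in> P1"
  shows "order_at p (Fract (line a b) 1) = (if p = pt a b then 1 else 0)"
proof (cases "p = pt a b")
  case True
  have "\<not> line a b dvd 1" using line_dvd_vanishes[of a b 1] by auto
  then have "line_multiplicity a b (line a b) = 1"
    by (intro line_multiplicity_eqI[OF ab, of _ 1 1]) auto
  moreover have "line_multiplicity a b 1 = 0"
    using ab by (intro line_multiplicity_0I) auto
  ultimately show ?thesis using True ab line_nonzero[OF ab] by (simp add: order_at_Fract)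
next
  case False
  obtain a' b' where p': "(a', b') \<noteq> (0, 0)" "p = pt a' b'" using p by (rule P1E)
  then have "eval_form (line a b) a' b' \<noteq> 0"
    using False pt_eqI[of a b a' b'] ab by auto
  then have "nonvanishing (line a b) p" using p' by (simp add: nonvanishing_pt[OF homogeneous_line])
  then show ?thesis using False order_at_form_0I[OF p _ homogeneous_line] by simp
qed

text \<open>Induction on the degree: a form of positive degree has a zero, and the linear factor
  split off there contributes 1 at that point and 0 elsewhere.\<close>

lemma has_total_order_form:
  fixes g :: "'a::alg_closed_field poly poly"
  assumes "homogeneous k g" "g \<noteq> 0"
  shows "has_total (\<lambda>p. order_at p (Fract g 1)) (int k)"
  using assms
proof (induction k arbitrary: g)
  case 0
  define c where "c = coeff (coeff g 0) 0"
  have g: "g = [:[:c:]:]" unfolding c_def using 0 by (intro homogeneous_0_degree) auto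
  then have "c \<noteq> 0" using 0 by auto
  then have "nonvanishing g p" for p by (auto simp: nonvanishing_def g)
  then have "order_at p (Fract g 1) = 0" if "p \<in> P1" for p
    using that order_at_form_0I 0 by blast
  then show ?case by (intro has_totalI[of "{}"]) auto
next
  case (Suc k)
  obtain a b where ab: "(a, b) \<noteq> (0, 0)" "eval_form g a b = 0"
    using homogeneous_has_zero Suc.prems by blast
  then obtain g' where g: "g = line a b * g'"
    using line_dvd_homogeneous[OF ab(1) Suc.prems(1)] by (metis dvdE)
  have g': "g' \<noteq> 0" "homogeneous k g'"
    using Suc.prems homogeneous_line_cancel[OF ab(1)] by (auto simp: g)
  have "has_total (\<lambda>p. order_at p (Fract (line a b) 1)) 1"
    by (rule has_totalI[of "{pt a b}"]) (use order_at_line[OF ab(1)] pt_in_P1[OF ab(1)] in auto)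
  from has_total_add[OF this Suc.IH[OF g'(2,1)]]
  have "has_total (\<lambda>p. order_at p (Fract (line a b) 1) + order_at p (Fract g' 1)) (int (Suc k))"
    by (simp add: add.commute)
  moreover have "order_at p (Fract g 1) = order_at p (Fract (line a b) 1) + order_at p (Fract g' 1)"
    if "p \<in> P1" for p
  proof -
    have "Fract g 1 = Fract (line a b) 1 * Fract g' 1" by (simp add: g)
    moreover have "Fract (line a b) 1 \<noteq> 0" "Fract g' 1 \<noteq> 0"
      using g' line_nonzero[OF ab(1)] by (auto simp: Zero_fract_def eq_fract)
    ultimately show ?thesis using order_at_mult that by metis
  qed
  ultimately show ?case using has_total_cong by (metis (no_types, lifting))
qed

section \<open>Graded pieces of the function field\<close>

text \<open>The condition on denominators is a parameter, so that graded pieces of the fraction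
  field (denominators nonzero) and stalks of twisting sheaves (denominators not vanishing at
  \<open>p\<close>) share their proofs.\<close>

definition fracs :: "int \<Rightarrow> ('a::field poly poly \<Rightarrow> bool) \<Rightarrow> 'a poly poly fract set" where
  "fracs m P = {Fract g h | g h. P h \<and>
     (\<exists>k l. homogeneous k g \<and> homogeneous l h \<and> int k = int l + m)}"

text \<open>A multiplicative set of denominators. The powers of the form provided by
  \<open>linear\<close> are denominators of every degree; this puts 0 into \<open>fracs m P\<close>
  for negative \<open>m\<close> as well.\<close>

locale denominators =
  fixes P :: "'a::field poly poly \<Rightarrow> bool"
  assumes one: "P 1" and mult: "P g \<Longrightarrow> P h \<Longrightarrow> P (g * h)" and nonzero: "P h \<Longrightarrow> h \<noteq> 0"
    and linear: "\<exists>h. P h \<and> homogeneous 1 h"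
begin

lemma fracsI: "homogeneous k g \<Longrightarrow> homogeneous l h \<Longrightarrow> P h \<Longrightarrow> int k = int l + m \<Longrightarrow> Fract g h \<in> fracs m P"
  unfolding fracs_def by blast

lemma fracsE:
  assumes "x \<in> fracs m P"
  obtains g h k l where "x = Fract g h" "homogeneous k g" "homogeneous l h" "P h" "h \<noteq> 0" "int k = int l + m"
  using assms nonzero unfolding fracs_def by blast

lemma fracs_form: "homogeneous k g \<Longrightarrow> Fract g 1 \<in> fracs (int k) P"
  by (rule fracsI[of k _ 0]) (auto simp: one)

lemma fracs_inverse_form: "homogeneous k h \<Longrightarrow> P h \<Longrightarrow> Fract 1 h \<in> fracs (- int k) P"
  by (rule fracsI[of 0 _ k]) auto

lemma power: "P h \<Longrightarrow> P (h ^ m)"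
  by (induction m) (auto simp: one mult)

lemma fracs_1: "1 \<in> fracs 0 P"
  unfolding One_fract_def by (rule fracsI[of 0 _ 0]) (auto simp: one)

lemma fracs_0: "0 \<in> fracs m P"
proof -
  obtain h where h: "P h" "homogeneous 1 h" using linear by blast
  have "homogeneous k (h ^ k)" for k using homogeneous_power[OF h(2), of k] by simp
  then have "Fract 0 (h ^ nat (- m)) \<in> fracs m P"
    by (intro fracsI[of "nat (int (nat (- m)) + m)" _ "nat (- m)"] power) (auto simp: h)
  moreover have "Fract 0 (h ^ nat (- m)) = 0"
    using nonzero[OF h(1)] by (simp add: Zero_fract_def eq_fract)
  ultimately show ?thesis by simp
qed

lemma fracs_uminus: "x \<in> fracs m P \<Longrightarrow> - x \<in> fracs m P"
  by (erule fracsE) (auto intro!: fracsI homogeneous_uminus)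

lemma fracs_add:
  assumes "x \<in> fracs m P" "y \<in> fracs m P"
  shows "x + y \<in> fracs m P"
proof -
  obtain g h k l where x: "x = Fract g h" "homogeneous k g" "homogeneous l h" "P h" "h \<noteq> 0" "int k = int l + m"
    using assms(1) by (rule fracsE)
  obtain g' h' k' l' where y: "y = Fract g' h'" "homogeneous k' g'" "homogeneous l' h'" "P h'" "h' \<noteq> 0" "int k' = int l' + m"
    using assms(2) by (rule fracsE)
  have "k' + l = k + l'" using x(6) y(6) by linarith
  then have "homogeneous (k + l') (g * h' + g' * h)"
    using homogeneous_mult[OF x(2) y(3)] homogeneous_mult[OF y(2) x(3)] by (auto intro: homogeneous_add)
  then have "Fract (g * h' + g' * h) (h * h') \<in> fracs m P"
    using x y by (intro fracsI[of "k + l'" _ "l + l'"] homogeneous_mult mult) auto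
  then show ?thesis using x y by simp
qed

lemma fracs_diff: "x \<in> fracs m P \<Longrightarrow> y \<in> fracs m P \<Longrightarrow> x - y \<in> fracs m P"
  using fracs_add[of x m "- y"] fracs_uminus[of y m] by simp

lemma fracs_mult:
  assumes "x \<in> fracs m P" "y \<in> fracs n P"
  shows "x * y \<in> fracs (m + n) P"
proof -
  obtain g h k l where x: "x = Fract g h" "homogeneous k g" "homogeneous l h" "P h" "h \<noteq> 0" "int k = int l + m"
    using assms(1) by (rule fracsE)
  obtain g' h' k' l' where y: "y = Fract g' h'" "homogeneous k' g'" "homogeneous l' h'" "P h'" "h' \<noteq> 0" "int k' = int l' + n"
    using assms(2) by (rule fracsE)
  have "Fract (g * g') (h * h') \<in> fracs (m + n) P"
    using x y by (intro fracsI[of "k + k'" _ "l + l'"] homogeneous_mult mult) auto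
  then show ?thesis using x y by simp
qed

lemma fracs_mult_eq: "x \<in> fracs m P \<Longrightarrow> y \<in> fracs n P \<Longrightarrow> k = m + n \<Longrightarrow> x * y \<in> fracs k P"
  using fracs_mult by blast

lemma fracs_sum: "(\<And>i. i \<in> I \<Longrightarrow> f i \<in> fracs m P) \<Longrightarrow> (\<Sum>i\<in>I. f i) \<in> fracs m P"
  by (induction I rule: infinite_finite_induct) (auto intro: fracs_add fracs_0)

lemma fracs_prod:
  "finite I \<Longrightarrow> (\<And>i. i \<in> I \<Longrightarrow> f i \<in> fracs m P) \<Longrightarrow> (\<Prod>i\<in>I. f i) \<in> fracs (int (card I) * m) P"
proof (induction I rule: finite_induct)
  case (insert i I)
  then have "f i * (\<Prod>i\<in>I. f i) \<in> fracs (m + int (card I) * m) P"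
    by (intro fracs_mult) auto
  then show ?case using insert by (simp add: algebra_simps)
qed (simp add: fracs_1)

text \<open>Every term of the Leibniz formula is a product of \<open>r\<close> factors of degree
  \<open>m\<close>; this is the origin of the term \<open>r m\<close> in all degrees below.\<close>

lemma fracs_det:
  assumes "\<And>i j. i < r \<Longrightarrow> j < r \<Longrightarrow> A i j \<in> fracs m P"
  shows "det (mat r r (\<lambda>(i, j). A i j)) \<in> fracs (int r * m) P"
proof -
  have "signof s * (\<Prod>i = 0..<r. mat r r (\<lambda>(i, j). A i j) $$ (i, s i)) \<in> fracs (int r * m) P"
    if s: "s permutes {0..<r}" for s
  proof -
    have "signof s \<in> fracs 0 P"
      using fracs_1 fracs_uminus by (auto simp: sign_def)
    moreover have "(\<Prod>i = 0..<r. mat r r (\<lambda>(i, j). A i j) $$ (i, s i)) \<in> fracs (int (card {0..<r}) * m) P"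
      using permutes_in_image[OF s] by (intro fracs_prod) (auto intro!: assms)
    ultimately show ?thesis using fracs_mult[of "signof s" 0] by simp
  qed
  then have "(\<Sum>s | s permutes {0..<r}. signof s * (\<Prod>i = 0..<r. mat r r (\<lambda>(i, j). A i j) $$ (i, s i)))
      \<in> fracs (int r * m) P"
    by (intro fracs_sum) blast
  then show ?thesis by (simp add: det_def)
qed

end

section \<open>Graded pieces and stalks as instances, and their orders\<close>

interpretation gr: denominators "\<lambda>h. h \<noteq> 0"
proof
  show "\<exists>h :: 'a poly poly. h \<noteq> 0 \<and> homogeneous 1 h" using homogeneous_X0 X0_nonzero by metis
qed auto

abbreviation graded :: "int \<Rightarrow> 'a::field poly poly fract set" where
  "graded m \<equiv> fracs m (\<lambda>h. h \<noteq> 0)"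

lemma denominators_nonvanishing: "p \<in> P1 \<Longrightarrow> denominators (\<lambda>h. nonvanishing h p)"
proof
  assume p: "p \<in> P1"
  show "\<exists>h. nonvanishing h p \<and> homogeneous 1 h" using nonvanishing_X0_X1[OF p] by metis
qed (use nonvanishing_nonzero in auto)

lemma twist_stalk_fracs: "twist_stalk m p = fracs m (\<lambda>h. nonvanishing h p)"
  by (simp add: twist_stalk_def fracs_def)

lemma function_field_graded: "function_field = graded 0"
  by (auto simp: function_field_def fracs_def)

lemma twist_stalk_graded: "p \<in> P1 \<Longrightarrow> x \<in> twist_stalk m p \<Longrightarrow> x \<in> graded m"
  unfolding twist_stalk_def fracs_def using nonvanishing_nonzero by blast

lemma graded_inverse:
  assumes "x \<in> graded m"
  shows "inverse x \<in> graded (- m)"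
proof (cases "x = 0")
  case False
  obtain g h k l where x: "x = Fract g h" "homogeneous k g" "homogeneous l h" "h \<noteq> 0" "int k = int l + m"
    using assms by (rule gr.fracsE)
  have "Fract h g \<in> graded (- m)"
    using x False by (intro gr.fracsI) (auto simp: Zero_fract_def eq_fract)
  then show ?thesis using x by simp
qed (simp add: gr.fracs_0)

lemma graded_divide: "x \<in> graded m \<Longrightarrow> y \<in> graded n \<Longrightarrow> x / y \<in> graded (m - n)"
  unfolding divide_inverse using gr.fracs_mult graded_inverse by fastforce

lemma order_at_Fract_form:
  assumes "p \<in> P1" "g \<noteq> 0" "h \<noteq> 0"
  shows "order_at p (Fract g h) = order_at p (Fract g 1) - order_at p (Fract h 1)"
proof -
  have "Fract g h = Fract g 1 / Fract h 1" by simp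
  moreover have "Fract g 1 \<noteq> 0" "Fract h 1 \<noteq> 0" using assms by (auto simp: Zero_fract_def eq_fract)
  ultimately show ?thesis using order_at_divide assms(1) by metis
qed

text \<open>Zeros minus poles of a homogeneous fraction: the numerator contributes its degree
  \<open>k\<close>, the denominator \<open>l\<close>, and \<open>k - l = m\<close>.\<close>

lemma has_total_order:
  fixes x :: "'a::alg_closed_field poly poly fract"
  assumes "x \<in> graded m" "x \<noteq> 0"
  shows "has_total (\<lambda>p. order_at p x) m"
proof -
  obtain g h k l where x: "x = Fract g h" "homogeneous k g" "homogeneous l h" "h \<noteq> 0" "int k = int l + m"
    using assms(1) by (rule gr.fracsE)
  have g: "g \<noteq> 0" using x assms(2) by (auto simp: Zero_fract_def eq_fract)
  have "has_total (\<lambda>p. order_at p (Fract g 1) - order_at p (Fract h 1)) (int k - int l)"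
    using x g by (intro has_total_diff has_total_order_form) auto
  then show ?thesis
    using has_total_cong[of "\<lambda>p. order_at p x" "\<lambda>p. order_at p (Fract g 1) - order_at p (Fract h 1)"]
      order_at_Fract_form x g by (auto simp: algebra_simps)
qed

lemma order_at_form_nonneg:
  assumes "p \<in> P1" "g \<noteq> 0"
  shows "order_at p (Fract g 1) \<ge> 0"
proof -
  obtain a b where p: "(a, b) \<noteq> (0, 0)" "p = pt a b" using assms(1) by (rule P1E)
  have "line_multiplicity a b 1 = 0" using p by (intro line_multiplicity_0I) auto
  then show ?thesis using p assms by (simp add: order_at_Fract)
qed

lemma order_at_stalk:
  assumes p: "p \<in> P1" and x: "x \<in> twist_stalk m p" "x \<noteq> 0"
  shows "order_at p x \<ge> 0"
proof -
  interpret denominators "\<lambda>h. nonvanishing h p" using p by (rule denominators_nonvanishing)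
  obtain g h k l where x': "x = Fract g h" "homogeneous k g" "homogeneous l h" "nonvanishing h p" "h \<noteq> 0"
    using x(1) unfolding twist_stalk_fracs by (rule fracsE)
  have g: "g \<noteq> 0" using x' x(2) by (auto simp: Zero_fract_def eq_fract)
  then show ?thesis
    using order_at_Fract_form[OF p g x'(5)] order_at_form_0I[OF p x'(4,3)] order_at_form_nonneg[OF p g] x'(1)
    by simp
qed

lemma homogeneous_line_power_cancel:
  "(a, b) \<noteq> (0, 0) \<Longrightarrow> g \<noteq> 0 \<Longrightarrow> homogeneous k (line a b ^ i * g) \<Longrightarrow> i \<le> k \<and> homogeneous (k - i) g"
proof (induction i arbitrary: k)
  case (Suc i)
  have nz: "line a b ^ Suc i * g \<noteq> 0" using Suc.prems(2) line_nonzero[OF Suc.prems(1)] by simp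
  \<comment> \<open>A form of degree 0 is constant; being a multiple of a linear form it vanishes at
    \<open>(a, b)\<close>, so it would be zero.\<close>
  have "k \<noteq> 0"
  proof
    assume "k = 0"
    then have c: "line a b ^ Suc i * g = [:[:coeff (coeff (line a b ^ Suc i * g) 0) 0:]:]"
      using Suc.prems homogeneous_0_degree by blast
    then have "eval_form (line a b ^ Suc i * g) a b = coeff (coeff (line a b ^ Suc i * g) 0) 0"
      by (metis eval_form_simps(5))
    then have "coeff (coeff (line a b ^ Suc i * g) 0) 0 = 0" by simp
    then show False using c nz by simp
  qed
  then obtain k' where k': "k = Suc k'" by (cases k) auto
  then have "homogeneous k' (line a b ^ i * g)"
    using Suc.prems homogeneous_line_cancel[of a b k' "line a b ^ i * g"] by (simp add: mult_ac)
  then show ?case using Suc.IH[OF Suc.prems(1,2)] k' by auto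
qed simp

text \<open>With \<open>order_at_stalk\<close> this makes the local ring the valuation ring of
  \<open>order_at p\<close>. All powers of the linear form of \<open>p\<close> are cancelled from
  the denominator; what remains is not divisible by that form, so it does not vanish at
  \<open>p\<close>.\<close>

lemma local_ringI:
  fixes x :: "'a::alg_closed_field poly poly fract"
  assumes p: "p \<in> P1" and x: "x \<in> function_field" "x \<noteq> 0" "order_at p x \<ge> 0"
  shows "x \<in> local_ring p"
proof -
  obtain g h k l where x': "x = Fract g h" "homogeneous k g" "homogeneous l h" "h \<noteq> 0" "int k = int l + 0"
    using x(1) unfolding function_field_graded by (rule gr.fracsE)
  have g0: "g \<noteq> 0" using x' x(2) by (auto simp: Zero_fract_def eq_fract)
  obtain a b where ab: "(a, b) \<noteq> (0, 0)" "p = pt a b" using p by (rule P1E)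
  obtain i g' where g: "g = line a b ^ i * g'" "\<not> line a b dvd g'" "g' \<noteq> 0"
    using line_multiplicity_exists[OF ab(1) g0] by blast
  obtain j h' where h: "h = line a b ^ j * h'" "\<not> line a b dvd h'" "h' \<noteq> 0"
    using line_multiplicity_exists[OF ab(1) x'(4)] by blast
  have "order_at p x = int i - int j"
    using ab x'(1,4) g0 g h line_multiplicity_eqI[OF ab(1)] order_at_Fract[OF ab(1) g0 x'(4)] by metis
  then have ij: "j \<le> i" using x(3) by linarith
  have gh': "i \<le> k" "homogeneous (k - i) g'" "j \<le> l" "homogeneous (l - j) h'"
    using homogeneous_line_power_cancel[OF ab(1)] g h x' by metis+
  have "nonvanishing h' p"
    using h(2) line_dvd_homogeneous[OF ab(1) gh'(4)] nonvanishing_pt[OF gh'(4)] ab(2) by blast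
  moreover have "homogeneous (l - j) (line a b ^ (i - j) * g')"
  proof -
    have "homogeneous ((i - j) * 1 + (k - i)) (line a b ^ (i - j) * g')"
      by (intro homogeneous_mult homogeneous_power homogeneous_line gh')
    moreover have "(i - j) * 1 + (k - i) = l - j" using x'(5) ij gh' by linarith
    ultimately show ?thesis by metis
  qed
  ultimately have "Fract (line a b ^ (i - j) * g') h' \<in> local_ring p"
    unfolding twist_stalk_def using gh'(4) by fastforce
  moreover have "Fract (line a b ^ (i - j) * g') h' = x"
  proof -
    have "line a b ^ i = line a b ^ j * line a b ^ (i - j)" using ij by (simp flip: power_add)
    then show ?thesis using x'(1,4) g h by (simp add: eq_fract mult_ac)
  qed
  ultimately show ?thesis by simp
qed

section \<open>Open sets\<close>

lemma open_subset_P1: "zariski_open U \<Longrightarrow> U \<subseteq> P1"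
  by (auto simp: zariski_open_def)

lemma open_basic: "homogeneous k h \<Longrightarrow> zariski_open {p \<in> P1. nonvanishing h p}"
  unfolding zariski_open_def by (rule exI[of _ "{h}"]) auto

lemma open_P1: "zariski_open P1"
  using open_basic[of 0 1] by simp

lemma open_Int:
  assumes "zariski_open U" "zariski_open V"
  shows "zariski_open (U \<inter> V)"
proof -
  obtain S where S: "\<forall>f\<in>S. \<exists>k. homogeneous k f" "U = {p \<in> P1. \<exists>f\<in>S. nonvanishing f p}"
    using assms(1) unfolding zariski_open_def by blast
  obtain T where T: "\<forall>f\<in>T. \<exists>k. homogeneous k f" "V = {p \<in> P1. \<exists>f\<in>T. nonvanishing f p}"
    using assms(2) unfolding zariski_open_def by blast
  have "\<forall>f\<in>{f * g | f g. f \<in> S \<and> g \<in> T}. \<exists>k. homogeneous k f"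
    using S(1) T(1) homogeneous_mult by blast
  moreover have "U \<inter> V = {p \<in> P1. \<exists>f\<in>{f * g | f g. f \<in> S \<and> g \<in> T}. nonvanishing f p}"
  proof (rule equalityI; rule subsetI)
    fix p assume "p \<in> U \<inter> V"
    then show "p \<in> {p \<in> P1. \<exists>f\<in>{f * g | f g. f \<in> S \<and> g \<in> T}. nonvanishing f p}"
      using S(2) T(2) nonvanishing_mult by blast
  next
    fix p assume "p \<in> {p \<in> P1. \<exists>f\<in>{f * g | f g. f \<in> S \<and> g \<in> T}. nonvanishing f p}"
    then obtain f g where "p \<in> P1" "f \<in> S" "g \<in> T" "nonvanishing (f * g) p" by blast
    then show "p \<in> U \<inter> V"
      using S T nonvanishing_mult_iff by blast
  qed
  ultimately show ?thesis unfolding zariski_open_def by blast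
qed

lemma open_INT:
  assumes "finite I" "\<And>i. i \<in> I \<Longrightarrow> zariski_open (U i)"
  shows "zariski_open (P1 \<inter> (\<Inter>i\<in>I. U i))"
  using assms
proof (induction I rule: finite_induct)
  case (insert i I)
  then have "zariski_open (U i \<inter> (P1 \<inter> (\<Inter>i\<in>I. U i)))" by (intro open_Int[of "U i"]) blast+
  moreover have "U i \<inter> (P1 \<inter> (\<Inter>i\<in>I. U i)) = P1 \<inter> (\<Inter>i\<in>insert i I. U i)" by blast
  ultimately show ?case by metis
qed (simp add: open_P1)

lemma order_at_form_vanishing:
  fixes f :: "'a::alg_closed_field poly poly"
  assumes p: "p \<in> P1" and f: "f \<noteq> 0" "homogeneous k f" "\<not> nonvanishing f p"
  shows "order_at p (Fract f 1) > 0"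
proof -
  obtain a b where ab: "(a, b) \<noteq> (0, 0)" "p = pt a b" using p by (rule P1E)
  have "eval_form f a b = 0" using f ab nonvanishing_pt[OF f(2)] by blast
  then obtain f' where f': "f = line a b * f'"
    using line_dvd_homogeneous[OF ab(1) f(2)] by (metis dvdE)
  have "Fract f 1 = Fract (line a b) 1 * Fract f' 1" by (simp add: f')
  moreover have nz: "Fract (line a b) 1 \<noteq> 0" "Fract f' 1 \<noteq> 0" "f' \<noteq> 0"
    using f(1) line_nonzero[OF ab(1)] by (auto simp: f' Zero_fract_def eq_fract)
  ultimately have "order_at p (Fract f 1) = 1 + order_at p (Fract f' 1)"
    using p ab(2) order_at_line[OF ab(1)] order_at_mult[OF p nz(1,2)] by simp
  then show ?thesis using order_at_form_nonneg[OF p nz(3)] by simp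
qed

lemma finite_zeros:
  fixes f :: "'a::alg_closed_field poly poly"
  assumes "f \<noteq> 0" "homogeneous k f"
  shows "finite {p \<in> P1. \<not> nonvanishing f p}"
proof (rule finite_subset)
  show "{p \<in> P1. \<not> nonvanishing f p} \<subseteq> {p \<in> P1. order_at p (Fract f 1) \<noteq> 0}"
    using order_at_form_vanishing[OF _ assms] by fastforce
  show "finite {p \<in> P1. order_at p (Fract f 1) \<noteq> 0}"
    using has_total_finite[OF has_total_order_form[OF assms(2,1)]] .
qed

lemma finite_compl_open:
  fixes U :: "'a::alg_closed_field point set"
  assumes "zariski_open U" "U \<noteq> {}"
  shows "finite (P1 - U)"
proof -
  obtain p where "p \<in> U" using assms by blast
  then obtain f k where f: "homogeneous k f" "nonvanishing f p" "p \<in> P1" "{q \<in> P1. nonvanishing f q} \<subseteq> U"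
    using assms(1) unfolding zariski_open_def by blast
  have "f \<noteq> 0" using f nonvanishing_nonzero by blast
  moreover have "P1 - U \<subseteq> {q \<in> P1. \<not> nonvanishing f q}" using f(4) by blast
  ultimately show ?thesis using finite_zeros[OF _ f(1)] finite_subset by blast
qed

lemma infinite_P1: "infinite (P1 :: 'a::alg_closed_field point set)"
proof
  assume fin: "finite (P1 :: 'a point set)"
  have "inj (\<lambda>t. pt (1::'a) t)"
  proof (rule injI)
    fix t u :: 'a assume "pt 1 t = pt 1 u"
    then have "(1, u) \<in> pt 1 t" using pt_self[of 1 u] by simp
    then show "t = u" by (auto simp: pt_def)
  qed
  moreover have "range (\<lambda>t. pt (1::'a) t) \<subseteq> P1" using pt_in_P1[of 1] by force
  ultimately have "finite (UNIV :: 'a set)"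
    using fin finite_subset finite_imageD by blast
  then show False using infinite_UNIV_alg_closed by blast
qed

text \<open>Irreducibility of the line: nonempty open sets have finite complements in an infinite
  set.\<close>

lemma open_Int_nonempty:
  fixes U :: "'a::alg_closed_field point set"
  assumes "zariski_open U" "U \<noteq> {}" "zariski_open V" "V \<noteq> {}"
  shows "U \<inter> V \<noteq> {}"
proof
  assume "U \<inter> V = {}"
  then have "P1 = (P1 - U) \<union> (P1 - V)" using assms open_subset_P1 by blast
  then show False using finite_compl_open[of U] finite_compl_open[of V] assms infinite_P1 by (metis finite_UnI)
qed

lemma open_INT_nonempty:
  fixes U :: "'i \<Rightarrow> 'a::alg_closed_field point set"
  assumes "finite I" "\<And>i. i \<in> I \<Longrightarrow> zariski_open (U i) \<and> U i \<noteq> {}"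
  shows "P1 \<inter> (\<Inter>i\<in>I. U i) \<noteq> {}"
proof
  assume "P1 \<inter> (\<Inter>i\<in>I. U i) = {}"
  then have "P1 \<subseteq> (\<Union>i\<in>I. P1 - U i)" by blast
  moreover have "finite (\<Union>i\<in>I. P1 - U i)" using assms finite_compl_open by blast
  ultimately show False using infinite_P1 finite_subset by blast
qed

lemma twist_stalk_open:
  assumes "x \<in> twist_stalk m p" "p \<in> P1"
  obtains U where "zariski_open U" "p \<in> U" "x \<in> twist m U"
proof -
  obtain g h k l where x: "x = Fract g h" "nonvanishing h p" "homogeneous k g" "homogeneous l h" "int k = int l + m"
    using assms(1) unfolding twist_stalk_def by blast
  have "x \<in> twist m {q \<in> P1. nonvanishing h q}"
    using x unfolding twist_def twist_stalk_def by blast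
  then show thesis using that open_basic[OF x(4)] x(2) assms(2) by blast
qed

lemma graded_open:
  fixes x :: "'a::alg_closed_field poly poly fract"
  assumes "x \<in> graded m"
  obtains U where "zariski_open U" "U \<noteq> {}" "x \<in> twist m U"
proof -
  obtain g h k l where x: "x = Fract g h" "homogeneous k g" "homogeneous l h" "h \<noteq> 0" "int k = int l + m"
    using assms by (rule gr.fracsE)
  have "{q \<in> P1. nonvanishing h q} \<noteq> {}"
  proof
    assume "{q \<in> P1. nonvanishing h q} = {}"
    then have "{q \<in> P1. \<not> nonvanishing h q} = P1" by blast
    then show False using finite_zeros[OF x(4,3)] infinite_P1 by metis
  qed
  moreover have "x \<in> twist m {q \<in> P1. nonvanishing h q}"
    using x unfolding twist_def twist_stalk_def by blast
  ultimately show thesis using that open_basic[OF x(3)] by blast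
qed

lemma twist_mono: "V \<subseteq> U \<Longrightarrow> twist m U \<subseteq> twist m V"
  by (auto simp: twist_def)


section \<open>Bases and minors\<close>

text \<open>The last clause of \<open>module_basis\<close>, set apart so that independence over the
  local ring and over the function field can be compared.\<close>

definition independent_over :: "'k::field set \<Rightarrow> nat \<Rightarrow> (nat \<Rightarrow> nat \<Rightarrow> 'k) \<Rightarrow> bool" where
  "independent_over R r v \<longleftrightarrow>
     (\<forall>c. (\<forall>i<r. c i \<in> R) \<and> (\<lambda>j. \<Sum>i<r. c i * v i j) = (\<lambda>_. 0) \<longrightarrow> (\<forall>i<r. c i = 0))"

lemma independent_over_mono: "R \<subseteq> R' \<Longrightarrow> independent_over R' r v \<Longrightarrow> independent_over R r v"
  unfolding independent_over_def by blast

lemma module_basis_altdef: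
  "module_basis R M r v \<longleftrightarrow> (\<forall>i<r. v i \<in> M) \<and>
     (\<forall>s\<in>M. \<exists>c. (\<forall>i<r. c i \<in> R) \<and> s = (\<lambda>j. \<Sum>i<r. c i * v i j)) \<and> independent_over R r v"
  by (simp add: module_basis_def independent_over_def)

lemma module_basis_memD: "module_basis R M r v \<Longrightarrow> i < r \<Longrightarrow> v i \<in> M"
  by (simp add: module_basis_def)

lemma module_basis_coords:
  assumes "module_basis R M r v" "\<And>i. i < k \<Longrightarrow> w i \<in> M"
  obtains A where "\<And>i j. i < k \<Longrightarrow> j < r \<Longrightarrow> A i j \<in> R" "\<And>i. i < k \<Longrightarrow> w i = (\<lambda>l. \<Sum>j<r. A i j * v j l)"
proof -
  have "\<exists>c. (\<forall>j<r. c j \<in> R) \<and> w i = (\<lambda>l. \<Sum>j<r. c j * v j l)" if "i < k" for i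
    using assms that unfolding module_basis_def by blast
  then show thesis using that by metis
qed

text \<open>Given a nonzero minor of the first \<open>r\<close> rows, a further column is adjoined
  and the determinant expanded along it. The cofactors depend only on the other columns, and the
  last one is the given minor. If the determinant vanished for every choice of the new column, the
  cofactors would be a nontrivial relation between the rows. Closure of \<open>R\<close> under
  determinants and signs puts the cofactors into \<open>R\<close>; this matters because independence
  is known only for coefficients in \<open>R\<close>, such as the function field inside the larger
  fraction field.\<close>

lemma minor_nonzero:
  fixes v :: "nat \<Rightarrow> nat \<Rightarrow> 'k::field"
  assumes R: "0 \<in> R" "\<And>x. x \<in> R \<Longrightarrow> - x \<in> R"
      "\<And>r A. (\<And>i j. i < r \<Longrightarrow> j < r \<Longrightarrow> A i j \<in> R) \<Longrightarrow> det (mat r r (\<lambda>(i, j). A i j)) \<in> R"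
    and v: "\<And>i j. i < r \<Longrightarrow> j < N \<Longrightarrow> v i j \<in> R"
    and indep: "\<And>c. (\<And>i. i < r \<Longrightarrow> c i \<in> R) \<Longrightarrow> (\<And>j. j < N \<Longrightarrow> (\<Sum>i<r. c i * v i j) = 0) \<Longrightarrow>
      (\<And>i. i < r \<Longrightarrow> c i = 0)"
  shows "\<exists>s. (\<forall>i<r. s i < N) \<and> det (mat r r (\<lambda>(i, j). v i (s j))) \<noteq> 0"
  using v indep
proof (induction r)
  case 0
  then show ?case by simp
next
  case (Suc r)
  have "\<exists>s. (\<forall>i<r. s i < N) \<and> det (mat r r (\<lambda>(i, j). v i (s j))) \<noteq> 0"
  proof (rule Suc.IH)
    fix c i assume c: "\<And>i. i < r \<Longrightarrow> c i \<in> R" "\<And>j. j < N \<Longrightarrow> (\<Sum>i<r. c i * v i j) = 0" and i: "i < r"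
    have "(if i < r then c i else 0) = 0"
      by (rule Suc.prems(2)[of "\<lambda>i. if i < r then c i else 0"]) (use c R(1) i in auto)
    then show "c i = 0" using i by simp
  qed (use Suc.prems(1) in auto)
  then obtain s where s: "\<And>i. i < r \<Longrightarrow> s i < N" and d: "det (mat r r (\<lambda>(i, j). v i (s j))) \<noteq> 0"
    by blast
  \<comment> \<open>The minor of size \<open>r + 1\<close> whose last column is column
    \<open>j\<close>; the other columns are those selected by \<open>s\<close>.\<close>
  define M where "M j = mat (Suc r) (Suc r) (\<lambda>(i, k). v i ((s(r := j)) k))" for j
  define c where "c i = (-1) ^ (i + r) * det (mat r r (\<lambda>(a, b). v (insert_index i a) (s b)))" for i
  have ins: "insert_index i a < Suc r" if "i < Suc r" "a < r" for i a
    using that by (auto simp: insert_index_def)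
  have cof: "cofactor (M j) i r = c i" if "i < Suc r" for i j
  proof -
    have "mat_delete (M j) i r = mat r r (\<lambda>(a, b). v (insert_index i a) (s b))"
      unfolding mat_delete_def M_def using that
      by (intro eq_matI) (auto simp: insert_index_def)
    then show ?thesis by (simp add: cofactor_def c_def)
  qed
  have "det (M j) = (\<Sum>i<Suc r. c i * v i j)" for j
  proof -
    have "det (M j) = (\<Sum>i<Suc r. M j $$ (i, r) * cofactor (M j) i r)"
      by (rule laplace_expansion_column) (simp_all add: M_def)
    also have "\<dots> = (\<Sum>i<Suc r. c i * v i j)"
    proof (rule sum.cong[OF refl])
      fix i assume "i \<in> {..<Suc r}"
      then have "i < Suc r" by simp
      moreover have "M j $$ (i, r) = v i j" using \<open>i < Suc r\<close> by (simp add: M_def)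
      ultimately show "M j $$ (i, r) * cofactor (M j) i r = c i * v i j" by (simp add: cof)
    qed
    finally show ?thesis .
  qed
  moreover have "c r \<noteq> 0"
  proof -
    have "mat r r (\<lambda>(a, b). v (insert_index r a) (s b)) = mat r r (\<lambda>(i, j). v i (s j))"
      by (intro eq_matI) (auto simp: insert_index_def)
    then show ?thesis using d by (simp add: c_def)
  qed
  moreover have "c i \<in> R" if "i < Suc r" for i
  proof -
    have "det (mat r r (\<lambda>(a, b). v (insert_index i a) (s b))) \<in> R"
      by (intro R(3)) (use Suc.prems(1) ins s that in auto)
    then show ?thesis unfolding c_def using R(2) by (cases "even (i + r)") auto
  qed
  ultimately obtain j where j: "j < N" "det (M j) \<noteq> 0"
    using Suc.prems(2)[of c r] by auto
  then have "\<forall>i<Suc r. (s(r := j)) i < N" using s by (auto simp: less_Suc_eq)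
  then show ?case using j(2) unfolding M_def by blast
qed

text \<open>A repeated column would make the determinant zero, so \<open>s\<close> is
  injective.\<close>

lemma minor_nonzero_card_le:
  assumes "\<forall>i<r. s i < N" "det (mat r r (\<lambda>(i, j). v i (s j))) \<noteq> (0 :: 'k::field)"
  shows "r \<le> N"
proof -
  have "inj_on s {..<r}"
  proof (rule inj_onI, rule ccontr)
    fix i j assume ij: "i \<in> {..<r}" "j \<in> {..<r}" "s i = s j" "i \<noteq> j"
    have "det (mat r r (\<lambda>(i, j). v i (s j))) = 0"
      by (rule det_identical_columns[of _ r i j]) (use ij in \<open>auto intro!: eq_vecI\<close>)
    then show False using assms(2) by blast
  qed
  then have "card (s ` {..<r}) = r" by (simp add: card_image)
  moreover have "s ` {..<r} \<subseteq> {..<N}" using assms(1) by auto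
  ultimately show ?thesis using card_mono[of "{..<N}" "s ` {..<r}"] by simp
qed

lemma sum_comb_swap:
  fixes c :: "nat \<Rightarrow> 'k::field"
  shows "(\<Sum>i<r. c i * (\<Sum>j<k. A i j * w j l)) = (\<Sum>j<k. (\<Sum>i<r. c i * A i j) * w j l)"
  unfolding sum_distrib_left sum_distrib_right
  by (subst sum.swap) (simp add: mult.assoc)

section \<open>Linear algebra over the function field\<close>

lemma function_field_closed:
  "0 \<in> (function_field :: 'a::field poly poly fract set)" "1 \<in> (function_field :: 'a::field poly poly fract set)"
  "x \<in> function_field \<Longrightarrow> - x \<in> (function_field :: 'a::field poly poly fract set)"
  "x \<in> function_field \<Longrightarrow> y \<in> function_field \<Longrightarrow> x + y \<in> (function_field :: 'a::field poly poly fract set)"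
  "x \<in> function_field \<Longrightarrow> y \<in> function_field \<Longrightarrow> x * y \<in> (function_field :: 'a::field poly poly fract set)"
  "x \<in> function_field \<Longrightarrow> y \<in> function_field \<Longrightarrow> x / y \<in> (function_field :: 'a::field poly poly fract set)"
  unfolding function_field_graded
  using gr.fracs_mult[of x 0 y 0] graded_divide[of x 0 y 0]
  by (auto intro: gr.fracs_0 gr.fracs_1 gr.fracs_uminus gr.fracs_add)

lemma function_field_sum: "(\<And>i. i \<in> I \<Longrightarrow> f i \<in> function_field) \<Longrightarrow> (\<Sum>i\<in>I. f i) \<in> function_field"
  unfolding function_field_graded by (rule gr.fracs_sum)

lemma function_field_det:
  "(\<And>i j. i < r \<Longrightarrow> j < r \<Longrightarrow> A i j \<in> function_field) \<Longrightarrow> det (mat r r (\<lambda>(i, j). A i j)) \<in> function_field"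
  unfolding function_field_graded using gr.fracs_det[of r A 0] by simp

text \<open>A relation between the rows of the coefficient matrix \<open>A\<close> is one between
  the vectors \<open>v i\<close>. So the rows are independent, and \<open>A\<close> has a nonzero
  minor of size \<open>r\<close> within its \<open>k\<close> columns.\<close>

lemma independent_le_span:
  fixes v w :: "nat \<Rightarrow> nat \<Rightarrow> 'a::field poly poly fract"
  assumes indep: "independent_over function_field r v"
    and A: "\<And>i j. i < r \<Longrightarrow> j < k \<Longrightarrow> A i j \<in> function_field" "\<And>i. i < r \<Longrightarrow> v i = (\<lambda>l. \<Sum>j<k. A i j * w j l)"
  shows "r \<le> k"
proof -
  have "\<exists>s. (\<forall>i<r. s i < k) \<and> det (mat r r (\<lambda>(i, j). A i (s j))) \<noteq> 0"
  proof (rule minor_nonzero[of function_field])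
    fix c i assume c: "\<And>i. i < r \<Longrightarrow> c i \<in> function_field" "\<And>j. j < k \<Longrightarrow> (\<Sum>i<r. c i * A i j) = 0" "i < r"
    have "(\<lambda>l. \<Sum>i<r. c i * v i l) = (\<lambda>l. \<Sum>i<r. c i * (\<Sum>j<k. A i j * w j l))"
      using A(2) by (intro ext sum.cong) auto
    also have "\<dots> = (\<lambda>_. 0)" unfolding sum_comb_swap using c(2) by simp
    finally show "c i = 0" using indep c(1,3) unfolding independent_over_def by blast
  qed (use A(1) function_field_closed(1,3) in \<open>auto intro!: function_field_det\<close>)
  then show ?thesis using minor_nonzero_card_le by blast
qed

lemma dependent_in_span:
  fixes v :: "nat \<Rightarrow> nat \<Rightarrow> 'a::field poly poly fract"
  assumes indep: "independent_over function_field r v" and dep: "\<not> independent_over function_field (Suc r) (v(r := s))"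
  shows "\<exists>c. (\<forall>i<r. c i \<in> function_field) \<and> s = (\<lambda>j. \<Sum>i<r. c i * v i j)"
proof -
  obtain c i where c: "\<And>i. i < Suc r \<Longrightarrow> c i \<in> function_field" "(\<lambda>j. \<Sum>i<Suc r. c i * (v(r := s)) i j) = (\<lambda>_. 0)"
    and i: "i < Suc r" "c i \<noteq> 0"
    using dep unfolding independent_over_def by blast
  have e: "(\<Sum>i<r. c i * v i j) + c r * s j = 0" for j
    using fun_cong[OF c(2), of j] by simp
  have cr: "c r \<noteq> 0"
  proof
    assume "c r = 0"
    then have "(\<lambda>j. \<Sum>i<r. c i * v i j) = (\<lambda>_. 0)" using e by auto
    then show False using indep c(1) i \<open>c r = 0\<close> unfolding independent_over_def
      by (metis less_Suc_eq)
  qed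
  have "s j = (\<Sum>i<r. - (c i / c r) * v i j)" for j
  proof -
    have "(\<Sum>i<r. - (c i / c r) * v i j) = - ((\<Sum>i<r. c i * v i j) / c r)"
      by (simp add: sum_negf sum_divide_distrib)
    also have "(\<Sum>i<r. c i * v i j) = - (c r * s j)" using e[of j] by (simp add: eq_neg_iff_add_eq_0)
    also have "- (- (c r * s j) / c r) = s j" using cr by simp
    finally show ?thesis by simp
  qed
  then have "s = (\<lambda>j. \<Sum>i<r. - (c i / c r) * v i j)" by blast
  moreover have "- (c i / c r) \<in> function_field" if "i < r" for i
    using c(1) that by (intro function_field_closed) auto
  ultimately show ?thesis by (intro exI[of _ "\<lambda>i. - (c i / c r)"]) blast
qed

text \<open>Adjoining any \<open>s\<close> in \<open>V\<close> to \<open>w\<close> gives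
  \<open>r + 1\<close> vectors in the span of \<open>r\<close>, hence a dependent family, and the
  relation can be solved for \<open>s\<close>.\<close>

lemma independent_basis:
  fixes v w :: "nat \<Rightarrow> nat \<Rightarrow> 'a::field poly poly fract"
  assumes basis: "module_basis function_field V r v" and w: "\<And>i. i < r \<Longrightarrow> w i \<in> V"
    and indep: "independent_over function_field r w"
  shows "module_basis function_field V r w"
  unfolding module_basis_altdef
proof (intro conjI ballI)
  fix s assume s: "s \<in> V"
  have mem: "(w(r := s)) i \<in> V" if "i < Suc r" for i
    using that w s by (auto simp: less_Suc_eq)
  obtain A where "\<And>i j. i < Suc r \<Longrightarrow> j < r \<Longrightarrow> A i j \<in> function_field"
      "\<And>i. i < Suc r \<Longrightarrow> (w(r := s)) i = (\<lambda>l. \<Sum>j<r. A i j * v j l)"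
    using module_basis_coords[OF basis, of "Suc r" "w(r := s)"] mem by blast
  then have "\<not> independent_over function_field (Suc r) (w(r := s))"
    using independent_le_span[of "Suc r" "w(r := s)" r A v] Suc_n_not_le_n by blast
  then show "\<exists>c. (\<forall>i<r. c i \<in> function_field) \<and> s = (\<lambda>j. \<Sum>i<r. c i * w i j)"
    using dependent_in_span indep by blast
qed (use w indep in auto)

lemma basis_size_unique:
  fixes v w :: "nat \<Rightarrow> nat \<Rightarrow> 'a::field poly poly fract"
  assumes "module_basis function_field V r v" "module_basis function_field V k w"
  shows "r = k"
proof -
  have "r \<le> k" if v: "module_basis function_field V r v" and w: "module_basis function_field V k w" for r k v w
  proof -
    obtain A where A: "\<And>i j. i < r \<Longrightarrow> j < k \<Longrightarrow> A i j \<in> function_field"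
      "\<And>i. i < r \<Longrightarrow> v i = (\<lambda>l. \<Sum>j<k. A i j * w j l)"
      using module_basis_coords[OF w, of r v] module_basis_memD[OF v] by blast
    have "independent_over function_field r v" using v by (simp add: module_basis_altdef)
    then show ?thesis using A by (rule independent_le_span)
  qed
  then show ?thesis using assms by (metis order_antisym)
qed

lemma sheaf_rank_eq: "module_basis function_field (generic_stalk F) r v \<Longrightarrow> sheaf_rank F = r"
  unfolding sheaf_rank_def using basis_size_unique by blast

lemma graded_nonzero: obtains t where "t \<in> graded m" "(t :: 'a::field poly poly fract) \<noteq> 0"
proof -
  have x: "Fract (X0 ^ k) 1 \<in> (graded (int k) :: 'a poly poly fract set)" for k
    by (intro gr.fracs_form) auto
  have nz: "Fract (X0 ^ k) 1 \<noteq> (0 :: 'a poly poly fract)" for k by (simp add: Zero_fract_def eq_fract)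
  show thesis
  proof (cases "m \<ge> 0")
    case True
    then show thesis using that[OF _ nz[of "nat m"]] x[of "nat m"] by simp
  next
    case False
    then have "inverse (Fract (X0 ^ nat (- m)) 1) \<in> (graded m :: 'a poly poly fract set)"
      using graded_inverse[OF x[of "nat (- m)"]] by simp
    moreover have "inverse (Fract (X0 ^ nat (- m)) 1) \<noteq> (0 :: 'a poly poly fract)"
      using nz[of "nat (- m)"] nonzero_imp_inverse_nonzero by blast
    ultimately show thesis by (rule that)
  qed
qed

text \<open>Dividing all entries by one nonzero element of degree \<open>m\<close> moves them into
  the function field and multiplies minors by a nonzero scalar.\<close>

lemma graded_minor:
  fixes v :: "nat \<Rightarrow> nat \<Rightarrow> 'a::field poly poly fract"
  assumes v: "\<And>i j. i < r \<Longrightarrow> j < N \<Longrightarrow> v i j \<in> graded m"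
    and indep: "\<And>c. (\<And>i. i < r \<Longrightarrow> c i \<in> function_field) \<Longrightarrow> (\<And>j. j < N \<Longrightarrow> (\<Sum>i<r. c i * v i j) = 0) \<Longrightarrow>
      (\<And>i. i < r \<Longrightarrow> c i = 0)"
  shows "\<exists>s. (\<forall>i<r. s i < N) \<and> det (mat r r (\<lambda>(i, j). v i (s j))) \<noteq> 0"
proof -
  obtain t :: "'a poly poly fract" where t: "t \<in> graded m" "t \<noteq> 0" by (rule graded_nonzero)
  have "\<exists>s. (\<forall>i<r. s i < N) \<and> det (mat r r (\<lambda>(i, j). v i (s j) / t)) \<noteq> 0"
  proof (rule minor_nonzero[of function_field])
    fix i j assume "i < r" "j < N"
    then show "v i j / t \<in> function_field"
      using graded_divide[OF v t(1)] by (simp add: function_field_graded)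
  next
    fix c i assume c: "\<And>i. i < r \<Longrightarrow> c i \<in> function_field" "\<And>j. j < N \<Longrightarrow> (\<Sum>i<r. c i * (v i j / t)) = 0" "i < r"
    have "(\<Sum>i<r. c i * v i j) = 0" if "j < N" for j
    proof -
      have "(\<Sum>i<r. c i * v i j) = (\<Sum>i<r. c i * (v i j / t)) * t"
        using t(2) by (simp add: sum_distrib_right)
      then show ?thesis using c(2)[OF that] by simp
    qed
    then show "c i = 0" using indep c by blast
  qed (use function_field_closed(1,3) in \<open>auto intro!: function_field_det\<close>)
  then obtain s where s: "\<forall>i<r. s i < N" "det (mat r r (\<lambda>(i, j). v i (s j) / t)) \<noteq> 0" by blast
  have "mat r r (\<lambda>(i, j). v i (s j) / t) = (1 / t) \<cdot>\<^sub>m mat r r (\<lambda>(i, j). v i (s j))"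
    by (intro eq_matI) auto
  then have "det (mat r r (\<lambda>(i, j). v i (s j))) \<noteq> 0" using s(2) by auto
  then show ?thesis using s(1) by blast
qed

text \<open>The local ring is a valuation ring: a nonzero coefficient of minimal order divides all
  the others.\<close>

lemma quotients_in_local_ring:
  fixes c :: "'i \<Rightarrow> 'a::alg_closed_field poly poly fract"
  assumes p: "p \<in> P1" and I: "finite I" "\<And>i. i \<in> I \<Longrightarrow> c i \<in> function_field" and ne: "\<exists>i\<in>I. c i \<noteq> 0"
  obtains k where "k \<in> I" "c k \<noteq> 0" "\<And>i. i \<in> I \<Longrightarrow> c i / c k \<in> local_ring p"
proof -
  let ?J = "{i \<in> I. c i \<noteq> 0}"
  have "finite ?J" "?J \<noteq> {}" using I(1) ne by auto
  then obtain k where k: "k \<in> ?J" "\<And>i. i \<in> ?J \<Longrightarrow> order_at p (c k) \<le> order_at p (c i)"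
    using arg_min_if_finite[of ?J "\<lambda>i. order_at p (c i)"] by (metis (no_types, lifting) linorder_not_le)
  interpret denominators "\<lambda>h. nonvanishing h p" using p by (rule denominators_nonvanishing)
  have "c i / c k \<in> local_ring p" if i: "i \<in> I" for i
  proof (cases "c i = 0")
    case True
    then show ?thesis using fracs_0 by (simp add: twist_stalk_fracs)
  next
    case False
    then show ?thesis using k i I(2) p by (intro local_ringI) (auto simp: function_field_closed order_at_divide)
  qed
  then show thesis using that k(1) by blast
qed

text \<open>Dividing a relation by a coefficient of minimal order turns it into a relation over the
  local ring with a coefficient 1.\<close>

lemma local_independent_function_field:
  fixes w :: "nat \<Rightarrow> nat \<Rightarrow> 'a::alg_closed_field poly poly fract"
  assumes p: "p \<in> P1" and indep: "independent_over (local_ring p) r w"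
  shows "independent_over function_field r w"
  unfolding independent_over_def
proof (rule allI, rule impI, rule ccontr)
  fix c assume c: "(\<forall>i<r. c i \<in> function_field) \<and> (\<lambda>j. \<Sum>i<r. c i * w i j) = (\<lambda>_. 0)"
    and "\<not> (\<forall>i<r. c i = 0)"
  then have "\<exists>i\<in>{..<r}. c i \<noteq> 0" by auto
  then obtain k where k: "k \<in> {..<r}" "c k \<noteq> 0" "\<And>i. i \<in> {..<r} \<Longrightarrow> c i / c k \<in> local_ring p"
    using quotients_in_local_ring[OF p, of "{..<r}" c] c by auto
  have "(\<lambda>j. \<Sum>i<r. (c i / c k) * w i j) = (\<lambda>j. (\<Sum>i<r. c i * w i j) / c k)"
    by (simp add: sum_divide_distrib)
  also have "\<dots> = (\<lambda>_. 0)" using c by (metis div_0)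
  finally have z: "(\<lambda>j. \<Sum>i<r. (c i / c k) * w i j) = (\<lambda>_. 0)" .
  have "\<forall>i<r. c i / c k = 0"
    by (rule mp[OF spec[OF indep[unfolded independent_over_def], of "\<lambda>i. c i / c k"]]) (use z k(3) in blast)
  then have "c k / c k = 0" using k(1) by blast
  then show False using k(2) by simp
qed

section \<open>The degree as an order of determinants\<close>

text \<open>Linearity over the whole fraction field, phrased for the finite combinations that occur
  in \<open>module_basis\<close>.\<close>

definition comb_linear :: "((nat \<Rightarrow> 'k::field) \<Rightarrow> 'k) \<Rightarrow> bool" where
  "comb_linear L \<longleftrightarrow> (\<forall>r c w. L (\<lambda>l. \<Sum>j<(r::nat). c j * w j l) = (\<Sum>j<r. c j * L (w j)))"

lemma comb_linear_sum: "comb_linear (\<lambda>s. \<Sum>i\<in>I. a i * s i)"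
  unfolding comb_linear_def
  by (auto simp: sum_distrib_left mult_ac intro: sum.swap)

lemma comb_linear_proj: "comb_linear (\<lambda>s. s i)"
  by (simp add: comb_linear_def)

text \<open>A minor in which linear functionals take the place of coordinates. This admits
  coordinates with respect to another basis, as needed for the equidistributed monomials.\<close>

definition functional_det :: "(nat \<Rightarrow> (nat \<Rightarrow> 'k) \<Rightarrow> 'k) \<Rightarrow> nat \<Rightarrow> (nat \<Rightarrow> nat \<Rightarrow> 'k) \<Rightarrow> 'k::field" where
  "functional_det L r v = det (mat r r (\<lambda>(i, j). L j (v i)))"

lemma functional_det_comb:
  assumes L: "\<And>j. j < r \<Longrightarrow> comb_linear (L j)"
    and A: "\<And>i. i < r \<Longrightarrow> v i = (\<lambda>l. \<Sum>j<r. A i j * w j l)"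
  shows "functional_det L r v = det (mat r r (\<lambda>(i, j). A i j)) * functional_det L r w"
proof -
  have "mat r r (\<lambda>(i, j). L j (v i)) = mat r r (\<lambda>(i, j). A i j) * mat r r (\<lambda>(i, j). L j (w i))"
  proof (rule eq_matI)
    fix i j assume "i < dim_row (mat r r (\<lambda>(i, j). A i j) * mat r r (\<lambda>(i, j). L j (w i)))"
      "j < dim_col (mat r r (\<lambda>(i, j). A i j) * mat r r (\<lambda>(i, j). L j (w i)))"
    then have ij: "i < r" "j < r" by auto
    have "L j (v i) = (\<Sum>k<r. A i k * L j (w k))"
      using L[OF ij(2)] A[OF ij(1)] by (simp add: comb_linear_def)
    then show "mat r r (\<lambda>(i, j). L j (v i)) $$ (i, j) = (mat r r (\<lambda>(i, j). A i j) * mat r r (\<lambda>(i, j). L j (w i))) $$ (i, j)"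
      using ij by (simp add: scalar_prod_def atLeast0LessThan)
  qed auto
  then show ?thesis unfolding functional_det_def by (simp add: det_mult[of _ r])
qed

text \<open>Each basis is expressed through the other with coefficients in the local ring. The two
  transition determinants have nonnegative order, so neither minor has the smaller order.\<close>

lemma functional_det_local_bases:
  fixes w w' :: "nat \<Rightarrow> nat \<Rightarrow> 'a::alg_closed_field poly poly fract"
  assumes p: "p \<in> P1" and L: "\<And>j. j < r \<Longrightarrow> comb_linear (L j)"
    and w: "module_basis (local_ring p) M r w" and w': "module_basis (local_ring p) M r w'"
    and nz: "functional_det L r w \<noteq> 0"
  shows "functional_det L r w' \<noteq> 0 \<and> order_at p (functional_det L r w') = order_at p (functional_det L r w)"
proof -
  interpret denominators "\<lambda>h. nonvanishing h p" using p by (rule denominators_nonvanishing)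
  have *: "\<exists>b\<in>local_ring p. functional_det L r w' = b * functional_det L r w"
    if w: "module_basis (local_ring p) M r w" and w': "module_basis (local_ring p) M r w'" for w w'
  proof -
    obtain A where A: "\<And>i j. i < r \<Longrightarrow> j < r \<Longrightarrow> A i j \<in> local_ring p" "\<And>i. i < r \<Longrightarrow> w' i = (\<lambda>l. \<Sum>j<r. A i j * w j l)"
      using module_basis_coords[OF w, of r w'] module_basis_memD[OF w'] by blast
    have "det (mat r r (\<lambda>(i, j). A i j)) \<in> local_ring p"
      using fracs_det[of r A 0] A(1) by (simp add: twist_stalk_fracs)
    then show ?thesis using functional_det_comb[of r L w' A w] L A(2) by blast
  qed
  obtain b where b: "b \<in> local_ring p" "functional_det L r w' = b * functional_det L r w" using *[OF w w'] by blast
  obtain b' where b': "b' \<in> local_ring p" "functional_det L r w = b' * functional_det L r w'" using *[OF w' w] by blast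
  have nz': "b' \<noteq> 0" "functional_det L r w' \<noteq> 0" using nz b'(2) by (metis mult_eq_0_iff)+
  then have nzb: "b \<noteq> 0" using b(2) by (metis mult_eq_0_iff)
  have "order_at p (functional_det L r w') = order_at p b + order_at p (functional_det L r w)"
    by (subst b(2)) (rule order_at_mult[OF p nzb nz])
  moreover have "order_at p (functional_det L r w) = order_at p b' + order_at p (functional_det L r w')"
    by (subst b'(2)) (rule order_at_mult[OF p nz'])
  ultimately show ?thesis
    using nz'(2) order_at_stalk[OF p b(1) nzb] order_at_stalk[OF p b'(1) nz'(1)] by linarith
qed

text \<open>If \<open>A\<close> expresses \<open>v\<close> through a local basis, the minor of
  \<open>v\<close> is \<open>det A\<close> times the minor of that basis. The order of
  \<open>det A\<close> is thus a difference of orders of minors, which is the same for every local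
  basis; hence the description has exactly one value.\<close>

lemma wedge_order_eq:
  fixes F :: "'a::alg_closed_field sheaf"
  assumes p: "p \<in> P1" and L: "\<And>j. j < r \<Longrightarrow> comb_linear (L j)"
    and w: "module_basis (local_ring p) (stalk F p) r w" "module_basis function_field (generic_stalk F) r w"
    and v: "\<And>i. i < r \<Longrightarrow> v i \<in> generic_stalk F" and nz: "functional_det L r v \<noteq> 0"
  shows "wedge_order F r v p = order_at p (functional_det L r v) - order_at p (functional_det L r w)"
  unfolding wedge_order_def
proof (rule the_equality)
  obtain A where A: "\<And>i j. i < r \<Longrightarrow> j < r \<Longrightarrow> A i j \<in> function_field" "\<And>i. i < r \<Longrightarrow> v i = (\<lambda>l. \<Sum>j<r. A i j * w j l)"
    using module_basis_coords[OF w(2), of r v] v by blast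
  have d: "functional_det L r v = det (mat r r (\<lambda>(i, j). A i j)) * functional_det L r w"
    using functional_det_comb[of r L v A w] L A(2) by blast
  then have nzw: "functional_det L r w \<noteq> 0" using nz by auto
  have "order_at p (functional_det L r v) = order_at p (det (mat r r (\<lambda>(i, j). A i j))) + order_at p (functional_det L r w)"
    using d nz p by (auto simp: order_at_mult)
  then have "order_at p (functional_det L r v) - order_at p (functional_det L r w) = order_at p (det (mat r r (\<lambda>(i, j). A i j)))"
    by simp
  then show "\<exists>w' A. module_basis (local_ring p) (stalk F p) r w' \<and>
      (\<forall>i<r. (\<forall>j<r. A i j \<in> function_field) \<and> v i = (\<lambda>l. \<Sum>j<r. A i j * w' j l)) \<and>
      order_at p (functional_det L r v) - order_at p (functional_det L r w) = order_at p (det (mat r r (\<lambda>(i, j). A i j)))"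
    using w(1) A by blast
  fix k assume "\<exists>w A. module_basis (local_ring p) (stalk F p) r w \<and>
      (\<forall>i<r. (\<forall>j<r. A i j \<in> function_field) \<and> v i = (\<lambda>l. \<Sum>j<r. A i j * w j l)) \<and>
      k = order_at p (det (mat r r (\<lambda>(i, j). A i j)))"
  then obtain w' A' where w': "module_basis (local_ring p) (stalk F p) r w'"
    "\<And>i. i < r \<Longrightarrow> v i = (\<lambda>l. \<Sum>j<r. A' i j * w' j l)" and k: "k = order_at p (det (mat r r (\<lambda>(i, j). A' i j)))"
    by blast
  have d': "functional_det L r v = det (mat r r (\<lambda>(i, j). A' i j)) * functional_det L r w'"
    using functional_det_comb[of r L v A' w'] L w'(2) by blast
  then have "order_at p (functional_det L r v) = k + order_at p (functional_det L r w')"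
    using nz p k by (auto simp: order_at_mult)
  moreover have "order_at p (functional_det L r w') = order_at p (functional_det L r w)"
    using functional_det_local_bases[OF p L w(1) w'(1) nzw] by blast
  ultimately show "k = order_at p (functional_det L r v) - order_at p (functional_det L r w)" by simp
qed

lemma stalk_subset_generic: "p \<in> P1 \<Longrightarrow> stalk F p \<subseteq> generic_stalk F"
  unfolding stalk_def generic_stalk_def by blast

lemma local_basis_generic:
  fixes F :: "'a::alg_closed_field sheaf"
  assumes p: "p \<in> P1" and w: "module_basis (local_ring p) (stalk F p) r w"
    and v: "module_basis function_field (generic_stalk F) r v"
  shows "module_basis function_field (generic_stalk F) r w"
proof (rule independent_basis[OF v])
  show "independent_over function_field r w"
    using local_independent_function_field[OF p] w by (simp add: module_basis_altdef)
  show "w i \<in> generic_stalk F" if "i < r" for i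
    using module_basis_memD[OF w that] stalk_subset_generic[OF p] by blast
qed

text \<open>The functionals have degree \<open>m\<close>, and \<open>t\<close> is the total order of
  their minor on the local bases \<open>W p\<close>. The basis \<open>v0\<close> certifies that this
  minor is not identically zero. The total is then computed for every rational basis, since
  \<open>sheaf_degree\<close> is a description over all of them.\<close>

lemma sheaf_degree_eq:
  fixes F :: "'a::alg_closed_field sheaf"
  assumes W: "\<And>p. p \<in> P1 \<Longrightarrow> module_basis (local_ring p) (stalk F p) r (W p)"
    and v0: "module_basis function_field (generic_stalk F) r v0"
    and L: "\<And>j. j < r \<Longrightarrow> comb_linear (L j)" "\<And>s j. s \<in> generic_stalk F \<Longrightarrow> j < r \<Longrightarrow> L j s \<in> graded m"
    and nz: "functional_det L r v0 \<noteq> 0"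
    and total: "has_total (\<lambda>p. order_at p (functional_det L r (W p))) t"
  shows "sheaf_degree F = int r * m - t"
proof -
  have rank: "sheaf_rank F = r" using v0 by (rule sheaf_rank_eq)
  have key: "has_total (wedge_order F r v) (int r * m - t)" if v: "module_basis function_field (generic_stalk F) r v" for v
  proof -
    have memv: "\<And>i. i < r \<Longrightarrow> v i \<in> generic_stalk F" using module_basis_memD[OF v] .
    obtain A where A: "\<And>i j. i < r \<Longrightarrow> j < r \<Longrightarrow> A i j \<in> function_field"
        "\<And>i. i < r \<Longrightarrow> v0 i = (\<lambda>l. \<Sum>j<r. A i j * v j l)"
      by (rule module_basis_coords[OF v module_basis_memD[OF v0]]) (assumption, rule that)
    have nzv: "functional_det L r v \<noteq> 0" using functional_det_comb[of r L v0 A v, OF L(1) A(2)] nz by auto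
    have "functional_det L r v \<in> graded (int r * m)"
      unfolding functional_det_def by (intro gr.fracs_det L(2) memv)
    then have "has_total (\<lambda>p. order_at p (functional_det L r v)) (int r * m)"
      using nzv by (rule has_total_order)
    from has_total_diff[OF this total]
    have "has_total (\<lambda>p. order_at p (functional_det L r v) - order_at p (functional_det L r (W p))) (int r * m - t)" .
    moreover have "wedge_order F r v p = order_at p (functional_det L r v) - order_at p (functional_det L r (W p))"
      if p: "p \<in> P1" for p
      using wedge_order_eq[OF p L(1) W[OF p] local_basis_generic[OF p W[OF p] v] memv nzv] .
    ultimately show ?thesis using has_total_cong by (metis (no_types, lifting))
  qed
  have total_wedge: "(\<Sum>p \<in> {p \<in> P1. wedge_order F r v p \<noteq> 0}. wedge_order F r v p) = int r * m - t"
    if "module_basis function_field (generic_stalk F) r v" for v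
    using key[OF that] by (simp only: has_total_def)
  show ?thesis unfolding sheaf_degree_def rank
  proof (rule the_equality)
    show "\<exists>v. module_basis function_field (generic_stalk F) r v \<and>
       int r * m - t = (\<Sum>p \<in> {p \<in> P1. wedge_order F r v p \<noteq> 0}. wedge_order F r v p)"
      using v0 total_wedge[OF v0, symmetric] by blast
  next
    fix k assume "\<exists>v. module_basis function_field (generic_stalk F) r v \<and>
       k = (\<Sum>p \<in> {p \<in> P1. wedge_order F r v p \<noteq> 0}. wedge_order F r v p)"
    then show "k = int r * m - t" using total_wedge by blast
  qed
qed


section \<open>Syzygy bundles\<close>

lemma generic_stalk_Syz:
  fixes f :: "nat \<Rightarrow> 'a::alg_closed_field poly poly"
  shows "generic_stalk (Syz d n f) =
    {s. (\<forall>i<n. s i \<in> graded (- int d)) \<and> (\<forall>i\<ge>n. s i = 0) \<and> (\<Sum>i<n. Fract (f i) 1 * s i) = 0}"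
    (is "?l = ?r")
proof (rule equalityI; rule subsetI)
  fix s assume "s \<in> ?l"
  then obtain U where U: "zariski_open U" "U \<noteq> {}" "s \<in> Syz d n f U" unfolding generic_stalk_def by blast
  then obtain p where p: "p \<in> U" "p \<in> P1" using open_subset_P1 by blast
  then have "s i \<in> graded (- int d)" if "i < n" for i
    using U(3) that twist_stalk_graded[OF p(2)] unfolding Syz_def twist_def by blast
  then show "s \<in> ?r" using U(3) unfolding Syz_def by blast
next
  fix s assume s: "s \<in> ?r"
  have "\<exists>U. zariski_open U \<and> U \<noteq> {} \<and> s i \<in> twist (- int d) U" if "i < n" for i
  proof -
    have "s i \<in> graded (- int d)" using s that by blast
    then obtain U where "zariski_open U" "U \<noteq> {}" "s i \<in> twist (- int d) U" by (rule graded_open)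
    then show ?thesis by blast
  qed
  then obtain U where U: "\<And>i. i < n \<Longrightarrow> zariski_open (U i) \<and> U i \<noteq> {} \<and> s i \<in> twist (- int d) (U i)"
    by metis
  define V where "V = P1 \<inter> (\<Inter>i\<in>{..<n}. U i)"
  have "zariski_open V" unfolding V_def by (rule open_INT) (use U in auto)
  moreover have "V \<noteq> {}" unfolding V_def by (rule open_INT_nonempty) (use U in auto)
  moreover have "s i \<in> twist (- int d) V" if "i < n" for i
    using U[OF that] twist_mono[of V "U i"] that unfolding V_def by blast
  ultimately show "s \<in> ?l" using s unfolding generic_stalk_def Syz_def by blast
qed

lemma stalk_Syz:
  fixes f :: "nat \<Rightarrow> 'a::alg_closed_field poly poly"
  assumes p: "p \<in> P1"
  shows "stalk (Syz d n f) p =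
    {s. (\<forall>i<n. s i \<in> twist_stalk (- int d) p) \<and> (\<forall>i\<ge>n. s i = 0) \<and> (\<Sum>i<n. Fract (f i) 1 * s i) = 0}"
    (is "?l = ?r")
proof (rule equalityI; rule subsetI)
  fix s assume "s \<in> ?l"
  then show "s \<in> ?r" unfolding stalk_def Syz_def twist_def by blast
next
  fix s assume s: "s \<in> ?r"
  have "\<exists>U. zariski_open U \<and> p \<in> U \<and> s i \<in> twist (- int d) U" if "i < n" for i
  proof -
    have "s i \<in> twist_stalk (- int d) p" using s that by blast
    then obtain U where "zariski_open U" "p \<in> U" "s i \<in> twist (- int d) U" using p by (rule twist_stalk_open)
    then show ?thesis by blast
  qed
  then obtain U where U: "\<And>i. i < n \<Longrightarrow> zariski_open (U i) \<and> p \<in> U i \<and> s i \<in> twist (- int d) (U i)"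
    by metis
  define V where "V = P1 \<inter> (\<Inter>i\<in>{..<n}. U i)"
  have "zariski_open V" unfolding V_def by (rule open_INT) (use U in auto)
  moreover have "p \<in> V" unfolding V_def using p U by blast
  moreover have "s i \<in> twist (- int d) V" if "i < n" for i
    using U[OF that] twist_mono[of V "U i"] that unfolding V_def by blast
  ultimately show "s \<in> ?l" using s unfolding stalk_def Syz_def by blast
qed

section \<open>Explicit bases of the stalks of a syzygy bundle\<close>

text \<open>The syzygy \<open>t\<close> times (unit vector \<open>\<tau> i\<close> minus
  \<open>f (\<tau> i) / f k\<close> times unit vector \<open>k\<close>), regular where
  \<open>f k\<close> does not vanish. The factor \<open>t\<close> will be \<open>1 / l ^ d\<close>
  with a linear form \<open>l\<close>, a local generator of O(-d).\<close>

definition syz_vec ::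
    "(nat \<Rightarrow> 'a::field poly poly) \<Rightarrow> nat \<Rightarrow> 'a poly poly fract \<Rightarrow> (nat \<Rightarrow> nat) \<Rightarrow> nat \<Rightarrow> nat \<Rightarrow> 'a poly poly fract" where
  "syz_vec f k t \<tau> i l = (if l = \<tau> i then t else if l = k then - (t * Fract (f (\<tau> i)) (f k)) else 0)"

text \<open>Where \<open>f k\<close> is invertible a syzygy can be solved for its coordinate
  \<open>k\<close>, so forgetting that coordinate is an isomorphism onto the remaining
  \<open>n - 1\<close> coordinates, enumerated by \<open>\<tau>\<close>. With \<open>P\<close> as a
  parameter this covers the generic stalk and all stalks at points.\<close>

lemma (in denominators) syz_vec_basis:
  assumes n: "k < n" and f: "\<And>i. i < n \<Longrightarrow> homogeneous d (f i)" and k: "P (f k)"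
    and l: "P l" "homogeneous 1 l" and t: "t = Fract 1 (l ^ d)"
    and \<tau>: "bij_betw \<tau> {..<n - 1} ({..<n} - {k})"
  shows "module_basis (fracs 0 P)
    {s. (\<forall>i<n. s i \<in> fracs (- int d) P) \<and> (\<forall>i\<ge>n. s i = 0) \<and> (\<Sum>i<n. Fract (f i) 1 * s i) = 0}
    (n - 1) (syz_vec f k t \<tau>)" (is "module_basis _ ?M _ _")
  unfolding module_basis_def
proof (intro conjI allI ballI impI)
  have ld: "P (l ^ d)" "homogeneous d (l ^ d)"
    using homogeneous_power[OF l(2), of d] l(1) by (auto intro: power)
  have t_frac: "t \<in> fracs (- int d) P" unfolding t using fracs_inverse_form[OF ld(2,1)] .
  have t0: "t \<noteq> 0" unfolding t using nonzero[OF ld(1)] by (simp add: Zero_fract_def eq_fract)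
  have fk: "f k \<noteq> 0" using nonzero[OF k] .
  then have Fk: "Fract (f k) 1 \<noteq> 0" by (simp add: Zero_fract_def eq_fract)
  have alg: "x * y - z * (y * (x / z)) = 0" if "z \<noteq> 0" for x y z :: "'a poly poly fract"
    using that by simp
  have \<tau>i: "\<tau> i < n" "\<tau> i \<noteq> k" if "i < n - 1" for i
    using bij_betwE[OF \<tau>] that by auto
  have \<tau>inj: "\<tau> i = \<tau> j \<longleftrightarrow> i = j" if "i < n - 1" "j < n - 1" for i j
    using bij_betw_imp_inj_on[OF \<tau>] that by (auto dest: inj_onD)
  have diag: "(\<Sum>i<n - 1. c i * syz_vec f k t \<tau> i (\<tau> j)) = c j * t" if "j < n - 1" for c j
  proof -
    have "(\<Sum>i<n - 1. c i * syz_vec f k t \<tau> i (\<tau> j)) = (\<Sum>i<n - 1. if i = j then c j * t else 0)"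
      by (rule sum.cong) (use that \<tau>inj \<tau>i in \<open>auto simp: syz_vec_def\<close>)
    then show ?thesis using that by simp
  qed
  {
    fix i assume i: "i < n - 1"
    have "(\<Sum>l<n. Fract (f l) 1 * syz_vec f k t \<tau> i l)
        = (\<Sum>l\<in>{\<tau> i, k}. Fract (f l) 1 * syz_vec f k t \<tau> i l)"
      by (rule sum.mono_neutral_right) (use \<tau>i[OF i] n in \<open>auto simp: syz_vec_def\<close>)
    also have "\<dots> = Fract (f (\<tau> i)) 1 * t - Fract (f k) 1 * (t * Fract (f (\<tau> i)) (f k))"
      using \<tau>i[OF i] by (simp add: syz_vec_def)
    also have "Fract (f (\<tau> i)) (f k) = Fract (f (\<tau> i)) 1 / Fract (f k) 1" by simp
    also have "Fract (f (\<tau> i)) 1 * t - Fract (f k) 1 * (t * (Fract (f (\<tau> i)) 1 / Fract (f k) 1)) = 0"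
      by (rule alg[OF Fk])
    finally have "(\<Sum>l<n. Fract (f l) 1 * syz_vec f k t \<tau> i l) = 0" .
    moreover have "syz_vec f k t \<tau> i l \<in> fracs (- int d) P" for l
    proof -
      have "Fract (f (\<tau> i)) (f k) \<in> fracs 0 P"
        using f n k \<tau>i[OF i] by (intro fracsI[of d _ d]) auto
      then have "t * Fract (f (\<tau> i)) (f k) \<in> fracs (- int d) P"
        using fracs_mult[OF t_frac] by fastforce
      then show ?thesis unfolding syz_vec_def using t_frac fracs_uminus fracs_0 by auto
    qed
    moreover have "syz_vec f k t \<tau> i l = 0" if "l \<ge> n" for l
      using that \<tau>i[OF i] n by (auto simp: syz_vec_def)
    ultimately show "syz_vec f k t \<tau> i \<in> ?M" by blast
  }
  {
    fix s assume s: "s \<in> ?M"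
    define c where "c i = s (\<tau> i) / t" for i
    have "c i \<in> fracs 0 P" if "i < n - 1" for i
    proof -
      have "c i = s (\<tau> i) * Fract (l ^ d) 1"
        unfolding c_def t divide_inverse by simp
      also have "\<dots> \<in> fracs 0 P"
        by (rule fracs_mult_eq[of _ "- int d" _ "int d"])
           (use s \<tau>i[OF that] fracs_form[OF ld(2)] in auto)
      finally show ?thesis .
    qed
    moreover have "s j = (\<Sum>i<n - 1. c i * syz_vec f k t \<tau> i j)" for j
    proof -
      consider "j \<ge> n" | "j < n" "j \<noteq> k" | "j = k" by linarith
      then show ?thesis
      proof cases
        case 1
        have "c i * syz_vec f k t \<tau> i j = 0" if "i < n - 1" for i
          using 1 n \<tau>i[OF that] by (auto simp: syz_vec_def)
        then have "(\<Sum>i<n - 1. c i * syz_vec f k t \<tau> i j) = 0" by (intro sum.neutral) auto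
        then show ?thesis using 1 s by simp
      next
        case 2
        then obtain i where "i < n - 1" "j = \<tau> i"
          using bij_betw_imp_surj_on[OF \<tau>] by (metis DiffI imageE lessThan_iff singletonD)
        then show ?thesis using diag[of i c] t0 by (simp add: c_def)
      next
        case 3
        have "(\<Sum>i<n - 1. c i * syz_vec f k t \<tau> i j) = (\<Sum>i<n - 1. - (s (\<tau> i) * Fract (f (\<tau> i)) 1 / Fract (f k) 1))"
        proof (rule sum.cong[OF refl])
          fix i assume "i \<in> {..<n - 1}"
          then have "\<tau> i \<noteq> k" using \<tau>i by simp
          then have "c i * syz_vec f k t \<tau> i j = - (s (\<tau> i) / t * (t * Fract (f (\<tau> i)) (f k)))"
            using 3 by (simp add: c_def syz_vec_def)
          also have "\<dots> = - (s (\<tau> i) * Fract (f (\<tau> i)) (f k))" using t0 by simp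
          also have "Fract (f (\<tau> i)) (f k) = Fract (f (\<tau> i)) 1 / Fract (f k) 1" by simp
          finally show "c i * syz_vec f k t \<tau> i j = - (s (\<tau> i) * Fract (f (\<tau> i)) 1 / Fract (f k) 1)"
            by (simp only: times_divide_eq_right)
        qed
        also have "\<dots> = - ((\<Sum>i<n - 1. Fract (f (\<tau> i)) 1 * s (\<tau> i)) / Fract (f k) 1)"
          unfolding sum_negf sum_divide_distrib by (simp only: mult.commute)
        also have "(\<Sum>i<n - 1. Fract (f (\<tau> i)) 1 * s (\<tau> i)) = (\<Sum>i\<in>{..<n} - {k}. Fract (f i) 1 * s i)"
          by (rule sum.reindex_bij_betw[OF \<tau>])
        also have "(\<Sum>i\<in>{..<n} - {k}. Fract (f i) 1 * s i) = - (Fract (f k) 1 * s k)"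
        proof -
          have "(\<Sum>i<n. Fract (f i) 1 * s i) = Fract (f k) 1 * s k + (\<Sum>i\<in>{..<n} - {k}. Fract (f i) 1 * s i)"
            by (rule sum.remove) (use n in auto)
          then show ?thesis using s by (simp add: eq_neg_iff_add_eq_0 add.commute)
        qed
        also have "- (- (Fract (f k) 1 * s k) / Fract (f k) 1) = s k" using Fk by simp
        finally show ?thesis using 3 by simp
      qed
    qed
    ultimately show "\<exists>c. (\<forall>i<n - 1. c i \<in> fracs 0 P) \<and> s = (\<lambda>j. \<Sum>i<n - 1. c i * syz_vec f k t \<tau> i j)"
      by blast
  }
  fix c i assume c: "(\<forall>i<n - 1. c i \<in> fracs 0 P) \<and> (\<lambda>j. \<Sum>i<n - 1. c i * syz_vec f k t \<tau> i j) = (\<lambda>_. 0)" "i < n - 1"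
  have "c i * t = 0" using fun_cong[OF conjunct2[OF c(1)], of "\<tau> i"] unfolding diag[OF c(2)] .
  then show "c i = 0" using t0 by simp
qed

lemma det_syz_vec_same:
  assumes \<sigma>: "bij_betw \<sigma> {..<r} ({..<n} - {k})"
  shows "functional_det (\<lambda>j s. s (\<sigma> j)) r (syz_vec f k t \<sigma>) = t ^ r"
proof -
  have "mat r r (\<lambda>(i, j). syz_vec f k t \<sigma> i (\<sigma> j)) = t \<cdot>\<^sub>m 1\<^sub>m r"
  proof (rule eq_matI)
    fix i j assume "i < dim_row (t \<cdot>\<^sub>m 1\<^sub>m r)" "j < dim_col (t \<cdot>\<^sub>m 1\<^sub>m r)"
    then have ij: "i < r" "j < r" by auto
    then have "\<sigma> j \<noteq> k" "\<sigma> i = \<sigma> j \<longleftrightarrow> i = j"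
      using bij_betwE[OF \<sigma>] bij_betw_imp_inj_on[OF \<sigma>] by (auto dest: inj_onD)
    then show "mat r r (\<lambda>(i, j). syz_vec f k t \<sigma> i (\<sigma> j)) $$ (i, j) = (t \<cdot>\<^sub>m 1\<^sub>m r) $$ (i, j)"
      using ij by (auto simp: syz_vec_def)
  qed auto
  then show ?thesis by (simp add: functional_det_def)
qed

text \<open>The matrix is a multiple of the identity with one column replaced, so Cramer's rule gives its
  determinant.\<close>

lemma det_syz_vec_exchange:
  assumes \<sigma>: "bij_betw \<sigma> {..<r} ({..<n} - {j0})" and k: "k < n" "k \<noteq> j0" "f k \<noteq> 0"
  defines "\<tau> \<equiv> \<lambda>i. if \<sigma> i = k then j0 else \<sigma> i"
  shows "functional_det (\<lambda>j s. s (\<sigma> j)) r (syz_vec f k t \<tau>) = - (t ^ r * Fract (f j0) (f k))"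
proof -
  obtain i0 where i0: "i0 < r" "\<sigma> i0 = k"
    using bij_betw_imp_surj_on[OF \<sigma>] k(1,2) by (metis DiffI imageE lessThan_iff singletonD)
  have inj: "\<sigma> i = \<sigma> j \<longleftrightarrow> i = j" if "i < r" "j < r" for i j
    using bij_betw_imp_inj_on[OF \<sigma>] that by (auto dest: inj_onD)
  define y where "y = vec r (\<lambda>i. - Fract (f (\<tau> i)) (f k))"
  have "mat r r (\<lambda>(i, j). syz_vec f k t \<tau> i (\<sigma> j)) = t \<cdot>\<^sub>m replace_col (1\<^sub>m r) (1\<^sub>m r *\<^sub>v y) i0"
  proof (rule eq_matI)
    fix i j assume "i < dim_row (t \<cdot>\<^sub>m replace_col (1\<^sub>m r) (1\<^sub>m r *\<^sub>v y) i0)" "j < dim_col (t \<cdot>\<^sub>m replace_col (1\<^sub>m r) (1\<^sub>m r *\<^sub>v y) i0)"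
    then have ij: "i < r" "j < r" by (auto simp: replace_col_def)
    have jk: "\<sigma> j = k \<longleftrightarrow> j = i0" using inj[of j i0] ij i0 by auto
    have ik: "\<sigma> i = k \<longleftrightarrow> i = i0" using inj[of i i0] ij i0 by auto
    have "\<sigma> j \<noteq> j0" using bij_betwE[OF \<sigma>] ij by auto
    moreover have "y \<in> carrier_vec r" by (simp add: y_def)
    ultimately show "mat r r (\<lambda>(i, j). syz_vec f k t \<tau> i (\<sigma> j)) $$ (i, j)
        = (t \<cdot>\<^sub>m replace_col (1\<^sub>m r) (1\<^sub>m r *\<^sub>v y) i0) $$ (i, j)"
      using ij inj[of i j] jk ik k(2) by (auto simp: syz_vec_def \<tau>_def replace_col_def y_def simp del: minus_fract)
  qed (auto simp: replace_col_def)
  moreover have "det (replace_col (1\<^sub>m r) (1\<^sub>m r *\<^sub>v y) i0) = y $ i0 * det (1\<^sub>m r)"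
    by (rule cramer_lemma_mat) (auto simp: y_def i0)
  moreover have "dim_col (replace_col (1\<^sub>m r) (1\<^sub>m r *\<^sub>v y) i0) = r" by (simp add: replace_col_def)
  ultimately show ?thesis
    using i0 by (simp add: functional_det_def y_def \<tau>_def del: minus_fract)
qed

lemma bij_exchange:
  assumes \<sigma>: "bij_betw \<sigma> {..<r} ({..<n} - {j0})" and k: "k < n" "k \<noteq> j0" "j0 < n"
  shows "bij_betw (\<lambda>i. if \<sigma> i = k then j0 else \<sigma> i) {..<r} ({..<n} - {k})"
proof -
  have "bij_betw (\<lambda>x. if x = k then j0 else x) ({..<n} - {j0}) ({..<n} - {k})"
    by (rule bij_betw_byWitness[where f' = "\<lambda>x. if x = j0 then k else x"]) (use k in auto)
  from bij_betw_trans[OF \<sigma> this] show ?thesis by (simp add: comp_def)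
qed

text \<open>The minor omitting a fixed coordinate \<open>j0\<close> with \<open>f j0\<close> nonzero
  is used at all points. Where \<open>f k\<close> does not vanish, the local basis omits coordinate
  \<open>k\<close> instead, and its minor is, up to sign and a power of the unit \<open>t\<close>,
  the quotient of \<open>f j0\<close> by \<open>f k\<close>. So the local order is that of
  \<open>f j0\<close> everywhere, with total \<open>d\<close>, and the degree is
  \<open>(n - 1) (- d) - d\<close>.\<close>

lemma Syz_rank_degree:
  fixes f :: "nat \<Rightarrow> 'a::alg_closed_field poly poly"
  assumes f: "\<And>i. i < n \<Longrightarrow> homogeneous d (f i)"
    and no_zero: "\<And>p. p \<in> P1 \<Longrightarrow> \<exists>k<n. nonvanishing (f k) p"
  shows "sheaf_rank (Syz d n f) = n - 1" "sheaf_degree (Syz d n f) = - int (n * d)"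
proof -
  have "pt 1 0 \<in> (P1 :: 'a point set)" by (rule pt_in_P1) simp
  then obtain j0 where j0: "j0 < n" "f j0 \<noteq> 0" using no_zero nonvanishing_nonzero by blast
  have "card {..<n - 1} = card ({..<n} - {j0})" using j0(1) by simp
  then obtain \<sigma> where \<sigma>: "bij_betw \<sigma> {..<n - 1} ({..<n} - {j0})"
    using finite_same_card_bij[of "{..<n - 1}" "{..<n} - {j0}"] by auto
  define v0 where "v0 = syz_vec f j0 (Fract 1 (X0 ^ d)) \<sigma>"
  have v0: "module_basis function_field (generic_stalk (Syz d n f)) (n - 1) v0"
    unfolding generic_stalk_Syz function_field_graded v0_def
    by (rule gr.syz_vec_basis[where l = X0]) (use j0 f \<sigma> homogeneous_X0 in simp_all)
  then show rank: "sheaf_rank (Syz d n f) = n - 1" by (rule sheaf_rank_eq)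
  let ?L = "\<lambda>j s :: nat \<Rightarrow> 'a poly poly fract. s (\<sigma> j)"
  have "\<exists>w. module_basis (local_ring p) (stalk (Syz d n f) p) (n - 1) w \<and>
      order_at p (functional_det ?L (n - 1) w) = order_at p (Fract (f j0) 1)"
    if p: "p \<in> P1" for p
  proof -
    interpret denominators "\<lambda>h. nonvanishing h p" using p by (rule denominators_nonvanishing)
    obtain l where l: "nonvanishing l p" "homogeneous 1 l" using nonvanishing_X0_X1[OF p] by metis
    obtain k where k: "k < n" "nonvanishing (f k) p" using no_zero[OF p] by blast
    have fk: "f k \<noteq> 0" using nonzero k(2) by blast
    define t where "t = Fract 1 (l ^ d)"
    have ld: "nonvanishing (l ^ d) p" "homogeneous d (l ^ d)" "l ^ d \<noteq> 0"
      using l homogeneous_power[OF l(2), of d] nonzero[OF l(1)] by auto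
    have t0: "t \<noteq> 0" unfolding t_def using ld(3) by (simp add: Zero_fract_def eq_fract)
    have "order_at p t = 0"
      using order_at_Fract_nonvanishing[OF p ld(3), of 1 0] order_at_form_0I[OF p ld(1,2)] by (simp add: t_def)
    then have ord_t: "order_at p (t ^ m) = 0" for m
      by (induction m) (use t0 order_at_1[OF p] order_at_mult[OF p] in auto)
    have basis: "module_basis (local_ring p) (stalk (Syz d n f) p) (n - 1) (syz_vec f k t \<tau>)"
      if "bij_betw \<tau> {..<n - 1} ({..<n} - {k})" for \<tau>
      unfolding stalk_Syz[OF p] twist_stalk_fracs
      by (rule syz_vec_basis[where l = l]) (use k f l t_def that in simp_all)
    show ?thesis
    proof (cases "k = j0")
      case True
      have "order_at p (Fract (f j0) 1) = 0"
        using order_at_form_0I[OF p k(2) f[OF k(1)]] True by simp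
      then show ?thesis
        using basis[of \<sigma>] \<sigma> True det_syz_vec_same[OF \<sigma>, of f t] ord_t by metis
    next
      case False
      let ?\<tau> = "\<lambda>i. if \<sigma> i = k then j0 else \<sigma> i"
      have F: "Fract (f j0) (f k) \<noteq> 0" using j0(2) fk by (simp add: Zero_fract_def eq_fract)
      have "- (t ^ (n - 1) * Fract (f j0) (f k)) = (- (t ^ (n - 1))) * Fract (f j0) (f k)" by simp
      moreover have "order_at p (- (t ^ (n - 1))) = 0"
      proof -
        have "order_at p (- 1 :: 'a poly poly fract) = 0"
          using order_at_mult[OF p, of "-1" "-1"] order_at_1[OF p] by simp
        then show ?thesis using order_at_mult[OF p, of "-1" "t ^ (n - 1)"] ord_t t0 by simp
      qed
      ultimately have "order_at p (- (t ^ (n - 1) * Fract (f j0) (f k))) = order_at p (Fract (f j0) (f k))"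
        using order_at_mult[OF p, of "- (t ^ (n - 1))" "Fract (f j0) (f k)"] t0 F by simp
      also have "\<dots> = order_at p (Fract (f j0) 1)"
        using order_at_Fract_form[OF p j0(2) fk] order_at_form_0I[OF p k(2) f[OF k(1)]] by simp
      finally have "order_at p (functional_det ?L (n - 1) (syz_vec f k t ?\<tau>)) = order_at p (Fract (f j0) 1)"
        unfolding det_syz_vec_exchange[of \<sigma> "n - 1" n j0 k f t, OF \<sigma> k(1) False fk] .
      then show ?thesis using basis[OF bij_exchange[OF \<sigma> k(1) False j0(1)]] by blast
    qed
  qed
  then obtain W where W: "\<And>p. p \<in> P1 \<Longrightarrow> module_basis (local_ring p) (stalk (Syz d n f) p) (n - 1) (W p)"
    "\<And>p. p \<in> P1 \<Longrightarrow> order_at p (functional_det ?L (n - 1) (W p)) = order_at p (Fract (f j0) 1)"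
    by metis
  have "has_total (\<lambda>p. order_at p (Fract (f j0) 1)) (int d)"
    using has_total_order_form[OF f[OF j0(1)] j0(2)] .
  then have total: "has_total (\<lambda>p. order_at p (functional_det ?L (n - 1) (W p))) (int d)"
    using has_total_cong[of "\<lambda>p. order_at p (functional_det ?L (n - 1) (W p))" "\<lambda>p. order_at p (Fract (f j0) 1)"] W(2) by blast
  have "sheaf_degree (Syz d n f) = int (n - 1) * (- int d) - int d"
  proof (rule sheaf_degree_eq[where L = ?L, OF W(1) v0 _ _ _ total])
    show "?L j s \<in> graded (- int d)" if "s \<in> generic_stalk (Syz d n f)" "j < n - 1" for j s
      using that bij_betwE[OF \<sigma>] unfolding generic_stalk_Syz by auto
    have "Fract 1 (X0 ^ d) \<noteq> (0 :: 'a poly poly fract)" by (simp add: Zero_fract_def eq_fract)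
    then show "functional_det ?L (n - 1) v0 \<noteq> 0"
      unfolding v0_def det_syz_vec_same[OF \<sigma>] by simp
  qed (simp_all add: comb_linear_proj)
  also have "\<dots> = - int (n * d)"
    using j0(1) by (cases n) (simp_all add: algebra_simps)
  finally show "sheaf_degree (Syz d n f) = - int (n * d)" .
qed


section \<open>The line subbundle spanned by a syzygy\<close>

definition form_vector :: "nat \<Rightarrow> (nat \<Rightarrow> 'a::field poly poly) \<Rightarrow> 'a poly poly fract \<Rightarrow> nat \<Rightarrow> 'a poly poly fract" where
  "form_vector n G c i = (if i < n then c * Fract (G i) 1 else 0)"

lemma form_vector_zero: "form_vector n G 0 = (\<lambda>_. 0)"
  by (auto simp: form_vector_def)

lemma form_vector_add: "(\<lambda>i. form_vector n G b i + form_vector n G c i) = form_vector n G (b + c)"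
  by (auto simp: form_vector_def algebra_simps)

lemma form_vector_scale: "(\<lambda>i. c * form_vector n G b i) = form_vector n G (c * b)"
  by (auto simp: form_vector_def mult.assoc)

text \<open>The image of O(-m) under multiplication by the vector of the \<open>G i\<close>, for
  \<open>i < n\<close>; the map is injective once one of these forms is nonzero.\<close>

definition line_sheaf :: "nat \<Rightarrow> nat \<Rightarrow> (nat \<Rightarrow> 'a::field poly poly) \<Rightarrow> 'a sheaf" where
  "line_sheaf m n G U = {form_vector n G c | c. c \<in> twist (- int m) U}"

context
  fixes f G :: "nat \<Rightarrow> 'a::alg_closed_field poly poly" and d e n i0 :: nat
  assumes G: "\<And>i. i < n \<Longrightarrow> homogeneous e (G i)" and i0: "i0 < n" "G i0 \<noteq> 0"
begin

lemma Fract_form_nonzero: "Fract (G i0) 1 \<noteq> 0"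
  using i0 by (simp add: Zero_fract_def eq_fract)

lemma form_vector_eq_iff: "form_vector n G c = form_vector n G c' \<longleftrightarrow> c = c'"
proof
  assume "form_vector n G c = form_vector n G c'"
  then have "c * Fract (G i0) 1 = c' * Fract (G i0) 1" using i0 by (metis form_vector_def)
  then show "c = c'" using Fract_form_nonzero by simp
qed simp

lemma generic_stalk_line_sheaf: "generic_stalk (line_sheaf m n G) = {form_vector n G c | c. c \<in> graded (- int m)}"
proof (rule equalityI; rule subsetI)
  fix s assume "s \<in> generic_stalk (line_sheaf m n G)"
  then obtain U c where U: "zariski_open U" "U \<noteq> {}" "c \<in> twist (- int m) U" "s = form_vector n G c"
    unfolding generic_stalk_def line_sheaf_def by blast
  then obtain p where p: "p \<in> U" "p \<in> P1" using open_subset_P1 by blast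
  then have "c \<in> graded (- int m)" using U(3) twist_stalk_graded unfolding twist_def by blast
  then show "s \<in> {form_vector n G c | c. c \<in> graded (- int m)}" using U by blast
next
  fix s assume "s \<in> {form_vector n G c | c. c \<in> graded (- int m)}"
  then obtain c where "s = form_vector n G c" "c \<in> graded (- int m)" by blast
  then show "s \<in> generic_stalk (line_sheaf m n G)"
    by (elim graded_open) (auto simp: generic_stalk_def line_sheaf_def)
qed

lemma stalk_line_sheaf:
  assumes "p \<in> P1"
  shows "stalk (line_sheaf m n G) p = {form_vector n G c | c. c \<in> twist_stalk (- int m) p}"
proof (rule equalityI; rule subsetI)
  fix s assume "s \<in> stalk (line_sheaf m n G) p"
  then show "s \<in> {form_vector n G c | c. c \<in> twist_stalk (- int m) p}"
    unfolding stalk_def line_sheaf_def twist_def by blast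
next
  fix s assume "s \<in> {form_vector n G c | c. c \<in> twist_stalk (- int m) p}"
  then obtain c where "s = form_vector n G c" "c \<in> twist_stalk (- int m) p" by blast
  then show "s \<in> stalk (line_sheaf m n G) p"
    using assms by (elim twist_stalk_open) (auto simp: stalk_def line_sheaf_def)
qed

lemma form_vector_basis:
  assumes "denominators P" and l: "P l" "homogeneous 1 l"
  shows "module_basis (fracs 0 P) {form_vector n G c | c. c \<in> fracs (- int m) P} 1 (\<lambda>_. form_vector n G (Fract 1 (l ^ m)))"
proof -
  interpret denominators P by fact
  show ?thesis
    unfolding module_basis_def
  proof (intro conjI allI ballI impI)
    have lm: "P (l ^ m)" "homogeneous m (l ^ m)"
      using homogeneous_power[OF l(2), of m] l(1) by (auto intro: power)
    have t: "Fract 1 (l ^ m) \<in> fracs (- int m) P" using fracs_inverse_form[OF lm(2,1)] .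
    have t0: "Fract 1 (l ^ m) \<noteq> 0" using nonzero[OF lm(1)] by (simp add: Zero_fract_def eq_fract)
    show "form_vector n G (Fract 1 (l ^ m)) \<in> {form_vector n G c | c. c \<in> fracs (- int m) P}" using t by blast
    {
      fix s assume "s \<in> {form_vector n G c | c. c \<in> fracs (- int m) P}"
      then obtain c where c: "c \<in> fracs (- int m) P" "s = form_vector n G c" by blast
      have "c * Fract (l ^ m) 1 \<in> fracs 0 P"
        by (rule fracs_mult_eq[OF c(1) fracs_form[OF lm(2)]]) simp
      moreover have cc: "c * Fract (l ^ m) 1 * Fract 1 (l ^ m) = c"
      proof -
        have "Fract (l ^ m) 1 * Fract 1 (l ^ m) = 1" using nonzero[OF lm(1)] by (simp add: One_fract_def eq_fract)
        then show ?thesis by (simp only: mult.assoc mult_1_right)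
      qed
      moreover have "s = (\<lambda>j. c * Fract (l ^ m) 1 * form_vector n G (Fract 1 (l ^ m)) j)"
        unfolding form_vector_scale c(2) cc ..
      ultimately show "\<exists>c. (\<forall>i<1. c i \<in> fracs 0 P) \<and> s = (\<lambda>j. \<Sum>i<(1::nat). c i * form_vector n G (Fract 1 (l ^ m)) j)"
        by (intro exI[of _ "\<lambda>_. c * Fract (l ^ m) 1"]) simp
    }
    fix c and i :: nat assume c: "(\<forall>i<1. c i \<in> fracs 0 P) \<and> (\<lambda>j. \<Sum>i<(1::nat). c i * form_vector n G (Fract 1 (l ^ m)) j) = (\<lambda>_. 0)" "i < 1"
    have "form_vector n G (c 0 * Fract 1 (l ^ m)) = form_vector n G 0"
      using c(1) by (simp add: form_vector_zero flip: form_vector_scale)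
    then have "c 0 * Fract 1 (l ^ m) = 0" unfolding form_vector_eq_iff .
    then show "c i = 0" using t0 c(2) by simp
  qed
qed

text \<open>The minor is the single coordinate \<open>i0\<close>. It is a functional of degree
  \<open>e - m\<close>, and on local generators it has the orders of \<open>G i0\<close>, with total
  \<open>e\<close>. The two occurrences of \<open>e\<close> cancel, whatever the common zeros of the
  forms.\<close>

lemma line_sheaf_rank_degree:
  shows "sheaf_rank (line_sheaf m n G) = 1" "sheaf_degree (line_sheaf m n G) = - int m"
proof -
  define v0 where "v0 = (\<lambda>_ :: nat. form_vector n G (Fract 1 (X0 ^ m)))"
  have v0: "module_basis function_field (generic_stalk (line_sheaf m n G)) 1 v0"
    unfolding generic_stalk_line_sheaf function_field_graded v0_def
    by (rule form_vector_basis[OF gr.denominators_axioms]) (use homogeneous_X0 in simp_all)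
  then show "sheaf_rank (line_sheaf m n G) = 1" by (rule sheaf_rank_eq)
  let ?L = "\<lambda>(j :: nat) s :: nat \<Rightarrow> 'a poly poly fract. s i0"
  have det: "functional_det ?L 1 w = w 0 i0" for w
    unfolding functional_det_def by (subst det_single) auto
  have "\<exists>w. module_basis (local_ring p) (stalk (line_sheaf m n G) p) 1 w \<and>
      order_at p (functional_det ?L 1 w) = order_at p (Fract (G i0) 1)" if p: "p \<in> P1" for p
  proof -
    interpret denominators "\<lambda>h. nonvanishing h p" using p by (rule denominators_nonvanishing)
    obtain l where l: "nonvanishing l p" "homogeneous 1 l" using nonvanishing_X0_X1[OF p] by metis
    have lm: "nonvanishing (l ^ m) p" "homogeneous m (l ^ m)" "l ^ m \<noteq> 0"
      using l homogeneous_power[OF l(2), of m] nonzero[OF l(1)] by auto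
    let ?w = "\<lambda>_ :: nat. form_vector n G (Fract 1 (l ^ m))"
    have "module_basis (local_ring p) (stalk (line_sheaf m n G) p) 1 ?w"
      unfolding stalk_line_sheaf[OF p] twist_stalk_fracs using denominators_nonvanishing[OF p] l by (rule form_vector_basis)
    moreover have "order_at p (functional_det ?L 1 ?w) = order_at p (Fract (G i0) 1)"
    proof -
      have "Fract 1 (l ^ m) \<noteq> 0" using lm(3) by (simp add: Zero_fract_def eq_fract)
      then have "order_at p (Fract 1 (l ^ m) * Fract (G i0) 1) = order_at p (Fract 1 (l ^ m)) + order_at p (Fract (G i0) 1)"
        using Fract_form_nonzero by (rule order_at_mult[OF p])
      moreover have "order_at p (Fract 1 (l ^ m)) = 0"
        using order_at_Fract_nonvanishing[OF p lm(3), of 1 0] order_at_form_0I[OF p lm(1,2)] by simp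
      ultimately show ?thesis unfolding det form_vector_def using i0(1) by (simp del: mult_fract)
    qed
    ultimately show ?thesis by blast
  qed
  then obtain W where W: "\<And>p. p \<in> P1 \<Longrightarrow> module_basis (local_ring p) (stalk (line_sheaf m n G) p) 1 (W p)"
    "\<And>p. p \<in> P1 \<Longrightarrow> order_at p (functional_det ?L 1 (W p)) = order_at p (Fract (G i0) 1)"
    by metis
  have "has_total (\<lambda>p. order_at p (Fract (G i0) 1)) (int e)"
    using has_total_order_form[OF G[OF i0(1)] i0(2)] .
  then have total: "has_total (\<lambda>p. order_at p (functional_det ?L 1 (W p))) (int e)"
    using has_total_cong[of "\<lambda>p. order_at p (functional_det ?L 1 (W p))" "\<lambda>p. order_at p (Fract (G i0) 1)"] W(2) by blast
  have "sheaf_degree (line_sheaf m n G) = int 1 * (- int m + int e) - int e"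
  proof (rule sheaf_degree_eq[where L = ?L, OF W(1) v0 _ _ _ total])
    show "?L j s \<in> graded (- int m + int e)" if "s \<in> generic_stalk (line_sheaf m n G)" "j < 1" for j s
      using that i0(1) gr.fracs_mult[OF _ gr.fracs_form[OF G[OF i0(1)]], of _ "- int m"]
      unfolding generic_stalk_line_sheaf form_vector_def by auto
    have "Fract 1 (X0 ^ m) \<noteq> (0 :: 'a poly poly fract)" by (simp add: Zero_fract_def eq_fract)
    then show "functional_det ?L 1 v0 \<noteq> 0"
      unfolding det v0_def form_vector_def using Fract_form_nonzero i0(1) by (simp del: mult_fract)
  qed (simp_all add: comb_linear_proj)
  then show "sheaf_degree (line_sheaf m n G) = - int m" by simp
qed

context
  assumes syz: "(\<Sum>i<n. f i * G i) = 0"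
begin

text \<open>The twist \<open>d + e\<close> makes the products with forms of degree \<open>e\<close>
  sections of O(-d), and \<open>syz\<close> makes them syzygies. Where a linear form
  \<open>l\<close> does not vanish, a single section generates, so the sheaf is of finite
  type.\<close>

lemma line_sheaf_coherent: "coherent_subsheaf (line_sheaf (d + e) n G) (Syz d n f)"
  unfolding coherent_subsheaf_def subsheaf_def
proof (intro conjI allI impI)
  fix U :: "'a point set" assume U: "zariski_open U \<and> U \<noteq> {}"
  then have UP: "U \<subseteq> P1" using open_subset_P1 by blast
  have den: "denominators (\<lambda>h. nonvanishing h p)" if "p \<in> U" for p using that UP denominators_nonvanishing by blast
  show "line_sheaf (d + e) n G U \<subseteq> Syz d n f U"
  proof
    fix s assume "s \<in> line_sheaf (d + e) n G U"
    then obtain c where c: "c \<in> twist (- int (d + e)) U" "s = form_vector n G c" unfolding line_sheaf_def by blast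
    have "c * Fract (G i) 1 \<in> twist (- int d) U" if "i < n" for i
      unfolding twist_def
    proof (rule CollectI, rule ballI)
      fix p assume p: "p \<in> U"
      interpret denominators "\<lambda>h. nonvanishing h p" using den[OF p] .
      have "c \<in> fracs (- int (d + e)) (\<lambda>h. nonvanishing h p)" using c(1) p by (simp add: twist_def twist_stalk_fracs)
      then show "c * Fract (G i) 1 \<in> twist_stalk (- int d) p"
        unfolding twist_stalk_fracs by (rule fracs_mult_eq[OF _ fracs_form[OF G[OF that]]]) simp
    qed
    moreover have "(\<Sum>i<n. Fract (f i) 1 * form_vector n G c i) = 0"
    proof -
      have "(\<Sum>i<n. Fract (f i) 1 * form_vector n G c i) = (\<Sum>i<n. c * Fract (f i * G i) 1)"
      proof (rule sum.cong[OF refl])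
        fix i assume "i \<in> {..<n}"
        moreover have "Fract (f i * G i) 1 = Fract (f i) 1 * Fract (G i) 1" by simp
        ultimately show "Fract (f i) 1 * form_vector n G c i = c * Fract (f i * G i) 1"
          by (simp del: mult_fract add: mult_ac form_vector_def)
      qed
      also have "\<dots> = c * Fract (\<Sum>i<n. f i * G i) 1"
      proof -
        have "(\<Sum>i\<in>I. Fract (f i * G i) 1) = Fract (\<Sum>i\<in>I. f i * G i) 1" if "finite I" for I
          using that by (induction I rule: finite_induct) (auto simp: Zero_fract_def)
        then show ?thesis by (simp add: sum_distrib_left[symmetric])
      qed
      also have "\<dots> = 0" by (simp add: syz Zero_fract_def)
      finally show ?thesis .
    qed
    ultimately show "s \<in> Syz d n f U" unfolding Syz_def c(2) by (auto simp: form_vector_def)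
  qed
  have z: "(0 :: 'a poly poly fract) \<in> twist (- int (d + e)) U"
    unfolding twist_def twist_stalk_fracs using denominators.fracs_0[OF den] by blast
  then show "(\<lambda>_. 0) \<in> line_sheaf (d + e) n G U"
    unfolding line_sheaf_def form_vector_zero[of n G, symmetric] by blast
  show "\<forall>s\<in>line_sheaf (d + e) n G U. \<forall>t\<in>line_sheaf (d + e) n G U. (\<lambda>i. s i + t i) \<in> line_sheaf (d + e) n G U"
  proof (intro ballI)
    fix s t assume "s \<in> line_sheaf (d + e) n G U" "t \<in> line_sheaf (d + e) n G U"
    then obtain b c where bc: "b \<in> twist (- int (d + e)) U" "s = form_vector n G b" "c \<in> twist (- int (d + e)) U" "t = form_vector n G c"
      unfolding line_sheaf_def by blast
    then have "b + c \<in> twist (- int (d + e)) U"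
      unfolding twist_def twist_stalk_fracs using denominators.fracs_add[OF den] by blast
    moreover have "(\<lambda>i. s i + t i) = form_vector n G (b + c)" by (simp add: bc form_vector_add)
    ultimately show "(\<lambda>i. s i + t i) \<in> line_sheaf (d + e) n G U" unfolding line_sheaf_def by blast
  qed
  show "\<forall>c\<in>twist 0 U. \<forall>s\<in>line_sheaf (d + e) n G U. (\<lambda>i. c * s i) \<in> line_sheaf (d + e) n G U"
  proof (intro ballI)
    fix s c assume c: "c \<in> twist 0 U" and "s \<in> line_sheaf (d + e) n G U"
    then obtain b where b: "b \<in> twist (- int (d + e)) U" "s = form_vector n G b" unfolding line_sheaf_def by blast
    have "c * b \<in> twist (- int (d + e)) U"
      using b(1) c denominators.fracs_mult_eq[OF den, of _ c 0 b "- int (d + e)" "- int (d + e)"]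
      unfolding twist_def twist_stalk_fracs by auto
    moreover have "(\<lambda>i. c * s i) = form_vector n G (c * b)" by (simp add: b form_vector_scale)
    ultimately show "(\<lambda>i. c * s i) \<in> line_sheaf (d + e) n G U" unfolding line_sheaf_def by blast
  qed
  show "line_sheaf (d + e) n G U \<subseteq> line_sheaf (d + e) n G V" if "zariski_open V \<and> V \<noteq> {} \<and> V \<subseteq> U" for V
    unfolding line_sheaf_def using twist_mono[of V U] that by blast
  show "s \<in> line_sheaf (d + e) n G U"
    if glue: "\<forall>p\<in>U. \<exists>V. zariski_open V \<and> p \<in> V \<and> V \<subseteq> U \<and> s \<in> line_sheaf (d + e) n G V" for s
  proof -
    \<comment> \<open>The vector \<open>s\<close> determines its coefficient, because coordinate
      \<open>i0\<close> of the form vector is nonzero; hence the coefficients found on different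
      open sets coincide.\<close>
    have loc: "\<exists>c. c \<in> twist_stalk (- int (d + e)) p \<and> s = form_vector n G c" if "p \<in> U" for p
      using glue that unfolding line_sheaf_def twist_def by blast
    obtain p where "p \<in> U" using U by blast
    then obtain c where c: "s = form_vector n G c" using loc by blast
    have "c \<in> twist_stalk (- int (d + e)) q" if "q \<in> U" for q
      using loc[OF that] c by (metis form_vector_eq_iff)
    then show ?thesis using c unfolding line_sheaf_def twist_def by blast
  qed
next
  show "finite_type (line_sheaf (d + e) n G)"
    unfolding finite_type_def
  proof
    fix p :: "'a point" assume p: "p \<in> P1"
    obtain l where l: "nonvanishing l p" "homogeneous 1 l" using nonvanishing_X0_X1[OF p] by metis
    define V where "V = {q \<in> P1. nonvanishing l q}"
    let ?g = "form_vector n G (Fract 1 (l ^ (d + e)))"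
    have V: "zariski_open V" "p \<in> V" using open_basic[OF l(2)] p l(1) by (auto simp: V_def)
    have basis: "module_basis (local_ring q) (stalk (line_sheaf (d + e) n G) q) 1 (\<lambda>_. ?g)" if q: "q \<in> V" for q
    proof -
      have "q \<in> P1" "nonvanishing l q" using q by (auto simp: V_def)
      then show ?thesis
        using form_vector_basis[OF denominators_nonvanishing _ l(2), of q "d + e"]
        unfolding stalk_line_sheaf[OF \<open>q \<in> P1\<close>] twist_stalk_fracs by blast
    qed
    have "Fract 1 (l ^ (d + e)) \<in> twist (- int (d + e)) V"
      unfolding twist_def
    proof (rule CollectI, rule ballI)
      fix q assume "q \<in> V"
      then have q: "q \<in> P1" "nonvanishing l q" by (auto simp: V_def)
      interpret denominators "\<lambda>h. nonvanishing h q" using q(1) by (rule denominators_nonvanishing)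
      show "Fract 1 (l ^ (d + e)) \<in> twist_stalk (- int (d + e)) q"
        unfolding twist_stalk_fracs
        using fracs_inverse_form[of "d + e" "l ^ (d + e)"] homogeneous_power[OF l(2), of "d + e"] q(2) by simp
    qed
    then have g: "?g \<in> line_sheaf (d + e) n G V" unfolding line_sheaf_def by blast
    have "\<exists>c. (\<forall>g\<in>{?g}. c g \<in> local_ring q) \<and> s = (\<lambda>i. \<Sum>g\<in>{?g}. c g * g i)"
      if q: "q \<in> V" and s: "s \<in> stalk (line_sheaf (d + e) n G) q" for q s
    proof -
      obtain c :: "nat \<Rightarrow> 'a poly poly fract" where c: "\<forall>i<1. c i \<in> local_ring q" "s = (\<lambda>j. \<Sum>i<(1::nat). c i * ?g j)"
        using basis[OF q] s unfolding module_basis_def by blast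
      then show ?thesis by (intro exI[of _ "\<lambda>_. c 0"]) simp
    qed
    then show "\<exists>V H. zariski_open V \<and> p \<in> V \<and> finite H \<and> H \<subseteq> line_sheaf (d + e) n G V \<and>
        (\<forall>q\<in>V. \<forall>s\<in>stalk (line_sheaf (d + e) n G) q.
          \<exists>c. (\<forall>g\<in>H. c g \<in> local_ring q) \<and> s = (\<lambda>i. \<Sum>g\<in>H. c g * g i))"
      using V g by (intro exI[of _ V] exI[of _ "{?g}"] conjI ballI) auto
  qed
qed

end

end


section \<open>Coherent subsheaves of syzygy bundles\<close>

context
  fixes F E :: "'a::alg_closed_field sheaf"
  assumes coherent: "coherent_subsheaf F E"
begin

lemma section_subset: "zariski_open U \<Longrightarrow> U \<noteq> {} \<Longrightarrow> F U \<subseteq> E U"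
  using coherent[unfolded coherent_subsheaf_def subsheaf_def, THEN conjunct1, THEN spec, of U] by (elim impE) auto

lemma stalkE:
  assumes "s \<in> stalk F p"
  obtains U where "zariski_open U" "p \<in> U" "s \<in> F U"
  using assms unfolding stalk_def by blast

lemma stalkI: "zariski_open U \<Longrightarrow> p \<in> U \<Longrightarrow> s \<in> F U \<Longrightarrow> s \<in> stalk F p"
  unfolding stalk_def by blast

lemma local_generators:
  assumes "p \<in> P1"
  obtains V G where "zariski_open V" "p \<in> V" "finite G" "G \<subseteq> F V"
    "\<forall>q\<in>V. \<forall>s\<in>stalk F q. \<exists>c. (\<forall>g\<in>G. c g \<in> local_ring q) \<and> s = (\<lambda>i. \<Sum>g\<in>G. c g * g i)"
  using bspec[OF coherent[unfolded coherent_subsheaf_def finite_type_def, THEN conjunct2] assms] by (elim exE conjE) (rule that)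

text \<open>A generating set of minimal cardinality is a basis: the local ring being a valuation ring, a
  linear relation can be solved for a generator whose coefficient has minimal order.\<close>

lemma stalk_basis_exists:
  assumes p: "p \<in> P1"
  shows "\<exists>r w. module_basis (local_ring p) (stalk F p) r w"
proof -
  interpret R: denominators "\<lambda>h. nonvanishing h p" using p by (rule denominators_nonvanishing)
  define generating where "generating G \<longleftrightarrow> finite G \<and> G \<subseteq> stalk F p \<and>
      (\<forall>s\<in>stalk F p. \<exists>c. (\<forall>g\<in>G. c g \<in> local_ring p) \<and> s = (\<lambda>i. \<Sum>g\<in>G. c g * g i))" for G
  obtain V G where V: "zariski_open V" "p \<in> V" "finite G" "G \<subseteq> F V"
    "\<forall>q\<in>V. \<forall>s\<in>stalk F q. \<exists>c. (\<forall>g\<in>G. c g \<in> local_ring q) \<and> s = (\<lambda>i. \<Sum>g\<in>G. c g * g i)"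
    using p by (rule local_generators)
  then have "generating G" unfolding generating_def using stalkI[OF V(1,2)] by blast
  then obtain H where H: "generating H" and min: "\<And>G. generating G \<Longrightarrow> card H \<le> card G"
    using ex_has_least_nat[of generating G card] by blast
  have finH: "finite H" and HF: "H \<subseteq> stalk F p"
    and span: "\<And>s. s \<in> stalk F p \<Longrightarrow> \<exists>c. (\<forall>g\<in>H. c g \<in> local_ring p) \<and> s = (\<lambda>i. \<Sum>g\<in>H. c g * g i)"
    using H unfolding generating_def by blast+
  have indep: "\<forall>g\<in>H. c g = 0"
    if c: "\<forall>g\<in>H. c g \<in> local_ring p" and zero: "(\<lambda>i. \<Sum>g\<in>H. c g * g i) = (\<lambda>_. 0)" for c
  proof (rule ccontr)
    assume "\<not> (\<forall>g\<in>H. c g = 0)"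
    then have ne: "\<exists>g\<in>H. c g \<noteq> 0" by blast
    have c_field: "c g \<in> function_field" if "g \<in> H" for g
      using c that twist_stalk_graded[OF p] unfolding function_field_graded by blast
    obtain k where k: "k \<in> H" "c k \<noteq> 0" "\<And>g. g \<in> H \<Longrightarrow> c g / c k \<in> local_ring p"
      using quotients_in_local_ring[OF p finH c_field ne] by blast
    have kk: "k i = - (\<Sum>g\<in>H - {k}. c g / c k * g i)" for i
    proof -
      have "c k * k i + (\<Sum>g\<in>H - {k}. c g * g i) = 0"
        using fun_cong[OF zero, of i] sum.remove[OF finH k(1), of "\<lambda>g. c g * g i"] by simp
      then have "k i = - ((\<Sum>g\<in>H - {k}. c g * g i) / c k)"
        using k(2) by (simp add: field_simps eq_neg_iff_add_eq_0)
      then show ?thesis by (simp add: sum_divide_distrib)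
    qed
    have "generating (H - {k})" unfolding generating_def
    proof (intro conjI ballI)
      fix s assume "s \<in> stalk F p"
      then obtain a where a: "\<forall>g\<in>H. a g \<in> local_ring p" "s = (\<lambda>i. \<Sum>g\<in>H. a g * g i)" using span by blast
      have "s i = (\<Sum>g\<in>H - {k}. (a g - a k * (c g / c k)) * g i)" for i
      proof -
        have "s i = a k * k i + (\<Sum>g\<in>H - {k}. a g * g i)"
          unfolding a(2) by (rule sum.remove[OF finH k(1)])
        also have "a k * k i = - (\<Sum>g\<in>H - {k}. a k * (c g / c k) * g i)"
          by (subst kk) (simp add: sum_distrib_left mult.assoc)
        finally show ?thesis by (simp add: sum_subtractf left_diff_distrib)
      qed
      then have "s = (\<lambda>i. \<Sum>g\<in>H - {k}. (a g - a k * (c g / c k)) * g i)" by blast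
      moreover have "a g - a k * (c g / c k) \<in> local_ring p" if "g \<in> H" for g
      proof -
        have "a g \<in> local_ring p" "a k \<in> local_ring p" "c g / c k \<in> local_ring p"
          using a(1) k that by blast+
        then show ?thesis unfolding twist_stalk_fracs
          using R.fracs_diff R.fracs_mult_eq[of "a k" 0 "c g / c k" 0 0] by simp
      qed
      ultimately show "\<exists>b. (\<forall>g\<in>H - {k}. b g \<in> local_ring p) \<and> s = (\<lambda>i. \<Sum>g\<in>H - {k}. b g * g i)"
        by (intro exI[of _ "\<lambda>g. a g - a k * (c g / c k)"]) blast
    qed (use finH HF in auto)
    then have "card H \<le> card (H - {k})" by (rule min)
    then show False using k(1) finH by (metis card_Diff1_less not_less)
  qed
  obtain b where b: "bij_betw b {..<card H} H"
    using ex_bij_betw_nat_finite[OF finH] by (auto simp: atLeast0LessThan)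
  have reindex: "(\<Sum>i<card H. c (b i) * b i j) = (\<Sum>g\<in>H. c g * g j)" for c :: "_ \<Rightarrow> 'a poly poly fract" and j
    using sum.reindex_bij_betw[OF b, of "\<lambda>g. c g * g j"] .
  have "module_basis (local_ring p) (stalk F p) (card H) b"
    unfolding module_basis_def
  proof (intro conjI allI ballI impI)
    show "b i \<in> stalk F p" if "i < card H" for i using bij_betwE[OF b] that HF by blast
    show "\<exists>c. (\<forall>i<card H. c i \<in> local_ring p) \<and> s = (\<lambda>j. \<Sum>i<card H. c i * b i j)" if s: "s \<in> stalk F p" for s
    proof -
      obtain c where c: "\<forall>g\<in>H. c g \<in> local_ring p" "s = (\<lambda>i. \<Sum>g\<in>H. c g * g i)" using span[OF s] by blast
      have "s = (\<lambda>j. \<Sum>i<card H. c (b i) * b i j)" unfolding c(2) reindex ..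
      moreover have "\<forall>i<card H. c (b i) \<in> local_ring p" using c(1) bij_betwE[OF b] by blast
      ultimately show ?thesis by (intro exI[of _ "\<lambda>i. c (b i)"]) blast
    qed
    fix c i assume c: "(\<forall>i<card H. c i \<in> local_ring p) \<and> (\<lambda>j. \<Sum>i<card H. c i * b i j) = (\<lambda>_. 0)"
      and i: "i < card H"
    define a where "a = the_inv_into {..<card H} b"
    have a: "a (b i) = i" if "i < card H" for i
      unfolding a_def using the_inv_into_f_f[OF bij_betw_imp_inj_on[OF b]] that by simp
    have "(\<Sum>g\<in>H. c (a g) * g j) = (\<Sum>i<card H. c i * b i j)" for j
      unfolding reindex[of "\<lambda>g. c (a g)", symmetric] by (rule sum.cong) (simp_all add: a)
    then have "(\<lambda>j. \<Sum>g\<in>H. c (a g) * g j) = (\<lambda>_. 0)" using c by simp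
    moreover have "c (a g) \<in> local_ring p" if "g \<in> H" for g
    proof -
      have "g \<in> b ` {..<card H}" using that bij_betw_imp_surj_on[OF b] by simp
      then obtain i where "i < card H" "g = b i" by auto
      then show ?thesis using a c by simp
    qed
    ultimately have "\<forall>g\<in>H. c (a g) = 0" using indep[of "\<lambda>g. c (a g)"] by blast
    then show "c i = 0" using a[OF i] bij_betwE[OF b] i by force
  qed
  then show ?thesis by blast
qed

text \<open>A section over any nonempty \<open>U\<close> is compared with the basis at
  \<open>p\<close> through a point \<open>q\<close> of \<open>U\<close> that lies in the
  neighbourhood \<open>V\<close> carrying the generators; it exists by irreducibility. At
  \<open>q\<close> the section is a combination of the generators, and at \<open>p\<close> these are
  combinations of \<open>w\<close>.\<close>

lemma stalk_basis_generic:
  assumes p: "p \<in> P1" and w: "module_basis (local_ring p) (stalk F p) r w"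
  shows "module_basis function_field (generic_stalk F) r w"
  unfolding module_basis_altdef
proof (intro conjI ballI)
  have mem: "\<And>i. i < r \<Longrightarrow> w i \<in> stalk F p" using module_basis_memD[OF w] .
  show "\<forall>i<r. w i \<in> generic_stalk F" using mem stalk_subset_generic[OF p] by blast
  show "independent_over function_field r w"
    using local_independent_function_field[OF p] w by (simp add: module_basis_altdef)
  fix s assume "s \<in> generic_stalk F"
  then obtain U where U: "zariski_open U" "U \<noteq> {}" "s \<in> F U" unfolding generic_stalk_def by blast
  obtain V G where V: "zariski_open V" "p \<in> V" "finite G" "G \<subseteq> F V"
    "\<forall>q\<in>V. \<forall>s\<in>stalk F q. \<exists>c. (\<forall>g\<in>G. c g \<in> local_ring q) \<and> s = (\<lambda>i. \<Sum>g\<in>G. c g * g i)"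
    using p by (rule local_generators)
  have "U \<inter> V \<noteq> {}" by (rule open_Int_nonempty) (use U V in auto)
  then obtain q where q: "q \<in> U" "q \<in> V" by blast
  then have qP: "q \<in> P1" using open_subset_P1[OF U(1)] by blast
  obtain c where c: "\<forall>g\<in>G. c g \<in> local_ring q" "s = (\<lambda>i. \<Sum>g\<in>G. c g * g i)"
    using V(5) q stalkI[OF U(1) q(1) U(3)] by blast
  have "\<exists>a. (\<forall>i<r. a i \<in> function_field) \<and> g = (\<lambda>j. \<Sum>i<r. a i * w i j)" if "g \<in> G" for g
  proof -
    have "g \<in> stalk F p" using stalkI[OF V(1,2)] V(4) that by blast
    then obtain a where "\<forall>i<r. a i \<in> local_ring p" "g = (\<lambda>j. \<Sum>i<r. a i * w i j)"
      using w unfolding module_basis_def by blast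
    then show ?thesis using twist_stalk_graded[OF p] unfolding function_field_graded by blast
  qed
  then obtain a where a: "\<And>g i. g \<in> G \<Longrightarrow> i < r \<Longrightarrow> a g i \<in> function_field" "\<And>g. g \<in> G \<Longrightarrow> g = (\<lambda>j. \<Sum>i<r. a g i * w i j)"
    by metis
  have "s j = (\<Sum>i<r. (\<Sum>g\<in>G. c g * a g i) * w i j)" for j
  proof -
    have "s j = (\<Sum>g\<in>G. c g * (\<Sum>i<r. a g i * w i j))"
      unfolding c(2) by (rule sum.cong[OF refl]) (use a(2) in metis)
    also have "\<dots> = (\<Sum>i<r. (\<Sum>g\<in>G. c g * a g i) * w i j)"
      unfolding sum_distrib_left sum_distrib_right by (subst sum.swap) (simp add: mult.assoc)
    finally show ?thesis .
  qed
  then have "s = (\<lambda>j. \<Sum>i<r. (\<Sum>g\<in>G. c g * a g i) * w i j)" by blast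
  moreover have "(\<Sum>g\<in>G. c g * a g i) \<in> function_field" if "i < r" for i
  proof (rule function_field_sum)
    fix g assume g: "g \<in> G"
    have "c g \<in> function_field"
      using c(1) g twist_stalk_graded[OF qP] unfolding function_field_graded by blast
    then show "c g * a g i \<in> function_field" using a(1)[OF g that] by (rule function_field_closed(5))
  qed
  ultimately show "\<exists>c. (\<forall>i<r. c i \<in> function_field) \<and> s = (\<lambda>j. \<Sum>i<r. c i * w i j)"
    by (intro exI[of _ "\<lambda>i. \<Sum>g\<in>G. c g * a g i"]) blast
qed

text \<open>Local bases are bases of the generic stalk, so they all have the same size
  \<open>r\<close>. A basis at one point is still a basis at all but finitely many others, which
  later makes the sum of local orders finite.\<close>

lemma coherent_bases:
  obtains r v W S where "module_basis function_field (generic_stalk F) r v"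
    and "\<And>p. p \<in> P1 \<Longrightarrow> module_basis (local_ring p) (stalk F p) r (W p)"
    and "finite S" and "\<And>p. p \<in> P1 \<Longrightarrow> p \<notin> S \<Longrightarrow> module_basis (local_ring p) (stalk F p) r v"
proof -
  have "pt 1 0 \<in> (P1 :: 'a point set)" by (rule pt_in_P1) simp
  then obtain p where p: "p \<in> (P1 :: 'a point set)" by blast
  obtain r v where v: "module_basis (local_ring p) (stalk F p) r v" using stalk_basis_exists[OF p] by blast
  have vg: "module_basis function_field (generic_stalk F) r v" using stalk_basis_generic[OF p v] .
  have "\<exists>w. module_basis (local_ring q) (stalk F q) r w" if q: "q \<in> P1" for q
  proof -
    obtain k w where w: "module_basis (local_ring q) (stalk F q) k w" using stalk_basis_exists[OF q] by blast
    then have "k = r" using basis_size_unique[OF stalk_basis_generic[OF q w] vg] by blast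
    then show ?thesis using w by blast
  qed
  then obtain W where W: "\<And>q. q \<in> P1 \<Longrightarrow> module_basis (local_ring q) (stalk F q) r (W q)" by metis
  obtain V G where V: "zariski_open V" "p \<in> V" "finite G" "G \<subseteq> F V"
    "\<forall>q\<in>V. \<forall>s\<in>stalk F q. \<exists>c. (\<forall>g\<in>G. c g \<in> local_ring q) \<and> s = (\<lambda>i. \<Sum>g\<in>G. c g * g i)"
    using p by (rule local_generators)
  have "\<exists>U. zariski_open U \<and> p \<in> U \<and> v i \<in> F U" if "i < r" for i
    using module_basis_memD[OF v that] stalkE by metis
  then obtain U where U: "\<And>i. i < r \<Longrightarrow> zariski_open (U i) \<and> p \<in> U i \<and> v i \<in> F (U i)" by metis
  have "\<exists>a. (\<forall>i<r. a i \<in> local_ring p) \<and> g = (\<lambda>j. \<Sum>i<r. a i * v i j)" if "g \<in> G" for g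
  proof -
    have "g \<in> stalk F p" using stalkI[OF V(1,2)] V(4) that by blast
    then show ?thesis using v unfolding module_basis_def by blast
  qed
  then obtain a where a: "\<And>g i. g \<in> G \<Longrightarrow> i < r \<Longrightarrow> a g i \<in> local_ring p" "\<And>g. g \<in> G \<Longrightarrow> g = (\<lambda>j. \<Sum>i<r. a g i * v i j)"
    by metis
  have "\<exists>O'. zariski_open O' \<and> p \<in> O' \<and> a g i \<in> twist 0 O'" if "g \<in> G" "i < r" for g i
    using twist_stalk_open[OF a(1)[OF that] p] by metis
  then obtain O' where O': "\<And>g i. g \<in> G \<Longrightarrow> i < r \<Longrightarrow> zariski_open (O' g i) \<and> p \<in> O' g i \<and> a g i \<in> twist 0 (O' g i)"
    by metis
  \<comment> \<open>Outside \<open>S\<close> the basis vectors \<open>v i\<close>, the generators in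
    \<open>G\<close> and the coefficients \<open>a g i\<close> expressing these through
    \<open>v\<close> are all regular.\<close>
  define S where "S = (P1 - V) \<union> (\<Union>i\<in>{..<r}. P1 - U i) \<union> (\<Union>g\<in>G. \<Union>i\<in>{..<r}. P1 - O' g i)"
  have "finite (P1 - V)" using finite_compl_open[OF V(1)] V(2) by blast
  moreover have "finite (P1 - U i)" if "i < r" for i
    using finite_compl_open[of "U i"] U[OF that] by blast
  moreover have "finite (P1 - O' g i)" if "g \<in> G" "i < r" for g i
    using finite_compl_open[of "O' g i"] O'[OF that] by blast
  ultimately have S: "finite S" unfolding S_def using V(3) by (intro finite_UnI finite_UN_I finite_lessThan) auto
  have "module_basis (local_ring q) (stalk F q) r v" if q: "q \<in> P1" "q \<notin> S" for q
    unfolding module_basis_altdef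
  proof (intro conjI ballI)
    interpret R: denominators "\<lambda>h. nonvanishing h q" using q(1) by (rule denominators_nonvanishing)
    have qV: "q \<in> V" and qU: "\<And>i. i < r \<Longrightarrow> q \<in> U i" and qO: "\<And>g i. g \<in> G \<Longrightarrow> i < r \<Longrightarrow> q \<in> O' g i"
      using q unfolding S_def by blast+
    show "\<forall>i<r. v i \<in> stalk F q" using stalkI U qU by blast
    have "local_ring q \<subseteq> function_field" using twist_stalk_graded[OF q(1)] unfolding function_field_graded by blast
    then show "independent_over (local_ring q) r v"
      using vg independent_over_mono unfolding module_basis_altdef by blast
    fix s assume "s \<in> stalk F q"
    then obtain c where c: "\<forall>g\<in>G. c g \<in> local_ring q" "s = (\<lambda>i. \<Sum>g\<in>G. c g * g i)"
      using V(5) qV by blast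
    have "s j = (\<Sum>i<r. (\<Sum>g\<in>G. c g * a g i) * v i j)" for j
    proof -
      have "s j = (\<Sum>g\<in>G. c g * (\<Sum>i<r. a g i * v i j))"
        unfolding c(2) by (rule sum.cong[OF refl]) (use a(2) in metis)
      also have "\<dots> = (\<Sum>i<r. (\<Sum>g\<in>G. c g * a g i) * v i j)"
        unfolding sum_distrib_left sum_distrib_right by (subst sum.swap) (simp add: mult.assoc)
      finally show ?thesis .
    qed
    then have "s = (\<lambda>j. \<Sum>i<r. (\<Sum>g\<in>G. c g * a g i) * v i j)" by blast
    moreover have "(\<Sum>g\<in>G. c g * a g i) \<in> local_ring q" if "i < r" for i
      unfolding twist_stalk_fracs
    proof (rule R.fracs_sum)
      fix g assume g: "g \<in> G"
      have "a g i \<in> local_ring q" using O'[OF g that] qO[OF g that] unfolding twist_def by blast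
      then show "c g * a g i \<in> fracs 0 (\<lambda>h. nonvanishing h q)"
        using c(1) g R.fracs_mult_eq[of "c g" 0 "a g i" 0 0] by (simp add: twist_stalk_fracs)
    qed
    ultimately show "\<exists>c. (\<forall>i<r. c i \<in> local_ring q) \<and> s = (\<lambda>j. \<Sum>i<r. c i * v i j)"
      by (intro exI[of _ "\<lambda>i. \<Sum>g\<in>G. c g * a g i"]) blast
  qed
  then show thesis using that[OF vg W S] by blast
qed

end

section \<open>The bound on the degree of coherent subsheaves\<close>

lemma functional_det_basis_nonzero:
  assumes L: "\<And>j. j < r \<Longrightarrow> comb_linear (L j)"
    and w: "module_basis R M r w" and v: "\<And>i. i < r \<Longrightarrow> v i \<in> M" and nz: "functional_det L r v \<noteq> 0"
  shows "functional_det L r w \<noteq> 0"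
proof -
  obtain A where A: "\<And>i j. i < r \<Longrightarrow> j < r \<Longrightarrow> A i j \<in> R" "\<And>i. i < r \<Longrightarrow> v i = (\<lambda>l. \<Sum>j<r. A i j * w j l)"
    using v by (rule module_basis_coords[OF w]) (assumption, rule that)
  then show ?thesis using functional_det_comb[of r L v A w, OF L A(2)] nz by auto
qed

text \<open>The functionals \<open>C j\<close> play the coordinates of an embedding into O(m)^N:
  linear, with regular values on stalks, and jointly injective on the generic stalk. Injectivity
  supplies a nonzero minor on \<open>F\<close>, regularity makes its local orders nonnegative, and
  these are what the degree loses against \<open>r m\<close>.\<close>

lemma coherent_degree_le:
  fixes f :: "nat \<Rightarrow> 'a::alg_closed_field poly poly"
    and C :: "nat \<Rightarrow> (nat \<Rightarrow> 'a poly poly fract) \<Rightarrow> 'a poly poly fract"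
  assumes F: "coherent_subsheaf F (Syz d n f)"
    and C: "\<And>j. j < N \<Longrightarrow> comb_linear (C j)"
      "\<And>p s j. p \<in> P1 \<Longrightarrow> s \<in> stalk (Syz d n f) p \<Longrightarrow> j < N \<Longrightarrow> C j s \<in> twist_stalk m p"
      "\<And>s. s \<in> generic_stalk (Syz d n f) \<Longrightarrow> (\<And>j. j < N \<Longrightarrow> C j s = 0) \<Longrightarrow> s = (\<lambda>_. 0)"
  shows "sheaf_degree F \<le> int (sheaf_rank F) * m"
proof -
  obtain r v W S where v: "module_basis function_field (generic_stalk F) r v"
    and W: "\<And>p. p \<in> P1 \<Longrightarrow> module_basis (local_ring p) (stalk F p) r (W p)"
    and S: "finite S" "\<And>p. p \<in> P1 \<Longrightarrow> p \<notin> S \<Longrightarrow> module_basis (local_ring p) (stalk F p) r v"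
    using coherent_bases[OF F] by metis
  have rank: "sheaf_rank F = r" using v by (rule sheaf_rank_eq)
  have stalk_sub: "s \<in> stalk (Syz d n f) p" if "s \<in> stalk F p" for s p
    using that section_subset[OF F] unfolding stalk_def by blast
  have gen_sub: "s \<in> generic_stalk (Syz d n f)" if "s \<in> generic_stalk F" for s
    using that section_subset[OF F] unfolding generic_stalk_def by blast
  have Cgen: "C j s \<in> graded m" if s: "s \<in> generic_stalk (Syz d n f)" and j: "j < N" for j s
  proof -
    obtain U where U: "zariski_open U" "U \<noteq> {}" "s \<in> Syz d n f U" using s unfolding generic_stalk_def by blast
    then obtain p where p: "p \<in> U" "p \<in> P1" using open_subset_P1 by blast
    have "s \<in> stalk (Syz d n f) p" using U p(1) unfolding stalk_def by blast
    then show ?thesis using C(2)[OF p(2) _ j] twist_stalk_graded[OF p(2)] by blast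
  qed
  have memv: "v i \<in> generic_stalk F" if "i < r" for i using module_basis_memD[OF v that] .
  have "\<exists>\<sigma>. (\<forall>i<r. \<sigma> i < N) \<and> det (mat r r (\<lambda>(i, j). C (\<sigma> j) (v i))) \<noteq> 0"
  proof (rule graded_minor[where v = "\<lambda>i j. C j (v i)"])
    show "C j (v i) \<in> graded m" if "i < r" "j < N" for i j using Cgen gen_sub memv that by blast
    fix c i assume c: "\<And>i. i < r \<Longrightarrow> c i \<in> function_field" "\<And>j. j < N \<Longrightarrow> (\<Sum>i<r. c i * C j (v i)) = 0" "i < r"
    \<comment> \<open>A relation between the rows of values gives a vector killed by every
      functional. Before injectivity applies, it has to be recognised as an element of the generic
      stalk of the syzygy bundle.\<close>
    let ?s = "\<lambda>l. \<Sum>i<r. c i * v i l"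
    have vi: "v i l \<in> graded (- int d)" if "i < r" "l < n" for i l
      using gen_sub[OF memv[OF that(1)]] that(2) unfolding generic_stalk_Syz by blast
    have "c i * v i l \<in> graded (- int d)" if "i < r" "l < n" for i l
      using gr.fracs_mult_eq[of "c i" 0 "v i l" "- int d" "- int d"] c(1)[OF that(1)] vi[OF that]
      unfolding function_field_graded by simp
    then have "?s l \<in> graded (- int d)" if "l < n" for l
      using that by (intro gr.fracs_sum) auto
    moreover have "?s l = 0" if "l \<ge> n" for l
    proof (rule sum.neutral, rule ballI)
      fix i assume "i \<in> {..<r}"
      then have "v i l = 0" using gen_sub[OF memv] that unfolding generic_stalk_Syz by auto
      then show "c i * v i l = 0" by simp
    qed
    moreover have "(\<Sum>l<n. Fract (f l) 1 * ?s l) = 0"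
    proof -
      have "(\<Sum>l<n. Fract (f l) 1 * ?s l) = (\<Sum>i<r. c i * (\<Sum>l<n. Fract (f l) 1 * v i l))"
        unfolding sum_distrib_left by (subst sum.swap) (simp only: mult.left_commute)
      also have "\<dots> = 0"
      proof (rule sum.neutral, rule ballI)
        fix i assume "i \<in> {..<r}"
        then have "(\<Sum>l<n. Fract (f l) 1 * v i l) = 0"
          using gen_sub[OF memv] unfolding generic_stalk_Syz by blast
        then show "c i * (\<Sum>l<n. Fract (f l) 1 * v i l) = 0" by simp
      qed
      finally show ?thesis .
    qed
    ultimately have "?s \<in> generic_stalk (Syz d n f)" unfolding generic_stalk_Syz by blast
    moreover have "C j ?s = 0" if "j < N" for j
      using C(1)[OF that] c(2)[OF that] unfolding comb_linear_def by metis
    ultimately have "?s = (\<lambda>_. 0)" by (rule C(3))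
    then show "c i = 0" using v c(1,3) unfolding module_basis_altdef independent_over_def by blast
  qed
  then obtain \<sigma> where \<sigma>: "\<And>j. j < r \<Longrightarrow> \<sigma> j < N" "det (mat r r (\<lambda>(i, j). C (\<sigma> j) (v i))) \<noteq> 0" by blast
  define L where "L j = C (\<sigma> j)" for j
  have L: "\<And>j. j < r \<Longrightarrow> comb_linear (L j)" using C(1) \<sigma>(1) by (simp add: L_def)
  have nz: "functional_det L r v \<noteq> 0" using \<sigma>(2) by (simp add: functional_det_def L_def)
  have "functional_det L r v \<in> graded (int r * m)"
    unfolding functional_det_def L_def using Cgen gen_sub memv \<sigma>(1) by (intro gr.fracs_det) blast
  then have fin_v: "finite {p \<in> P1. order_at p (functional_det L r v) \<noteq> 0}"
    using has_total_finite[OF has_total_order[OF _ nz]] by blast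
  let ?\<mu> = "\<lambda>p. order_at p (functional_det L r (W p))"
  have nonneg: "?\<mu> p \<ge> 0" if p: "p \<in> P1" for p
  proof -
    interpret R: denominators "\<lambda>h. nonvanishing h p" using p by (rule denominators_nonvanishing)
    have "functional_det L r (W p) \<in> twist_stalk (int r * m) p"
      unfolding functional_det_def L_def twist_stalk_fracs
    proof (rule R.fracs_det)
      fix i j assume "i < r" "j < r"
      then show "C (\<sigma> j) (W p i) \<in> fracs m (\<lambda>h. nonvanishing h p)"
        using C(2)[OF p stalk_sub[OF module_basis_memD[OF W[OF p]]] \<sigma>(1)] by (simp add: twist_stalk_fracs)
    qed
    moreover have "functional_det L r (W p) \<noteq> 0"
      by (rule functional_det_basis_nonzero[OF L local_basis_generic[OF p W[OF p] v] memv nz])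
    ultimately show ?thesis using order_at_stalk[OF p] by blast
  qed
  \<comment> \<open>Outside \<open>S\<close> the rational basis \<open>v\<close> is itself a local
    basis, so the local order is that of one fixed nonzero fraction, which is nonzero at finitely
    many points only.\<close>
  have "{p \<in> P1. ?\<mu> p \<noteq> 0} \<subseteq> S \<union> {p \<in> P1. order_at p (functional_det L r v) \<noteq> 0}"
  proof
    fix p assume p: "p \<in> {p \<in> P1. ?\<mu> p \<noteq> 0}"
    show "p \<in> S \<union> {p \<in> P1. order_at p (functional_det L r v) \<noteq> 0}"
    proof (cases "p \<in> S")
      case False
      then have "?\<mu> p = order_at p (functional_det L r v)"
        using functional_det_local_bases[of p r L "stalk F p" v "W p"] p L S(2) W nz by blast
      then show ?thesis using p by auto
    qed blast
  qed
  then have "finite {p \<in> P1. ?\<mu> p \<noteq> 0}" using S(1) fin_v finite_subset by blast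
  then have total: "has_total ?\<mu> (sum ?\<mu> {p \<in> P1. ?\<mu> p \<noteq> 0})" by (simp add: has_total_def)
  have "L j s \<in> graded m" if "s \<in> generic_stalk F" "j < r" for s j
    unfolding L_def using Cgen gen_sub that \<sigma>(1) by blast
  then have "sheaf_degree F = int r * m - sum ?\<mu> {p \<in> P1. ?\<mu> p \<noteq> 0}"
    using sheaf_degree_eq[OF W v L _ nz total] by blast
  moreover have "sum ?\<mu> {p \<in> P1. ?\<mu> p \<noteq> 0} \<ge> 0" using has_total_nonneg[OF total] nonneg by blast
  ultimately show ?thesis using rank by simp
qed


section \<open>Existence of syzygies\<close>

lemma coeff_monomial:
  "coeff (coeff (X0 ^ a * X1 ^ b) j) i = (if j = b \<and> i = a then 1 else 0)"
proof -
  have "X0 ^ a = [:monom 1 a :: 'a poly:]"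
    by (induction a) (simp_all add: X0_def monom_Suc one_pCons)
  moreover have "X1 ^ b = monom (1 :: 'a poly) b"
    by (induction b) (simp_all add: X1_def monom_Suc)
  ultimately show ?thesis by (simp add: smult_monom)
qed

lemma coeff_const_mult: "coeff (coeff ([:[:c:]:] * g) j) i = c * coeff (coeff g j) i"
  by simp

lemma homogeneous_eq_0I:
  assumes hom: "homogeneous k g" and "\<And>i. i < k + 1 \<Longrightarrow> coeff (coeff g (k - i)) i = 0"
  shows "g = 0"
proof (intro poly_eqI)
  fix j i show "coeff (coeff g j) i = coeff (coeff 0 j) i"
    using homogeneousD[OF hom, of i j] assms(2)[of i] by (cases "i + j = k") auto
qed

lemma monomial_homogeneous: "is_monomial k g \<Longrightarrow> homogeneous k g"
  unfolding is_monomial_def by (auto intro: homogeneous_mult)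

text \<open>The unknowns are the \<open>n (e + 1)\<close> coefficients of \<open>n\<close> forms of
  degree \<open>e\<close>; the equations are the \<open>d + e + 1\<close> coefficients of a form of
  degree \<open>d + e\<close>. If the rows of this system were independent, a nonzero minor would
  bound the number of unknowns by the number of equations.\<close>

lemma syzygy_exists:
  fixes f :: "nat \<Rightarrow> 'a::field poly poly"
  assumes f: "\<And>i. i < n \<Longrightarrow> homogeneous d (f i)" and large: "d + e + 1 < n * (e + 1)"
  obtains G i0 where "\<And>i. i < n \<Longrightarrow> homogeneous e (G i)" "i0 < n" "G i0 \<noteq> 0" "(\<Sum>i<n. f i * G i) = 0"
proof -
  define N where "N = n * (e + 1)"
  \<comment> \<open>An unknown \<open>u\<close> stands for the pair of the index
    \<open>u div (e + 1)\<close> of a form and the exponent \<open>u mod (e + 1)\<close> of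
    \<open>X0\<close> in a monomial of degree \<open>e\<close>.\<close>
  define mon where "mon u = X0 ^ (u mod (e + 1)) * (X1 ^ (e - u mod (e + 1)) :: 'a poly poly)" for u
  have mon_hom: "homogeneous e (mon u)" for u
  proof -
    have "homogeneous (u mod (e + 1) + (e - u mod (e + 1))) (mon u)"
      unfolding mon_def by (intro homogeneous_mult) simp_all
    moreover have "u mod (e + 1) \<le> e" using mod_less_divisor[of "e + 1" u] by simp
    ultimately show ?thesis by simp
  qed
  define v where "v u b = coeff (coeff (f (u div (e + 1)) * mon u) (d + e - b)) b" for u b
  have row: "u div (e + 1) < n" if "u < N" for u
    using that unfolding N_def by (simp add: less_mult_imp_div_less)
  have "\<not> (\<forall>c. (\<forall>b<d + e + 1. (\<Sum>u<N. c u * v u b) = 0) \<longrightarrow> (\<forall>u<N. c u = 0))"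
  proof
    assume "\<forall>c. (\<forall>b<d + e + 1. (\<Sum>u<N. c u * v u b) = 0) \<longrightarrow> (\<forall>u<N. c u = 0)"
    then have "\<exists>s. (\<forall>i<N. s i < d + e + 1) \<and> det (mat N N (\<lambda>(i, j). v i (s j))) \<noteq> 0"
      by (intro minor_nonzero[of UNIV]) auto
    then have "N \<le> d + e + 1" using minor_nonzero_card_le by blast
    then show False using large N_def by simp
  qed
  then obtain c u0 where c: "\<And>b. b < d + e + 1 \<Longrightarrow> (\<Sum>u<N. c u * v u b) = 0" and u0: "u0 < N" "c u0 \<noteq> 0"
    by blast
  define G where "G i = (\<Sum>u\<in>{u \<in> {..<N}. u div (e + 1) = i}. [:[:c u:]:] * mon u)" for i
  have G_hom: "homogeneous e (G i)" for i
    unfolding G_def using homogeneous_mult[OF homogeneous_const mon_hom]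
    by (intro homogeneous_sum) simp
  \<comment> \<open>The monomials belonging to one form are distinct, so the nonzero unknown
    \<open>c u0\<close> reappears as a coefficient of that form.\<close>
  have "coeff (coeff (G (u0 div (e + 1))) (e - u0 mod (e + 1))) (u0 mod (e + 1)) = c u0"
  proof -
    have "coeff (coeff (G (u0 div (e + 1))) (e - u0 mod (e + 1))) (u0 mod (e + 1))
        = (\<Sum>u\<in>{u \<in> {..<N}. u div (e + 1) = u0 div (e + 1)}.
            c u * coeff (coeff (mon u) (e - u0 mod (e + 1))) (u0 mod (e + 1)))"
      unfolding G_def coeff_sum by (simp only: coeff_const_mult)
    also have "\<dots> = (\<Sum>u\<in>{u \<in> {..<N}. u div (e + 1) = u0 div (e + 1)}. if u = u0 then c u0 else 0)"
    proof (rule sum.cong[OF refl])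
      fix u assume "u \<in> {u \<in> {..<N}. u div (e + 1) = u0 div (e + 1)}"
      then have "u mod (e + 1) = u0 mod (e + 1) \<longleftrightarrow> u = u0"
        by (metis (mono_tags, lifting) mem_Collect_eq mult_div_mod_eq)
      then show "c u * coeff (coeff (mon u) (e - u0 mod (e + 1))) (u0 mod (e + 1)) = (if u = u0 then c u0 else 0)"
        unfolding mon_def coeff_monomial by auto
    qed
    also have "\<dots> = c u0" using u0(1) by simp
    finally show ?thesis .
  qed
  then have G_nz: "G (u0 div (e + 1)) \<noteq> 0" using u0(2) by auto
  have expand: "(\<Sum>i<n. f i * G i) = (\<Sum>u<N. [:[:c u:]:] * (f (u div (e + 1)) * mon u))"
  proof -
    have "(\<Sum>i<n. f i * G i) = (\<Sum>i<n. \<Sum>u\<in>{u \<in> {..<N}. u div (e + 1) = i}. [:[:c u:]:] * (f (u div (e + 1)) * mon u))"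
      unfolding G_def sum_distrib_left by (intro sum.cong refl) (auto simp only: mem_Collect_eq mult.left_commute)
    also have "\<dots> = (\<Sum>u<N. [:[:c u:]:] * (f (u div (e + 1)) * mon u))"
      by (rule sum.group) (use row in auto)
    finally show ?thesis .
  qed
  have "(\<Sum>i<n. f i * G i) = 0"
  proof (rule homogeneous_eq_0I)
    show "homogeneous (d + e) (\<Sum>i<n. f i * G i)"
      by (intro homogeneous_sum homogeneous_mult G_hom) (simp add: f)
    show "coeff (coeff (\<Sum>i<n. f i * G i) (d + e - b)) b = 0" if "b < d + e + 1" for b
      using c[OF that] unfolding expand coeff_sum by (simp only: coeff_const_mult v_def)
  qed
  then show thesis by (intro that[of G "u0 div (e + 1)"] G_hom row u0(1) G_nz)
qed

section \<open>Ideals primary to the irrelevant ideal\<close>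

interpretation ring_mod: Modules.module "(*) :: 'r::comm_ring_1 \<Rightarrow> 'r \<Rightarrow> 'r"
  by unfold_locales (simp_all add: algebra_simps)

lemma ideal_generated_vanishing:
  fixes S :: "'a::field poly poly set"
  assumes "\<And>g. g \<in> S \<Longrightarrow> eval_form g a b = 0" "g \<in> ideal_generated S"
  shows "eval_form g a b = 0"
proof -
  have "ideal_generated S \<subseteq> {g. eval_form g a b = 0}"
    unfolding ideal_generated_def
    by (rule ring_mod.span_minimal) (use assms(1) in \<open>auto simp: ring_mod.subspace_def\<close>)
  then show ?thesis using assms(2) by blast
qed

text \<open>Some powers of \<open>X0\<close> and \<open>X1\<close> lie in the ideal, so both
  coordinates of a common zero would vanish.\<close>

lemma primary_no_common_zero:
  fixes f :: "nat \<Rightarrow> 'a::field poly poly"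
  assumes f: "\<And>i. i < n \<Longrightarrow> homogeneous d (f i)" and prim: "generates_primary n f" and p: "p \<in> P1"
  shows "\<exists>k<n. nonvanishing (f k) p"
proof (rule ccontr)
  assume none: "\<not> (\<exists>k<n. nonvanishing (f k) p)"
  obtain a b where ab: "(a, b) \<noteq> (0, 0)" "p = pt a b" using p by (rule P1E)
  have zero: "eval_form g a b = 0" if "g \<in> f ` {..<n}" for g
    using that none nonvanishing_pt[OF f] ab(2) by blast
  have rad: "ideal_radical (ideal_generated (f ` {..<n})) = ideal_generated {X0, X1}"
    using prim by (simp add: generates_primary_def Let_def)
  have "eval_form l a b = 0" if l: "l \<in> {X0, X1}" for l
  proof -
    have "l \<in> ideal_generated {X0, X1}" unfolding ideal_generated_def using l by (rule ring_mod.span_base)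
    then obtain k where "l ^ k \<in> ideal_generated (f ` {..<n})"
      unfolding rad[symmetric] ideal_radical_def by blast
    then have "eval_form (l ^ k) a b = 0" by (rule ideal_generated_vanishing[rotated]) (rule zero)
    then show ?thesis by simp
  qed
  from this[of X0] this[of X1] show False using ab(1) by simp
qed

lemma ideal_generated_X0_X1: "ideal_generated {X0, X1} = {g :: 'a::field poly poly. eval_form g 0 0 = 0}"
proof (rule equalityI; rule subsetI)
  fix g :: "'a poly poly" assume "g \<in> ideal_generated {X0, X1}"
  then have "eval_form g 0 0 = 0" by (rule ideal_generated_vanishing[rotated]) auto
  then show "g \<in> {g. eval_form g 0 0 = 0}" by simp
next
  fix g :: "'a poly poly" assume "g \<in> {g. eval_form g 0 0 = 0}"
  then have g0: "eval_form g 0 0 = 0" by simp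
  obtain c q where g: "g = pCons c q" by (rule pCons_cases)
  obtain c0 c' where c: "c = pCons c0 c'" by (rule pCons_cases)
  have "c0 = 0" using g0 by (simp add: g c eval_form_def)
  then have eq: "g = [:c':] * X0 + q * X1" by (simp add: g c X0_def X1_def)
  show "g \<in> ideal_generated {X0, X1}"
    unfolding ideal_generated_def eq
    by (intro ring_mod.span_add ring_mod.span_scale ring_mod.span_base) blast+
qed

text \<open>In a power \<open>2 d\<close> of an element of \<open>(X0, X1)\<close>, every term of
  the binomial expansion contains \<open>X0 ^ d\<close> or \<open>X1 ^ d\<close>; this gives the
  radical. If \<open>x * y\<close> is in \<open>I\<close> and \<open>y\<close> has constant term
  \<open>c\<close> nonzero, then \<open>c - y\<close> is nilpotent modulo \<open>I\<close>, so
  \<open>y\<close> is a unit modulo \<open>I\<close> and \<open>x\<close> is in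
  \<open>I\<close>.\<close>

lemma primary_idealI:
  fixes I :: "'a::field poly poly set"
  assumes I: "module.subspace (*) I" and pow: "X0 ^ d \<in> I" "X1 ^ d \<in> I"
    and zero: "\<And>g. g \<in> I \<Longrightarrow> eval_form g 0 0 = 0"
  shows "primary_ideal I" "ideal_radical I = ideal_generated {X0, X1}"
proof -
  have absorb: "c * x \<in> I" if "x \<in> I" for c x using ring_mod.subspace_scale[OF I that] .
  have rad: "g ^ (2 * d) \<in> I" if "eval_form g 0 0 = 0" for g
  proof -
    obtain c q where g: "g = pCons c q" by (rule pCons_cases)
    obtain c0 c' where c: "c = pCons c0 c'" by (rule pCons_cases)
    have "c0 = 0" using that by (simp add: g c eval_form_def)
    then have "g = [:c':] * X0 + q * X1" by (simp add: g c X0_def X1_def)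
    then have "g ^ (2 * d) = (\<Sum>k\<le>2 * d. of_nat (2 * d choose k) * ([:c':] * X0) ^ k * (q * X1) ^ (2 * d - k))"
      by (simp only: binomial_ring)
    also have "\<dots> \<in> I"
    proof (rule ring_mod.subspace_sum[OF I])
      fix k assume "k \<in> {..2 * d}"
      show "of_nat (2 * d choose k) * ([:c':] * X0) ^ k * (q * X1) ^ (2 * d - k) \<in> I"
      proof (cases "k \<ge> d")
        case True
        then have xk: "X0 ^ k = X0 ^ (k - d) * X0 ^ d" by (simp flip: power_add)
        have "of_nat (2 * d choose k) * ([:c':] * X0) ^ k * (q * X1) ^ (2 * d - k)
          = (of_nat (2 * d choose k) * [:c':] ^ k * X0 ^ (k - d) * (q * X1) ^ (2 * d - k)) * X0 ^ d"
          unfolding power_mult_distrib xk by (simp only: mult_ac)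
        then show ?thesis by (simp only: absorb[OF pow(1)])
      next
        case False
        then have "2 * d - k = d - k + d" by linarith
        then have xk: "X1 ^ (2 * d - k) = X1 ^ (d - k) * X1 ^ d" by (simp only: power_add)
        have "of_nat (2 * d choose k) * ([:c':] * X0) ^ k * (q * X1) ^ (2 * d - k)
          = (of_nat (2 * d choose k) * ([:c':] * X0) ^ k * q ^ (2 * d - k) * X1 ^ (d - k)) * X1 ^ d"
          unfolding power_mult_distrib xk by (simp only: mult_ac)
        then show ?thesis by (simp only: absorb[OF pow(2)])
      qed
    qed
    finally show ?thesis .
  qed
  show radical: "ideal_radical I = ideal_generated {X0, X1}"
    unfolding ideal_generated_X0_X1
  proof (rule equalityI; rule subsetI)
    fix g assume "g \<in> ideal_radical I"
    then obtain k where "g ^ k \<in> I" unfolding ideal_radical_def by blast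
    then have "eval_form (g ^ k) 0 0 = 0" by (rule zero)
    then show "g \<in> {g. eval_form g 0 0 = 0}" by simp
  qed (use rad in \<open>auto simp: ideal_radical_def\<close>)
  show "primary_ideal I" unfolding primary_ideal_def
  proof (intro conjI allI impI)
    show "module.subspace (*) I" by (rule I)
    show "I \<noteq> UNIV" using zero[of 1] by auto
    fix x y assume xy: "x * y \<in> I"
    show "x \<in> I \<or> y \<in> ideal_radical I"
    proof (cases "eval_form y 0 0 = 0")
      case True
      then show ?thesis unfolding radical ideal_generated_X0_X1 by simp
    next
      case False
      define c where "c = eval_form y 0 0"
      define C where "C = [:[:c:]:]"
      define t where "t = C - y"
      have "eval_form t 0 0 = 0" by (simp add: t_def C_def c_def)
      then have tI: "t ^ (2 * d) \<in> I" by (rule rad)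
      \<comment> \<open>The cofactor in \<open>C ^ (2 * d) - t ^ (2 * d) = (C - t) * S\<close>,
        where \<open>C - t\<close> is \<open>y\<close>.\<close>
      define S where "S = (\<Sum>i<2 * d. t ^ (2 * d - Suc i) * C ^ i)"
      have "C ^ (2 * d) - t ^ (2 * d) = y * S"
        unfolding S_def power_diff_sumr2 t_def by simp
      then have "C ^ (2 * d) = y * S + t ^ (2 * d)" by (simp add: algebra_simps)
      then have "x * C ^ (2 * d) = S * (x * y) + x * t ^ (2 * d)" by (simp only: distrib_left mult_ac)
      also have "\<dots> \<in> I" by (intro ring_mod.subspace_add[OF I] absorb xy tI)
      finally have "[:[:1 / c:]:] ^ (2 * d) * (x * C ^ (2 * d)) \<in> I" by (rule absorb)
      moreover have "[:[:1 / c:]:] ^ (2 * d) * (x * C ^ (2 * d)) = x"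
      proof -
        have "[:[:1 / c:]:] * C = 1" using False by (simp add: C_def c_def one_pCons)
        then have "[:[:1 / c:]:] ^ (2 * d) * C ^ (2 * d) = 1" by (metis power_mult_distrib power_one)
        moreover have "[:[:1 / c:]:] ^ (2 * d) * (x * C ^ (2 * d)) = x * ([:[:1 / c:]:] ^ (2 * d) * C ^ (2 * d))"
          by (simp only: mult_ac)
        ultimately show ?thesis by simp
      qed
      ultimately have "x \<in> I" by (simp only:)
      then show ?thesis ..
    qed
  qed
qed

section \<open>Equidistributed monomials\<close>

context
  fixes n d e :: nat and f :: "nat \<Rightarrow> 'a::alg_closed_field poly poly"
  assumes n: "2 \<le> n" and e: "0 < e" and d: "d = (n - 1) * e"
  defines "f \<equiv> \<lambda>i. X0 ^ (e * i) * X1 ^ (d - e * i)"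
begin

lemma e_le:
  assumes "i < n"
  shows "e * i \<le> d"
proof -
  have "i * e \<le> (n - 1) * e" by (rule mult_le_mono1) (use assms in simp)
  then show ?thesis by (simp only: d mult.commute)
qed

lemma equi_monomial: "i < n \<Longrightarrow> is_monomial d (f i)"
  unfolding is_monomial_def f_def using e_le
  by (intro exI[of _ "e * i"] exI[of _ "d - e * i"]) simp

lemma equi_inj: "inj_on f {..<n}"
proof (rule inj_onI)
  fix i j assume "i \<in> {..<n}" "j \<in> {..<n}" and eq: "f i = f j"
  have "coeff (coeff (f i) (d - e * i)) (e * i) = 1" unfolding f_def coeff_monomial by simp
  then have "coeff (coeff (f j) (d - e * i)) (e * i) = 1" using eq by simp
  then have "e * i = e * j" unfolding f_def coeff_monomial by (auto split: if_splits)
  then show "i = j" using e by simp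
qed

lemma equi_primary: "generates_primary n f"
proof -
  define I where "I = ideal_generated (f ` {..<n})"
  have sub: "module.subspace (*) I" unfolding I_def ideal_generated_def by (rule ring_mod.subspace_span)
  have mem: "f i \<in> I" if "i < n" for i
    unfolding I_def ideal_generated_def using that by (intro ring_mod.span_base) auto
  have "e * (n - 1) = d" by (simp add: d)
  then have X: "X0 ^ d \<in> I" "X1 ^ d \<in> I"
    using mem[of "n - 1"] mem[of 0] n by (simp_all add: f_def)
  have d0: "0 < d" using n e by (simp add: d)
  have "eval_form g 0 0 = 0" if "g \<in> I" for g
  proof (rule ideal_generated_vanishing[of "f ` {..<n}"])
    show "g \<in> ideal_generated (f ` {..<n})" using that by (simp add: I_def)
    fix h assume "h \<in> f ` {..<n}"
    then obtain i where "h = f i" by blast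
    moreover have "0 < e * i \<or> 0 < d - e * i" using d0 by linarith
    ultimately show "eval_form h 0 0 = 0" by (auto simp: f_def)
  qed
  then show ?thesis
    using primary_idealI[OF sub X] unfolding generates_primary_def Let_def I_def by blast
qed

lemma equi_rank_degree:
  "sheaf_rank (Syz d n f) = n - 1" "sheaf_degree (Syz d n f) = - int (n * d)"
proof -
  have hom: "\<And>i. i < n \<Longrightarrow> homogeneous d (f i)" using equi_monomial monomial_homogeneous by blast
  then have "\<And>p. p \<in> P1 \<Longrightarrow> \<exists>k<n. nonvanishing (f k) p"
    using primary_no_common_zero equi_primary by blast
  then show "sheaf_rank (Syz d n f) = n - 1" "sheaf_degree (Syz d n f) = - int (n * d)"
    using Syz_rank_degree[of n d f] hom by blast+
qed

text \<open>From \<open>d = (n - 1) e\<close> one has \<open>n d = (n - 1) (d + e)\<close>, so the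
  slope is an integer.\<close>

lemma equi_slope: "slope (Syz d n f) = - of_nat (d + e)"
proof -
  have "n * d = (n - 1) * (d + e)" using n by (cases n) (auto simp: d algebra_simps)
  moreover have "rat_of_nat (n - 1) \<noteq> 0" using n by simp
  ultimately show ?thesis unfolding slope_def equi_rank_degree by simp
qed

text \<open>The coordinates of a syzygy in the basis \<open>X\<^sub>1\<^sup>e e\<^bsub>j+1\<^esub> - X\<^sub>0\<^sup>e e\<^sub>j\<close>.\<close>

definition coord :: "nat \<Rightarrow> (nat \<Rightarrow> 'a poly poly fract) \<Rightarrow> 'a poly poly fract" where
  "coord j s = (\<Sum>i\<in>{..j}. - Fract (X1 ^ (e * (j - i))) (X0 ^ (e * (j + 1 - i))) * s i)"

text \<open>For \<open>s\<close> with coordinates \<open>c j\<close> one has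
  \<open>s i = X1^e c(i-1) - X0^e c(i)\<close>. By \<open>X1^e f(i) = X0^e f(i-1)\<close> the
  partial sums of the \<open>f(i) s(i)\<close> telescope to \<open>- X0^e f(j) c(j)\<close>; solving
  for \<open>c(j)\<close> gives the formula of \<open>coord\<close>.\<close>

lemma coord_eq:
  assumes "j < n"
  shows "Fract (f j * X0 ^ e) 1 * coord j s = - (\<Sum>i\<in>{..j}. Fract (f i) 1 * s i)"
proof -
  have neg: "x * (- y * w) = - (z * w)" if "x * y = z" for x y z w :: "'a poly poly fract"
    unfolding that[symmetric] by simp
  have "Fract (f j * X0 ^ e) 1 * (- Fract (X1 ^ (e * (j - i))) (X0 ^ (e * (j + 1 - i))) * s i) = - (Fract (f i) 1 * s i)"
    if i: "i \<le> j" for i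
  proof -
    have x0: "e * j + e = e * i + e * (j + 1 - i)" 
    proof -
      have "e * (j + 1) = e * (i + (j + 1 - i))" using i by simp
      then show ?thesis by (simp only: add_mult_distrib2 mult_1_right)
    qed
    have x1: "d - e * j + e * (j - i) = d - e * i"
    proof -
      have "e * j = e * i + e * (j - i)" using i by (simp flip: add_mult_distrib2)
      then show ?thesis using e_le[OF assms] by linarith
    qed
    have "f j * X0 ^ e * X1 ^ (e * (j - i)) = X0 ^ (e * j + e) * X1 ^ (d - e * j + e * (j - i))"
      unfolding f_def power_add by (simp only: mult_ac)
    also have "\<dots> = f i * X0 ^ (e * (j + 1 - i))"
      unfolding x0 x1 f_def power_add by (simp only: mult_ac)
    finally have "Fract (f j * X0 ^ e) 1 * Fract (X1 ^ (e * (j - i))) (X0 ^ (e * (j + 1 - i))) = Fract (f i) 1"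
      by (simp add: eq_fract)
    then show ?thesis by (rule neg)
  qed
  then show ?thesis unfolding coord_def sum_distrib_left sum_negf[symmetric]
    by (intro sum.cong) auto
qed

lemma f_nonzero: "f i \<noteq> 0"
  by (simp add: f_def)

text \<open>The syzygy relation replaces the sum up to \<open>j\<close> by minus the sum beyond
  \<open>j\<close>. The denominators then become powers of \<open>X1\<close> instead of
  \<open>X0\<close>.\<close>

lemma coord_altdef:
  assumes j: "j < n - 1" and s: "(\<Sum>i<n. Fract (f i) 1 * s i) = 0"
  shows "coord j s = (\<Sum>i\<in>{j + 1..<n}. Fract (X0 ^ (e * (i - j - 1))) (X1 ^ (e * (i - j))) * s i)"
    (is "_ = ?c")
proof -
  have "Fract (f j * X0 ^ e) 1 * (Fract (X0 ^ (e * (i - j - 1))) (X1 ^ (e * (i - j))) * s i) = Fract (f i) 1 * s i"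
    if i: "j + 1 \<le> i" "i < n" for i
  proof -
    have x0: "e * j + e + e * (i - j - 1) = e * i"
    proof -
      have "e * i = e * (j + 1 + (i - j - 1))" using i by simp
      then show ?thesis by (simp add: algebra_simps)
    qed
    have x1: "d - e * j = d - e * i + e * (i - j)"
    proof -
      have "e * i = e * (j + (i - j))" using i by simp
      then have "e * i = e * j + e * (i - j)" by (simp only: add_mult_distrib2)
      then show ?thesis using e_le[OF i(2)] by linarith
    qed
    have "f j * X0 ^ e * X0 ^ (e * (i - j - 1)) = X0 ^ (e * j + e + e * (i - j - 1)) * X1 ^ (d - e * j)"
      unfolding f_def power_add by (simp only: mult_ac)
    also have "\<dots> = f i * X1 ^ (e * (i - j))"
      unfolding x0 x1 f_def power_add by (simp only: mult_ac)
    finally have "Fract (f j * X0 ^ e) 1 * Fract (X0 ^ (e * (i - j - 1))) (X1 ^ (e * (i - j))) = Fract (f i) 1"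
      by (simp add: eq_fract)
    then show ?thesis by (simp only: mult.assoc[symmetric])
  qed
  then have "Fract (f j * X0 ^ e) 1 * ?c = (\<Sum>i\<in>{j + 1..<n}. Fract (f i) 1 * s i)"
    unfolding sum_distrib_left by (intro sum.cong) auto
  also have "\<dots> = - (\<Sum>i\<in>{..j}. Fract (f i) 1 * s i)"
  proof -
    have "{..<n} = {..j} \<union> {j + 1..<n}" using j by auto
    moreover have "(\<Sum>i\<in>{..j} \<union> {j + 1..<n}. Fract (f i) 1 * s i)
        = (\<Sum>i\<in>{..j}. Fract (f i) 1 * s i) + (\<Sum>i\<in>{j + 1..<n}. Fract (f i) 1 * s i)"
      by (rule sum.union_disjoint) auto
    ultimately have "(\<Sum>i<n. Fract (f i) 1 * s i) = (\<Sum>i\<in>{..j}. Fract (f i) 1 * s i) + (\<Sum>i\<in>{j + 1..<n}. Fract (f i) 1 * s i)"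
      by (simp only:)
    then show ?thesis using s by (simp add: eq_neg_iff_add_eq_0 add.commute)
  qed
  also have "\<dots> = Fract (f j * X0 ^ e) 1 * coord j s" using coord_eq[of j s] j by simp
  finally have eq: "Fract (f j * X0 ^ e) 1 * ?c = Fract (f j * X0 ^ e) 1 * coord j s" .
  have "Fract (f j * X0 ^ e) 1 \<noteq> 0" by (simp add: Zero_fract_def eq_fract f_nonzero)
  from iffD1[OF mult_left_cancel[OF this] eq] show ?thesis by (rule sym)
qed

text \<open>At each point \<open>X0\<close> or \<open>X1\<close> is nonzero, and the one of the two
  formulas with its powers as denominators shows regularity. The fractions have degree
  \<open>- e\<close>, the coordinates of \<open>s\<close> degree \<open>- d\<close>.\<close>

lemma coord_stalk:
  assumes p: "p \<in> P1" and s: "s \<in> stalk (Syz d n f) p" and j: "j < n - 1"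
  shows "coord j s \<in> twist_stalk (- int (d + e)) p"
proof -
  interpret R: denominators "\<lambda>h. nonvanishing h p" using p by (rule denominators_nonvanishing)
  have si: "s i \<in> fracs (- int d) (\<lambda>h. nonvanishing h p)" if "i < n" for i
    using s that unfolding stalk_Syz[OF p] twist_stalk_fracs by blast
  have syz: "(\<Sum>i<n. Fract (f i) 1 * s i) = 0" using s unfolding stalk_Syz[OF p] by blast
  obtain l where l: "l \<in> {X0, X1}" "nonvanishing l p" using nonvanishing_X0_X1[OF p] by blast
  show ?thesis
  proof (cases "l = X0")
    case True
    show ?thesis unfolding coord_def twist_stalk_fracs
    proof (rule R.fracs_sum)
      fix i assume "i \<in> {..j}"
      then have i: "i \<le> j" "i < n" using j by auto
      have "e * (j + 1 - i) = e * (j - i) + e" using i by (simp add: Suc_diff_le)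
      then have "Fract (X1 ^ (e * (j - i))) (X0 ^ (e * (j + 1 - i))) \<in> fracs (- int e) (\<lambda>h. nonvanishing h p)"
        by (intro R.fracsI[OF homogeneous_X1_power homogeneous_X0_power]) (use l True in auto)
      then show "- Fract (X1 ^ (e * (j - i))) (X0 ^ (e * (j + 1 - i))) * s i \<in> fracs (- int (d + e)) (\<lambda>h. nonvanishing h p)"
        by (intro R.fracs_mult_eq[OF R.fracs_uminus si[OF i(2)]]) simp_all
    qed
  next
    case False
    then have X1: "nonvanishing X1 p" using l by auto
    show ?thesis unfolding coord_altdef[OF j syz] twist_stalk_fracs
    proof (rule R.fracs_sum)
      fix i assume "i \<in> {j + 1..<n}"
      then have i: "j + 1 \<le> i" "i < n" by auto
      have "e * (i - j) = e * (i - j - 1) + e"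
      proof -
        have "i - j = (i - j - 1) + 1" using i by simp
        then show ?thesis by (metis add_mult_distrib2 mult.right_neutral)
      qed
      then have "Fract (X0 ^ (e * (i - j - 1))) (X1 ^ (e * (i - j))) \<in> fracs (- int e) (\<lambda>h. nonvanishing h p)"
        by (intro R.fracsI[OF homogeneous_X0_power homogeneous_X1_power]) (use X1 in auto)
      then show "Fract (X0 ^ (e * (i - j - 1))) (X1 ^ (e * (i - j))) * s i \<in> fracs (- int (d + e)) (\<lambda>h. nonvanishing h p)"
        by (intro R.fracs_mult_eq[OF _ si[OF i(2)]]) simp_all
    qed
  qed
qed

text \<open>Each term \<open>f(i) s(i)\<close> is the difference of two consecutive partial sums,
  and these vanish with the coordinates.\<close>

lemma coord_injective:
  assumes s: "s \<in> generic_stalk (Syz d n f)" and zero: "\<And>j. j < n - 1 \<Longrightarrow> coord j s = 0"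
  shows "s = (\<lambda>_. 0)"
proof
  fix i
  have syz: "(\<Sum>i<n. Fract (f i) 1 * s i) = 0" and out: "\<And>i. i \<ge> n \<Longrightarrow> s i = 0"
    using s unfolding generic_stalk_Syz by blast+
  \<comment> \<open>The coordinates control the sums of length 1 to \<open>n - 1\<close>; length 0
    is the empty sum and length \<open>n\<close> is the syzygy relation.\<close>
  have partial: "(\<Sum>i<j. Fract (f i) 1 * s i) = 0" if "j \<le> n" for j
  proof -
    consider "j = 0" | "j = n" | k where "j = Suc k" "k < n - 1"
    proof (cases j)
      case (Suc k)
      then show thesis using \<open>j \<le> n\<close> that(2) that(3)[of k] by (cases "j = n") auto
    qed (use that(1) in blast)
    then show ?thesis
    proof cases
      case 3
      then show ?thesis using coord_eq[of k s] zero[of k] by (simp add: lessThan_Suc_atMost)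
    qed (use syz in auto)
  qed
  show "s i = 0"
  proof (cases "i < n")
    case True
    then have "Fract (f i) 1 * s i = 0" using partial[of "Suc i"] partial[of i] by simp
    moreover have "Fract (f i) 1 \<noteq> 0" by (simp add: Zero_fract_def eq_fract f_nonzero)
    ultimately show ?thesis by simp
  qed (use out in auto)
qed

text \<open>The \<open>n - 1\<close> functionals \<open>coord j\<close> of degree
  \<open>- (d + e)\<close> bound the slope of every subsheaf by exactly the slope of the
  bundle.\<close>

lemma equi_semistable: "slope_semistable (Syz d n f)"
  unfolding slope_semistable_def
proof (intro allI impI)
  fix F :: "'a sheaf"
  assume F: "coherent_subsheaf F (Syz d n f) \<and> 0 < sheaf_rank F \<and> sheaf_rank F < sheaf_rank (Syz d n f)"
  have "sheaf_degree F \<le> int (sheaf_rank F) * (- int (d + e))"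
  proof (rule coherent_degree_le[of F d n f "n - 1" coord])
    show "comb_linear (coord j)" for j unfolding coord_def by (rule comb_linear_sum)
  qed (use F coord_stalk coord_injective in blast)+
  then have "rat_of_int (sheaf_degree F) \<le> rat_of_int (int (sheaf_rank F) * (- int (d + e)))"
    by (simp only: of_int_le_iff)
  then have "rat_of_int (sheaf_degree F) \<le> - rat_of_nat (d + e) * rat_of_nat (sheaf_rank F)"
    by (simp add: algebra_simps)
  then have "slope F \<le> - rat_of_nat (d + e)"
    unfolding slope_def using F by (simp add: divide_le_eq)
  then show "slope F \<le> slope (Syz d n f)" unfolding equi_slope .
qed

text \<open>The bundle has rank 1, so there is no rank strictly between 0 and that of the bundle to
  be tested.\<close>

lemma equi_stable: "n = 2 \<Longrightarrow> slope_stable (Syz d n f)"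
  unfolding slope_stable_def equi_rank_degree by auto

text \<open>The relation between the first two monomials spans a line subsheaf of degree
  \<open>- (d + e)\<close>, which is the slope of the bundle. Its rank 1 is below
  \<open>n - 1\<close> because \<open>n > 2\<close>.\<close>

lemma equi_not_stable:
  assumes "n \<noteq> 2"
  shows "\<not> slope_stable (Syz d n f)"
proof
  assume stable: "slope_stable (Syz d n f)"
  define G :: "nat \<Rightarrow> 'a poly poly" where
    "G i = (if i = 0 then - (X0 ^ e) else if i = 1 then X1 ^ e else 0)" for i
  have G: "homogeneous e (G i)" for i by (simp add: G_def homogeneous_uminus)
  have "e \<le> d" using e_le[of 1] n by simp
  have "(\<Sum>i<n. f i * G i) = (\<Sum>i\<in>{0, 1}. f i * G i)"
    by (rule sum.mono_neutral_right) (use n in \<open>auto simp: G_def\<close>)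
  also have "\<dots> = X0 ^ e * (X1 ^ (d - e) * X1 ^ e) - X1 ^ d * X0 ^ e"
    by (simp add: G_def f_def)
  also have "\<dots> = 0" using \<open>e \<le> d\<close> by (simp flip: power_add)
  finally have syz: "(\<Sum>i<n. f i * G i) = 0" .
  have i0: "0 < n" "G 0 \<noteq> 0" using n by (auto simp: G_def)
  have "coherent_subsheaf (line_sheaf (d + e) n G) (Syz d n f)"
    using G i0 syz by (rule line_sheaf_coherent)
  moreover have rd: "sheaf_rank (line_sheaf (d + e) n G) = 1" "sheaf_degree (line_sheaf (d + e) n G) = - int (d + e)"
    using line_sheaf_rank_degree[of n e G 0] G i0 by blast+
  ultimately have "slope (line_sheaf (d + e) n G) < slope (Syz d n f)"
    using stable assms n unfolding slope_stable_def equi_rank_degree(1) by auto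
  moreover have "slope (line_sheaf (d + e) n G) = - rat_of_nat (d + e)" unfolding slope_def rd by simp
  ultimately show False unfolding equi_slope by simp
qed

end

section \<open>Degrees not divisible by n - 1\<close>

lemma not_semistable:
  fixes f :: "nat \<Rightarrow> 'a::alg_closed_field poly poly"
  assumes n: "2 \<le> n" and ndvd: "\<not> (n - 1) dvd d"
    and f: "\<And>i. i < n \<Longrightarrow> homogeneous d (f i)" and prim: "generates_primary n f"
  shows "\<not> slope_semistable (Syz d n f)"
proof
  assume semistable: "slope_semistable (Syz d n f)"
  obtain k where k: "n = Suc k" "0 < k" using n by (cases n) auto
  \<comment> \<open>Since 1 divides \<open>d\<close>, the bundle has rank at least 2, and
    semistability has something to say about line subsheaves.\<close>
  have "k \<noteq> 1" using ndvd k by auto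
  define m where "m = n * d div k"
  define e where "e = m - d"
  have nd: "n * d = k * d + d" using k by simp
  have md: "d \<le> m" unfolding m_def nd less_eq_div_iff_mult_less_eq[OF k(2)] by (simp add: mult.commute)
  \<comment> \<open>The dimension count: with \<open>m = d + e\<close> this is the inequality
    required by \<open>syzygy_exists\<close>.\<close>
  have upper: "n * d < k * (m + 1)"
    unfolding m_def using dividend_less_times_div[OF k(2), of "n * d"] by simp
  \<comment> \<open>The strict inequality of slopes. Non-divisibility enters here, as
    \<open>n d\<close> and \<open>d\<close> are congruent modulo \<open>k\<close>.\<close>
  have lower: "k * m < n * d"
  proof -
    have "\<not> k dvd n * d" using ndvd k unfolding nd by (simp add: dvd_add_right_iff)
    then have "k * m \<noteq> n * d" by (metis dvd_triv_left)
    moreover have "k * m \<le> n * d" unfolding m_def by simp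
    ultimately show ?thesis by simp
  qed
  have "d + e + 1 < n * (e + 1)"
  proof -
    have "m = d + e" using md by (simp add: e_def)
    then show ?thesis using upper by (simp add: k(1) algebra_simps)
  qed
  then obtain G i0 where G: "\<And>i. i < n \<Longrightarrow> homogeneous e (G i)" "i0 < n" "G i0 \<noteq> 0" "(\<Sum>i<n. f i * G i) = 0"
    using syzygy_exists[of n d f e, OF f] by blast
  have m: "m = d + e" using md by (simp add: e_def)
  have "coherent_subsheaf (line_sheaf m n G) (Syz d n f)"
    unfolding m using G by (rule line_sheaf_coherent)
  moreover have rd: "sheaf_rank (line_sheaf m n G) = 1" "sheaf_degree (line_sheaf m n G) = - int m"
    using line_sheaf_rank_degree[of n e G i0] G(1-3) by blast+
  moreover have Syz: "sheaf_rank (Syz d n f) = k" "sheaf_degree (Syz d n f) = - int (n * d)"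
    using Syz_rank_degree[of n d f] f primary_no_common_zero[OF f prim] k by auto
  ultimately have "slope (line_sheaf m n G) \<le> slope (Syz d n f)"
    using semistable k \<open>k \<noteq> 1\<close> unfolding slope_semistable_def by auto
  then have "rat_of_nat (n * d) / rat_of_nat k \<le> rat_of_nat m"
    unfolding slope_def rd Syz by simp
  then have "rat_of_nat (n * d) \<le> rat_of_nat (k * m)"
    using k(2) by (simp add: divide_le_eq mult.commute)
  then show False using lower by (simp only: of_nat_le_iff)
qed

theorem theorem2p1:
  fixes d n :: nat
  assumes "2 \<le> n" and "n \<le> d + 1"
  shows
    "((n - 1) dvd d \<longrightarrow>
        (\<exists>f :: nat \<Rightarrow> 'a::alg_closed_field poly poly.
           (\<forall>i<n. is_monomial d (f i)) \<and> inj_on f {..<n} \<and> generates_primary n f \<and>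
           slope_semistable (Syz d n f) \<and>
           (n = 2 \<longrightarrow> slope_stable (Syz d n f)) \<and>
           (n \<noteq> 2 \<longrightarrow> \<not> slope_stable (Syz d n f))))
     \<and> (\<not> (n - 1) dvd d \<longrightarrow>
        \<not> (\<exists>f :: nat \<Rightarrow> 'a poly poly.
             (\<forall>i<n. is_monomial d (f i)) \<and> generates_primary n f \<and>
             slope_semistable (Syz d n f)))
     \<and> (\<not> (n - 1) dvd d \<longrightarrow>
        (\<forall>f :: nat \<Rightarrow> 'a poly poly.
           (\<forall>i<n. homogeneous d (f i)) \<and> generates_primary n f \<longrightarrow>
           \<not> slope_semistable (Syz d n f)))"
proof (intro conjI impI allI)
  assume "(n - 1) dvd d"
  then obtain e where e: "d = (n - 1) * e" by (rule dvdE)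
  \<comment> \<open>\<open>e = 0\<close> would give \<open>d = 0\<close>, and then
    \<open>n \<le> d + 1\<close> contradicts \<open>2 \<le> n\<close>.\<close>
  then have e0: "0 < e" using assms by (cases "e = 0") auto
  show "\<exists>f :: nat \<Rightarrow> 'a poly poly. (\<forall>i<n. is_monomial d (f i)) \<and> inj_on f {..<n} \<and>
      generates_primary n f \<and> slope_semistable (Syz d n f) \<and>
      (n = 2 \<longrightarrow> slope_stable (Syz d n f)) \<and> (n \<noteq> 2 \<longrightarrow> \<not> slope_stable (Syz d n f))"
  proof (intro exI[of _ "\<lambda>i. X0 ^ (e * i) * X1 ^ (d - e * i)"] conjI allI impI)
    note eqs = assms(1) e0 e
    show "is_monomial d (X0 ^ (e * i) * X1 ^ (d - e * i) :: 'a poly poly)" if "i < n" for i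
      by (rule equi_monomial[OF eqs that])
    show "inj_on (\<lambda>i. X0 ^ (e * i) * X1 ^ (d - e * i) :: 'a poly poly) {..<n}" by (rule equi_inj[OF eqs])
    show "generates_primary n (\<lambda>i. X0 ^ (e * i) * X1 ^ (d - e * i) :: 'a poly poly)" by (rule equi_primary[OF eqs])
    show "slope_semistable (Syz d n (\<lambda>i. X0 ^ (e * i) * X1 ^ (d - e * i) :: 'a poly poly))"
      by (rule equi_semistable[OF eqs])
    show "slope_stable (Syz d n (\<lambda>i. X0 ^ (e * i) * X1 ^ (d - e * i) :: 'a poly poly))" if "n = 2"
      by (rule equi_stable[OF eqs that])
    show "\<not> slope_stable (Syz d n (\<lambda>i. X0 ^ (e * i) * X1 ^ (d - e * i) :: 'a poly poly))" if "n \<noteq> 2"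
      by (rule equi_not_stable[OF eqs that])
  qed
next
  assume ndvd: "\<not> (n - 1) dvd d"
  show "\<not> (\<exists>f :: nat \<Rightarrow> 'a poly poly. (\<forall>i<n. is_monomial d (f i)) \<and> generates_primary n f \<and>
      slope_semistable (Syz d n f))"
  proof
    assume "\<exists>f :: nat \<Rightarrow> 'a poly poly. (\<forall>i<n. is_monomial d (f i)) \<and> generates_primary n f \<and>
      slope_semistable (Syz d n f)"
    then obtain f :: "nat \<Rightarrow> 'a poly poly" where f: "\<forall>i<n. is_monomial d (f i)"
      "generates_primary n f" "slope_semistable (Syz d n f)" by blast
    then have "homogeneous d (f i)" if "i < n" for i using monomial_homogeneous that by blast
    from not_semistable[OF assms(1) ndvd this f(2)] f(3) show False by simp
  qed
  show "\<not> slope_semistable (Syz d n f)"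
    if "(\<forall>i<n. homogeneous d (f i)) \<and> generates_primary n f" for f :: "nat \<Rightarrow> 'a poly poly"
    by (rule not_semistable[OF assms(1) ndvd]) (use that in auto)
qed

end
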